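(* Let $t\ge 2$ be a fixed integer and let $X$ be a real random variable with $X>0$ almost surely and distribution function $F_X(x)=\mathsf{P}(X\le x)$. Suppose that $$\lim_{x\to 0+}\frac{x}{\sqrt[t-1]{F_X(x)}}=a\quad\text{for some } a\in(0,+\infty).$$ For each $n$ let $\tilde{\mathfrak{G}}_n$ be the complete $t$-uniform hypergraph on $n$ vertices whose edge weights are independent and identically distributed random variables distributed as $X$, and let $\mathrm{MST}(\tilde{\mathfrak{G}}_n)$ be the weight of its minimum spanning subgraph. Put $$L_t=\sqrt[t-1]{(t-1)!}\;\frac{t-1}{t^2}\int_0^1\left(\frac{\ln(1-x)}{(1-x)^{t-1}-1}\right)^{t/(t-1)}\left(1-(1-x)^{t-1}\right)dx,$$ $$U_t=\sqrt[t-1]{(t-1)!}\;\frac{t-1}{t}\int_0^1\left(\frac{\ln(1-x)}{(1-x)^{t-1}-1}\right)^{t/(t-1)}x^{t-1}\,dx.$$ Then for every $\varepsilon>0$, $$\mathsf{P}\left(\mathrm{MST}(\tilde{\mathfrak{G}}_n)\in(aL_t-\varepsilon,\;aU_t+\varepsilon)\right)\to 1\quad\text{as } n\to\infty.$$ Moreover, $U_t/L_t=O(\log t)$ as $t\to\infty$.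
   Context: A hypergraph is $t$-uniform if every edge consists of $t$ distinct vertices; the complete $t$-uniform hypergraph on $n$ vertices has all $\binom{n}{t}$ such edges. A hypergraph is called connected if replacing each of its edges by a clique on the same set of vertices yields a connected graph. A minimum spanning subgraph of a weighted hypergraph $\tilde G$ is a connected subhypergraph $H$ containing all vertices of $\tilde G$ whose sum of edge weights is minimal; $\mathrm{MST}(\tilde G)$ denotes this minimal sum. For $t=2$, $\sqrt[t-1]{y}=y$. *)

theory Defs
  imports "HOL-Probability.Probability" "HOL-Library.Ramsey"
begin

definition clique_expansion :: "'v set set \<Rightarrow> ('v \<times> 'v) set" where
  "clique_expansion H = {(u, v). u \<noteq> v \<and> (\<exists>e\<in>H. u \<in> e \<and> v \<in> e)}"

definition hg_connected :: "'v set \<Rightarrow> 'v set set \<Rightarrow> bool" where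
  "hg_connected V H \<longleftrightarrow> (\<forall>u\<in>V. \<forall>v\<in>V. (u, v) \<in> (clique_expansion H)\<^sup>*)"

(* A subhypergraph containing all vertices is determined by its edge set.
   The value is meaningful only if the hypergraph (V, E) is itself connected and E is finite;
   for the complete t-uniform hypergraph on n vertices, t >= 2, this holds whenever n >= t. *)
definition mst_weight :: "'v set \<Rightarrow> 'v set set \<Rightarrow> ('v set \<Rightarrow> real) \<Rightarrow> real" where
  "mst_weight V E w = Min {\<Sum>e\<in>H. w e | H. H \<subseteq> E \<and> hg_connected V H}"

(* The open interval keeps the integrands away from the end points, where they are
   0/0 and ln 0 respectively. *)
definition L_const :: "nat \<Rightarrow> real" where
  "L_const t = root (t - 1) (fact (t - 1)) * ((real t - 1) / (real t)\<^sup>2) *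
     (LBINT x:{0<..<1}. (ln (1 - x) / ((1 - x) ^ (t - 1) - 1)) powr (real t / (real t - 1))
        * (1 - (1 - x) ^ (t - 1)))"

definition U_const :: "nat \<Rightarrow> real" where
  "U_const t = root (t - 1) (fact (t - 1)) * ((real t - 1) / real t) *
     (LBINT x:{0<..<1}. (ln (1 - x) / ((1 - x) ^ (t - 1) - 1)) powr (real t / (real t - 1))
        * x ^ (t - 1))"

end

theory Submission
  imports Defs "HOL-Real_Asymp.Real_Asymp"
begin

text \<open>
  Write \<open>s = 1 / (t - 1)\<close> and let \<open>c\<close> be the mean vertex degree of the hypergraph \<open>G\<^sub>c\<close> of all edges of
  weight at most \<open>a ((t - 1)! c)\<^sup>s / n\<close>; a giant component of \<open>G\<^sub>c\<close> has about \<open>x n\<close> vertices when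
  \<open>c = ln (1 - x) / ((1 - x)\<^bsup>t-1\<^esup> - 1)\<close>.

  Lower bound. Rooting a connected spanning \<open>H\<close> assigns to every vertex but the root one of its edges, and
  each edge to at most \<open>t - 1\<close> vertices, so \<open>(t - 1) w(H)\<close> is at least the sum of the minimal edge weights
  at these vertices. That sum is governed by the numbers of isolated vertices of the \<open>G\<^sub>c\<close>, which a second
  moment controls, and is asymptotically \<open>a ((t - 1)!)\<^sup>s\<close> times the integral of \<open>(- ln q)\<^sup>s\<close> over the unit
  interval; this is already at least \<open>(t - 1) a L\<^sub>t\<close>.

  Upper bound. Along a fine mesh of levels take every edge appearing between two consecutive levels unless
  it lies inside the giant component of the lower one. This keeps all connectivity and costs about
  \<open>a ((t - 1)!)\<^sup>s\<close> times the integral of \<open>c\<^sup>s (1 - x\<^sup>t) / t\<close> with respect to \<open>c\<close>, which is \<open>a U\<^sub>t\<close>. The few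
  vertices left outside the giant component at a large level are joined to it through dyadic levels.

  The giant component comes from a linear-size set of green vertices: the probability that a vertex is not
  connected to it satisfies, up to \<open>o(1)\<close>, the recursion \<open>u \<mapsto> exp (- c (1 - u\<^bsup>t-1\<^esup>))\<close> as single vertices are
  removed, and sprinkling further edges merges the few components of green vertices.
\<close>

section \<open>Expectations over random subsets\<close>

text \<open>For \<open>t > 2\<close> greedy selection need not be optimal: one edge may join up to
  \<open>t\<close> components or overlap what is already connected. Hence the two bounds rest on
  different structures and do not meet. The scaling comes from
  \<open>F w ~ (w / a) ^ (t - 1)\<close> near 0. A vertex lies in about
  \<open>n ^ (t - 1) / (t - 1)!\<close> edges, which gives mean degree \<open>c\<close> at the
  stated level, and about \<open>n dc / t\<close> edges appear while the mean degree grows by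
  \<open>dc\<close>. An edge lies inside a set of \<open>x n\<close> vertices with probability about
  \<open>x ^ t\<close>; this explains \<open>(1 - x ^ t) / t\<close>. Integration by parts replaces
  \<open>c powr s\<close> by its primitive \<open>c powr (1 + s) / (1 + s)\<close>, and
  \<open>1 / (1 + s) = (t - 1) / t\<close> yields the form of \<open>U_const\<close>. The cost falls
  as the giant component grows, so a lower bound on its size is what must be established. Every
  random event involves one level or two. The joint law of two level sets is reduced to the finite
  sum \<open>bexp\<close>, where all estimates are made, and a union bound over a mesh fixed before
  \<open>n\<close> tends to infinity collects them.\<close>

definition bexp :: "real \<Rightarrow> 'e set \<Rightarrow> ('e set \<Rightarrow> real) \<Rightarrow> real" where
  "bexp p E \<phi> = (\<Sum>A\<in>Pow E. p ^ card A * (1 - p) ^ card (E - A) * \<phi> A)"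

lemma bexp_empty [simp]: "bexp p {} \<phi> = \<phi> {}"
  by (simp add: bexp_def)

lemma bexp_cong: "(\<And>A. A \<subseteq> E \<Longrightarrow> \<phi> A = \<psi> A) \<Longrightarrow> bexp p E \<phi> = bexp p E \<psi>"
  by (auto simp: bexp_def intro!: sum.cong)

lemma bexp_insert:
  assumes "finite E" "e \<notin> E"
  shows "bexp p (insert e E) \<phi> = (1 - p) * bexp p E \<phi> + p * bexp p E (\<lambda>A. \<phi> (insert e A))"
proof -
  let ?g = "\<lambda>A. p ^ card A * (1 - p) ^ card (insert e E - A) * \<phi> A"
  have inj: "inj_on (insert e) (Pow E)" using assms(2) by (auto simp: inj_on_def)
  have "bexp p (insert e E) \<phi> = sum ?g (Pow E) + sum ?g (insert e ` Pow E)"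
    unfolding bexp_def Pow_insert using assms by (intro sum.union_disjoint) auto
  also have "sum ?g (Pow E) = (1 - p) * bexp p E \<phi>"
    unfolding bexp_def sum_distrib_left
  proof (rule sum.cong)
    fix A assume "A \<in> Pow E"
    then have "insert e E - A = insert e (E - A)" "e \<notin> E - A" "finite (E - A)" using assms by auto
    then show "?g A = (1 - p) * (p ^ card A * (1 - p) ^ card (E - A) * \<phi> A)" by simp
  qed simp
  also have "sum ?g (insert e ` Pow E) = (\<Sum>A\<in>Pow E. ?g (insert e A))"
    using inj by (simp add: sum.reindex)
  also have "\<dots> = p * bexp p E (\<lambda>A. \<phi> (insert e A))"
    unfolding bexp_def sum_distrib_left
  proof (rule sum.cong)
    fix A assume A: "A \<in> Pow E"
    then have "insert e E - insert e A = E - A" "e \<notin> A" "finite A"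
      using assms by (auto intro: finite_subset)
    then show "?g (insert e A) = p * (p ^ card A * (1 - p) ^ card (E - A) * \<phi> (insert e A))"
      by simp
  qed simp
  finally show ?thesis .
qed

lemma bexp_add: "bexp p E (\<lambda>A. \<phi> A + \<psi> A) = bexp p E \<phi> + bexp p E \<psi>"
  by (simp add: bexp_def distrib_left sum.distrib)

lemma bexp_cmult: "bexp p E (\<lambda>A. k * \<phi> A) = k * bexp p E \<phi>"
  by (simp add: bexp_def sum_distrib_left mult_ac)

lemma bexp_sum: "bexp p E (\<lambda>A. \<Sum>i\<in>I. \<phi> i A) = (\<Sum>i\<in>I. bexp p E (\<phi> i))"
  unfolding bexp_def sum_distrib_left by (rule sum.swap)

lemma bexp_const [simp]: "finite E \<Longrightarrow> bexp p E (\<lambda>_. k) = k"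
  by (induction E rule: finite_induct) (simp_all add: bexp_insert algebra_simps)

lemma bexp_mono:
  assumes "0 \<le> p" "p \<le> 1" "\<And>A. A \<subseteq> E \<Longrightarrow> \<phi> A \<le> \<psi> A"
  shows "bexp p E \<phi> \<le> bexp p E \<psi>"
  unfolding bexp_def using assms by (intro sum_mono mult_left_mono) auto

lemma bexp_nonneg:
  assumes "0 \<le> p" "p \<le> 1" "\<And>A. A \<subseteq> E \<Longrightarrow> 0 \<le> \<phi> A"
  shows "0 \<le> bexp p E \<phi>"
  unfolding bexp_def using assms by (intro sum_nonneg) auto

lemma bexp_le_const:
  assumes "finite E" "0 \<le> p" "p \<le> 1" "\<And>A. A \<subseteq> E \<Longrightarrow> \<phi> A \<le> k"
  shows "bexp p E \<phi> \<le> k"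
  using bexp_mono[of p E \<phi> "\<lambda>_. k"] assms by simp

lemma bexp_markov:
  assumes "0 \<le> p" "p \<le> 1" "0 < k" "\<And>A. A \<subseteq> E \<Longrightarrow> 0 \<le> \<phi> A"
    "\<And>A. A \<subseteq> E \<Longrightarrow> Q A \<Longrightarrow> k \<le> \<phi> A"
  shows "bexp p E (\<lambda>A. of_bool (Q A)) \<le> bexp p E \<phi> / k"
proof -
  have "bexp p E (\<lambda>A. k * of_bool (Q A)) \<le> bexp p E \<phi>"
    by (rule bexp_mono) (use assms in auto)
  then show ?thesis using assms(3) by (simp add: bexp_cmult field_simps)
qed

lemma bexp_union:
  assumes "finite D" "finite E" "D \<inter> E = {}"
  shows "bexp p (D \<union> E) \<phi> = bexp p D (\<lambda>A. bexp p E (\<lambda>B. \<phi> (A \<union> B)))"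
  using assms(1,3)
proof (induction D arbitrary: \<phi> rule: finite_induct)
  case (insert e D)
  then show ?case using assms(2)
    by (simp add: bexp_insert)
qed simp

text \<open>Successive exposure: the part of the random set inside \<open>D\<close> is revealed
  before the rest, so events can be bounded conditionally on it.\<close>

lemma bexp_split:
  assumes "finite E" "D \<subseteq> E"
  shows "bexp p E \<phi> = bexp p D (\<lambda>A. bexp p (E - D) (\<lambda>B. \<phi> (A \<union> B)))"
  using bexp_union[of D "E - D" p \<phi>] assms by (simp add: Un_absorb1 finite_subset)

lemma bexp_Int:
  assumes "finite E" "T \<subseteq> E"
  shows "bexp p E (\<lambda>A. \<phi> (A \<inter> T)) = bexp p T \<phi>"
proof -
  have "bexp p E (\<lambda>A. \<phi> (A \<inter> T)) = bexp p T (\<lambda>A. bexp p (E - T) (\<lambda>B. \<phi> ((A \<union> B) \<inter> T)))"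
    by (rule bexp_split) (use assms in auto)
  also have "\<dots> = bexp p T (\<lambda>A. bexp p (E - T) (\<lambda>B. \<phi> A))"
    by (intro bexp_cong arg_cong[where f=\<phi>]) auto
  finally show ?thesis using assms by simp
qed

lemma bexp_disjoint:
  assumes "finite E" "T \<subseteq> E"
  shows "bexp p E (\<lambda>A. of_bool (A \<inter> T = {})) = (1 - p) ^ card T"
proof -
  have "finite T" using assms finite_subset by auto
  then have "bexp p T (\<lambda>A. of_bool (A = {})) = (1 - p) ^ card T"
  proof (induction T rule: finite_induct)
    case (insert e D)
    have "bexp p D (\<lambda>_. 0) = 0" using insert by simp
    then show ?case using insert by (simp add: bexp_insert)
  qed simp
  then show ?thesis using bexp_Int[OF assms, of p "\<lambda>A. of_bool (A = {})"] by simp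
qed

lemma bexp_card:
  assumes "finite E" "T \<subseteq> E"
  shows "bexp p E (\<lambda>A. real (card (A \<inter> T))) = p * card T"
proof -
  have "finite T" using assms finite_subset by auto
  then have "bexp p T (\<lambda>A. real (card A)) = p * card T"
  proof (induction T rule: finite_induct)
    case (insert e D)
    have "bexp p D (\<lambda>A. real (card (insert e A))) = bexp p D (\<lambda>A. 1 + real (card A))"
      using insert by (intro bexp_cong) (auto simp: card_insert_if finite_subset)
    then show ?case using insert by (simp add: bexp_insert bexp_add algebra_simps)
  qed simp
  then show ?thesis using bexp_Int[OF assms, of p "\<lambda>A. real (card A)"] by simp
qed

text \<open>The variance of a binomial variable, for the Chebyshev bound in
  \<open>whp_window\<close>. The second moment is computed by adding one element at a time, and the
  square is expanded afterwards.\<close>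

lemma bexp_card_sq:
  assumes "finite E" "T \<subseteq> E"
  shows "bexp p E (\<lambda>A. (real (card (A \<inter> T)) - p * card T)\<^sup>2) = p * (1 - p) * card T"
proof -
  have "finite T" using assms finite_subset by auto
  then have "bexp p T (\<lambda>A. (real (card A))\<^sup>2) = p * (1 - p) * card T + (p * card T)\<^sup>2"
  proof (induction T rule: finite_induct)
    case (insert e D)
    have "bexp p D (\<lambda>A. (real (card (insert e A)))\<^sup>2)
        = bexp p D (\<lambda>A. 1 + (2 * real (card A) + (real (card A))\<^sup>2))"
      using insert by (intro bexp_cong) (auto simp: card_insert_if finite_subset power2_eq_square algebra_simps)
    moreover have "bexp p D (\<lambda>A. real (card A)) = p * card D"
      using bexp_card[of D D p] insert(1) bexp_cong[of D "\<lambda>A. real (card (A \<inter> D))" "\<lambda>A. real (card A)" p]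
      by (simp add: Int_absorb2)
    ultimately show ?case using insert
      by (simp add: bexp_insert bexp_add bexp_cmult) (simp add: algebra_simps power2_eq_square)
  qed simp
  moreover have "bexp p T (\<lambda>A. real (card A)) = p * card T"
    using bexp_card[of T T p] \<open>finite T\<close> bexp_cong[of T "\<lambda>A. real (card (A \<inter> T))" "\<lambda>A. real (card A)" p]
    by (simp add: Int_absorb2)
  moreover have "bexp p T (\<lambda>A. (real (card A) - p * card T)\<^sup>2)
      = bexp p T (\<lambda>A. (real (card A))\<^sup>2 + ((- 2 * p * card T) * real (card A) + (p * card T)\<^sup>2))"
    by (intro bexp_cong) (auto simp: power2_eq_square algebra_simps)
  then have "bexp p T (\<lambda>A. (real (card A) - p * card T)\<^sup>2) = bexp p T (\<lambda>A. (real (card A))\<^sup>2)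
      + ((- 2 * p * card T) * bexp p T (\<lambda>A. real (card A)) + (p * card T)\<^sup>2)"
    using \<open>finite T\<close> by (simp only: bexp_add bexp_cmult bexp_const)
  ultimately have "bexp p T (\<lambda>A. (real (card A) - p * card T)\<^sup>2) = p * (1 - p) * card T"
    by (simp add: algebra_simps power2_eq_square)
  then show ?thesis using bexp_Int[OF assms, of p "\<lambda>A. (real (card A) - p * card T)\<^sup>2"] by simp
qed

section \<open>Connectivity in hypergraphs\<close>

abbreviation reach :: "'v set set \<Rightarrow> ('v \<times> 'v) set" where
  "reach A \<equiv> (clique_expansion A)\<^sup>*"

lemma reach_mono: "A \<subseteq> B \<Longrightarrow> reach A \<subseteq> reach B"
  by (intro rtrancl_mono) (auto simp: clique_expansion_def)

lemma reach_edge: "e \<in> A \<Longrightarrow> u \<in> e \<Longrightarrow> v \<in> e \<Longrightarrow> (u, v) \<in> reach A"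
  by (cases "u = v") (auto simp: clique_expansion_def intro!: r_into_rtrancl)

lemma reach_sym: "(u, v) \<in> reach A \<Longrightarrow> (v, u) \<in> reach A"
proof -
  have "sym (clique_expansion A)" by (auto simp: sym_def clique_expansion_def)
  then show "(u, v) \<in> reach A \<Longrightarrow> (v, u) \<in> reach A" by (meson sym_rtrancl symD)
qed

lemma reach_subset:
  assumes "\<Gamma> \<subseteq> V" "\<And>e. e \<in> A \<Longrightarrow> e \<subseteq> V"
  shows "reach A `` \<Gamma> \<subseteq> V"
proof
  fix v assume "v \<in> reach A `` \<Gamma>"
  then obtain u where u: "u \<in> \<Gamma>" "(u, v) \<in> reach A" by auto
  from u(2) show "v \<in> V"
    by (induction rule: rtrancl_induct) (use u(1) assms in \<open>auto simp: clique_expansion_def\<close>)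
qed

lemma reach_cover:
  assumes "\<And>e u v. e \<in> A \<Longrightarrow> u \<in> e \<Longrightarrow> v \<in> e \<Longrightarrow> (u, v) \<in> reach B"
  shows "reach A \<subseteq> reach B"
  by (rule rtrancl_subset_rtrancl) (use assms in \<open>auto simp: clique_expansion_def\<close>)

section \<open>Counting uniform edges and comparing binomial coefficients\<close>

lemma card_nsets:
  assumes "finite V"
  shows "card (nsets V k) = card V choose k"
proof -
  have "nsets V k = {B. B \<subseteq> V \<and> card B = k}"
    using assms finite_subset by (auto simp: nsets_def)
  then show ?thesis using n_subsets[OF assms] by simp
qed

lemma nsets_Suc_insert:
  assumes "v \<in> V" "\<sigma> \<in> nsets (V - K) k" "v \<in> K"
  shows "insert v \<sigma> \<in> nsets V (Suc k)"
  using assms by (auto simp: nsets_def card_insert_if)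

text \<open>An edge with exactly one vertex in \<open>K\<close> determines the pair: its traces
  inside and outside \<open>K\<close> are \<open>{v}\<close> and \<open>\<sigma>\<close>. This is
  how edges crossing a cut are counted.\<close>

lemma inj_on_attach:
  "inj_on (\<lambda>(v, \<sigma>). insert v \<sigma>) (K \<times> nsets (V - K) k)"
proof (rule inj_onI, clarify)
  fix v \<sigma> v' \<sigma>'
  assume h: "v \<in> K" "\<sigma> \<in> nsets (V - K) k" "v' \<in> K" "\<sigma>' \<in> nsets (V - K) k"
    "insert v \<sigma> = insert v' \<sigma>'"
  then have "\<sigma> \<inter> K = {}" "\<sigma>' \<inter> K = {}" by (auto simp: nsets_def)
  then have "insert v \<sigma> \<inter> K = {v}" "insert v' \<sigma>' \<inter> K = {v'}"
    "insert v \<sigma> - K = \<sigma>" "insert v' \<sigma>' - K = \<sigma>'" using h(1,3) by auto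
  then show "v = v' \<and> \<sigma> = \<sigma>'" using h(5) by simp
qed

text \<open>Factor by factor: each quotient \<open>(q - i) / (m - i)\<close> is at most
  \<open>b\<close>, for \<open>b \<le> 1\<close> because of \<open>q \<le> b * m\<close> and
  otherwise because of \<open>q \<le> m\<close>.\<close>

lemma choose_ratio_le:
  assumes "q \<le> b * real m" "0 \<le> b" "q \<le> m"
  shows "real (q choose r) \<le> b ^ r * real (m choose r)"
proof (cases "r \<le> q")
  case True
  then show ?thesis using assms(3)
  proof (induction r)
    case (Suc r)
    have IH: "real (q choose r) \<le> b ^ r * real (m choose r)" using Suc by simp
    have e: "(real r + 1) * real (n choose Suc r) = (real n - real r) * real (n choose r)"
      if "r \<le> n" for n
    proof -
      have "Suc r * (n choose Suc r) = (n - r) * (n choose r)"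
        by (metis binomial_absorb_comp binomial_absorption)
      then have "real (Suc r * (n choose Suc r)) = real ((n - r) * (n choose r))" by presburger
      then show ?thesis using that by (simp only: of_nat_mult of_nat_diff of_nat_Suc add.commute)
    qed
    have "real q - r \<le> b * (real m - r)"
    proof (cases "b \<le> 1")
      case True
      then have "b * real r \<le> real r" by (simp add: mult_left_le_one_le assms(2))
      then show ?thesis using assms(1) by (simp add: right_diff_distrib)
    next
      case False
      then have "real m - r \<le> b * (real m - r)"
        using Suc.prems mult_right_mono[of 1 b "real m - r"] by simp
      moreover have "real q \<le> real m" using Suc.prems by simp
      ultimately show ?thesis by linarith
    qed
    then have "(real q - r) * real (q choose r) \<le> (b * (real m - r)) * (b ^ r * real (m choose r))"
      using IH Suc.prems assms(2) by (intro mult_mono) auto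
    then have "(real r + 1) * real (q choose Suc r) \<le> (real r + 1) * (b ^ Suc r * real (m choose Suc r))"
      using e[of q] e[of m] Suc.prems by (simp add: mult_ac)
    then show ?case by (simp add: mult_le_cancel_left_pos)
  qed simp
next
  case False
  then show ?thesis using assms(2) by (simp add: binomial_eq_0)
qed

section \<open>The giant component\<close>

text \<open>Each of the \<open>r\<close> factors of the falling factorial of \<open>m\<close> is at
  least \<open>m - r\<close>; the induction runs over a separate \<open>k \<le> r\<close> to keep
  that bound fixed.\<close>

lemma choose_lower:
  assumes "r \<le> m"
  shows "(real m - real r) ^ r \<le> fact r * real (m choose r)"
proof -
  have "(real m - real r) ^ k \<le> fact k * real (m choose k)" if "k \<le> r" for k
    using that
  proof (induction k)
    case (Suc k)
    have "Suc k * (m choose Suc k) = (m - k) * (m choose k)"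
      by (metis binomial_absorb_comp binomial_absorption)
    then have "real (Suc k * (m choose Suc k)) = real ((m - k) * (m choose k))" by presburger
    then have e: "real (Suc k) * real (m choose Suc k) = (real m - real k) * real (m choose k)"
      using assms Suc.prems by (simp only: of_nat_mult of_nat_diff)
    have "(real m - real r) ^ Suc k \<le> (real m - real k) * (fact k * real (m choose k))"
      unfolding power_Suc using assms Suc by (intro mult_mono) auto
    also have "\<dots> = fact k * (real (Suc k) * real (m choose Suc k))"
      unfolding e by simp
    also have "\<dots> = fact (Suc k) * real (m choose Suc k)" by simp
    finally show ?case .
  qed simp
  then show ?thesis by simp
qed

lemma choose_upper: "fact r * real (m choose r) \<le> real m ^ r"
proof -
  have "real ((m choose r) * fact r) \<le> real (m ^ r)"
    using binomial_fact_pow by (intro of_nat_mono) blast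
  then show ?thesis by (simp add: mult.commute)
qed

lemma choose_ratio_ge:
  assumes "r \<le> m" "0 < n"
  shows "((real m - real r) / real n) ^ r * real (n choose r) \<le> real (m choose r)"
proof -
  have "((real m - real r) / real n) ^ r * (fact r * real (n choose r))
      \<le> ((real m - real r) / real n) ^ r * real n ^ r"
    using assms by (intro mult_left_mono choose_upper) auto
  also have "\<dots> = (real m - real r) ^ r" using assms by (simp add: power_divide)
  also have "\<dots> \<le> fact r * real (m choose r)" by (rule choose_lower[OF assms(1)])
  finally have "fact r * (((real m - real r) / real n) ^ r * real (n choose r))
      \<le> fact r * real (m choose r)" by (simp add: mult_ac)
  then show ?thesis by (simp add: mult_le_cancel_left_pos)
qed

text \<open>After removal of \<^term>\<open>K\<close> the cluster of \<^term>\<open>\<Gamma>\<close> only shrinks, and no edge with exactly one vertex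
  in \<^term>\<open>K\<close> may meet the smaller cluster; these edges are independent of that cluster.\<close>

lemma avoid_cluster_bound:
  assumes "finite V" "\<Gamma> \<subseteq> V" "K \<subseteq> V - \<Gamma>" "0 \<le> p" "p \<le> 1" "0 \<le> b" "b \<le> 1"
  shows "bexp p (nsets V (Suc r)) (\<lambda>A. of_bool (K \<inter> reach A `` \<Gamma> = {}))
    \<le> bexp p (nsets (V - K) (Suc r))
         (\<lambda>A. of_bool (b * real (card (V - K)) \<le> real (card (V - K - reach A `` \<Gamma>))))
       + exp (- (real (card K) * (p * real (card (V - K) choose r)) * (1 - b ^ r)))"
proof -
  let ?E = "nsets V (Suc r)" and ?D = "nsets (V - K) (Suc r)"
  \<comment> \<open>Edges with one vertex \<open>v\<close> in \<open>K\<close> whose other vertices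
    lie outside \<open>K\<close> and are not all unreached. A single one of them in \<open>B\<close>
    links \<open>K\<close> to \<open>\<Gamma>\<close>.\<close>
  define T where "T = (\<lambda>A. (\<lambda>(v, \<sigma>). insert v \<sigma>) `
     (K \<times> (nsets (V - K) r - nsets (V - K - reach A `` \<Gamma>) r)))"
  have finE: "finite ?E" using assms(1) by (rule finite_imp_finite_nsets)
  have DE: "?D \<subseteq> ?E" by (rule nsets_mono) auto
  have KV: "K \<subseteq> V" using assms(3) by auto
  have TE: "T A \<subseteq> ?E - ?D" for A
  proof
    fix e assume "e \<in> T A"
    then obtain v \<sigma> where e: "e = insert v \<sigma>" "v \<in> K" "\<sigma> \<in> nsets (V - K) r"
      by (auto simp: T_def)
    then have "e \<in> ?E" using nsets_Suc_insert[of v V \<sigma> K r] KV by auto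
    moreover have "e \<notin> ?D" using e by (auto simp: nsets_def)
    ultimately show "e \<in> ?E - ?D" by simp
  qed
  have key: "of_bool (K \<inter> reach (A \<union> B) `` \<Gamma> = {}) \<le> (of_bool (B \<inter> T A = {}) :: real)"
    if "A \<subseteq> ?D" for A B
  proof -
    have "K \<inter> reach (A \<union> B) `` \<Gamma> \<noteq> {}" if ne: "B \<inter> T A \<noteq> {}"
    proof -
      obtain e where "e \<in> B" "e \<in> T A" using ne by auto
      then obtain v \<sigma> where e: "e = insert v \<sigma>" "v \<in> K" "\<sigma> \<in> nsets (V - K) r"
        "\<sigma> \<notin> nsets (V - K - reach A `` \<Gamma>) r" by (auto simp: T_def)
      then obtain u where u: "u \<in> \<sigma>" "u \<in> reach A `` \<Gamma>" by (auto simp: nsets_def)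
      then obtain g where "g \<in> \<Gamma>" "(g, u) \<in> reach A" by auto
      moreover have "(u, v) \<in> reach (A \<union> B)"
        using reach_edge[of e "A \<union> B" u v] \<open>e \<in> B\<close> e(1) u(1) by auto
      ultimately have "(g, v) \<in> reach (A \<union> B)"
        using reach_mono[of A "A \<union> B"] by (auto intro: rtrancl_trans)
      then show ?thesis using \<open>g \<in> \<Gamma>\<close> e(2) by auto
    qed
    then show ?thesis by auto
  qed
  have cardT: "real (card (T A)) = real (card K) *
      (real (card (V - K) choose r) - real (card (V - K - reach A `` \<Gamma>) choose r))" for A
  proof -
    let ?N = "nsets (V - K) r" and ?N' = "nsets (V - K - reach A `` \<Gamma>) r"
    have sub: "?N' \<subseteq> ?N" by (rule nsets_mono) auto
    have fin: "finite ?N" "finite ?N'" using assms(1) by (auto intro!: finite_imp_finite_nsets)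
    have "inj_on (\<lambda>(v, \<sigma>). insert v \<sigma>) (K \<times> (?N - ?N'))"
      by (rule inj_on_subset[OF inj_on_attach]) auto
    then have "card (T A) = card K * card (?N - ?N')"
      unfolding T_def by (simp add: card_image card_cartesian_product)
    moreover have "real (card (?N - ?N')) = real (card ?N) - real (card ?N')"
      using card_Diff_subset[OF fin(2) sub] card_mono[OF fin(1) sub] by (simp only: of_nat_diff)
    ultimately show ?thesis using assms(1) by (simp add: card_nsets)
  qed
  have "bexp p ?E (\<lambda>A. of_bool (K \<inter> reach A `` \<Gamma> = {}))
      = bexp p ?D (\<lambda>A. bexp p (?E - ?D) (\<lambda>B. of_bool (K \<inter> reach (A \<union> B) `` \<Gamma> = {})))"
    by (rule bexp_split[OF finE DE])
  also have "\<dots> \<le> bexp p ?D (\<lambda>A. bexp p (?E - ?D) (\<lambda>B. of_bool (B \<inter> T A = {})))"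
    by (intro bexp_mono assms key) auto
  also have "\<dots> = bexp p ?D (\<lambda>A. (1 - p) ^ card (T A))"
    using TE finE by (intro bexp_cong bexp_disjoint) auto
  also have "\<dots> \<le> bexp p ?D (\<lambda>A.
         of_bool (b * real (card (V - K)) \<le> real (card (V - K - reach A `` \<Gamma>)))
       + exp (- (real (card K) * (p * real (card (V - K) choose r)) * (1 - b ^ r))))"
  proof (rule bexp_mono)
    fix A
    let ?Q = "card (V - K - reach A `` \<Gamma>)" and ?m = "card (V - K)"
    show "(1 - p) ^ card (T A) \<le> of_bool (b * real ?m \<le> real ?Q)
       + exp (- (real (card K) * (p * real (?m choose r)) * (1 - b ^ r)))"
    \<comment> \<open>Either the smaller cluster misses a proportion \<open>b\<close>, which the
      first term pays for, or \<open>T A\<close> is large enough to make its absence cost the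
      exponential.\<close>
    proof (cases "b * real ?m \<le> real ?Q")
      case True
      have "(1 - p) ^ card (T A) \<le> 1" using assms by (intro power_le_one) auto
      with True show ?thesis by (simp add: add_increasing2)
    next
      case False
      have "?Q \<le> ?m" using assms(1) by (intro card_mono) auto
      then have "real (?Q choose r) \<le> b ^ r * real (?m choose r)"
        using choose_ratio_le[of ?Q b ?m r] False assms by simp
      then have "real (card K) * (real (?m choose r) * (1 - b ^ r)) \<le> real (card (T A))"
        unfolding cardT by (intro mult_left_mono) (auto simp: algebra_simps)
      then have "p * (real (card K) * (real (?m choose r) * (1 - b ^ r))) \<le> p * real (card (T A))"
        using assms by (intro mult_left_mono)
      then have "exp (- p * real (card (T A)))
          \<le> exp (- (real (card K) * (p * real (?m choose r)) * (1 - b ^ r)))"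
        by (simp add: mult_ac)
      moreover have "(1 - p) ^ card (T A) \<le> exp (- p) ^ card (T A)"
        using assms exp_ge_add_one_self[of "- p"] by (intro power_mono) auto
      moreover have "exp (- p) ^ card (T A) = exp (- p * real (card (T A)))"
        by (simp add: exp_of_nat_mult[symmetric] mult.commute)
      ultimately have "(1 - p) ^ card (T A)
          \<le> exp (- (real (card K) * (p * real (?m choose r)) * (1 - b ^ r)))" by linarith
      then show ?thesis using False by simp
    qed
  qed (use assms in auto)
  also have "\<dots> = bexp p ?D
         (\<lambda>A. of_bool (b * real (card (V - K)) \<le> real (card (V - K - reach A `` \<Gamma>))))
       + exp (- (real (card K) * (p * real (card (V - K) choose r)) * (1 - b ^ r)))"
    using assms(1) by (simp add: bexp_add finite_imp_finite_nsets)
  finally show ?thesis .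
qed

section \<open>Iterating the recursion for the proportion of unreached vertices\<close>

definition far_prob :: "nat \<Rightarrow> real \<Rightarrow> 'v set \<Rightarrow> 'v set \<Rightarrow> real \<Rightarrow> real" where
  "far_prob t b V \<Gamma> p =
     bexp p (nsets V t) (\<lambda>A. of_bool (b * real (card V) \<le> real (card (V - reach A `` \<Gamma>))))"

text \<open>With high probability every set \<open>\<Gamma>\<close> of proportion \<open>h\<close>
  reaches all but a proportion \<open>b\<close>, when the mean degree is at least \<open>c\<close>.
  The bound \<open>n0\<close> is uniform in \<open>V\<close>, \<open>\<Gamma>\<close> and
  \<open>p\<close>, because \<open>spread_step\<close> applies the statement to \<open>V - K\<close>
  for many sets \<open>K\<close>.\<close>

definition spread :: "nat \<Rightarrow> real \<Rightarrow> real \<Rightarrow> real \<Rightarrow> bool" where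
  "spread t c h b \<longleftrightarrow> (\<forall>\<epsilon>>0. \<exists>n0. \<forall>(V::nat set) \<Gamma> p. finite V \<and> n0 \<le> card V \<and> \<Gamma> \<subseteq> V \<and>
     h * real (card V) \<le> real (card \<Gamma>) \<and> 0 \<le> p \<and> p \<le> 1 \<and>
     c \<le> p * real (card V choose (t - 1)) \<longrightarrow> far_prob t b V \<Gamma> p \<le> \<epsilon>)"

lemma far_prob_mono:
  assumes "b \<le> b'" "0 \<le> p" "p \<le> 1"
  shows "far_prob t b' V \<Gamma> p \<le> far_prob t b V \<Gamma> p"
  unfolding far_prob_def
proof (rule bexp_mono)
  fix A
  have "b * real (card V) \<le> b' * real (card V)" using assms(1) by (intro mult_right_mono) auto
  then show "of_bool (b' * real (card V) \<le> real (card (V - reach A `` \<Gamma>)))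
      \<le> (of_bool (b * real (card V) \<le> real (card (V - reach A `` \<Gamma>))) :: real)" by auto
qed (use assms in auto)

lemma spread_mono:
  assumes "spread t c h b" "c \<le> c'" "b \<le> b'"
  shows "spread t c' h b'"
  unfolding spread_def
proof (intro allI impI)
  fix \<epsilon> :: real assume "0 < \<epsilon>"
  with assms(1) obtain n0 where "\<forall>(V::nat set) \<Gamma> p. finite V \<and> n0 \<le> card V \<and> \<Gamma> \<subseteq> V \<and>
     h * real (card V) \<le> real (card \<Gamma>) \<and> 0 \<le> p \<and> p \<le> 1 \<and>
     c \<le> p * real (card V choose (t - 1)) \<longrightarrow> far_prob t b V \<Gamma> p \<le> \<epsilon>"
    unfolding spread_def by blast
  then show "\<exists>n0. \<forall>(V::nat set) \<Gamma> p. finite V \<and> n0 \<le> card V \<and> \<Gamma> \<subseteq> V \<and>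
     h * real (card V) \<le> real (card \<Gamma>) \<and> 0 \<le> p \<and> p \<le> 1 \<and>
     c' \<le> p * real (card V choose (t - 1)) \<longrightarrow> far_prob t b' V \<Gamma> p \<le> \<epsilon>"
    using far_prob_mono[OF assms(3)] assms(2) by (meson order_trans)
qed

text \<open>The vertices of \<open>\<Gamma>\<close> reach themselves, so at most a proportion
  \<open>1 - h\<close> is left, whatever the random set is. This starts the iteration.\<close>

lemma spread_base:
  assumes "1 - h < b"
  shows "spread t c h b"
  unfolding spread_def
proof (intro allI impI exI[of _ 1], elim conjE)
  fix \<epsilon> p :: real and V \<Gamma> :: "nat set"
  assume h: "0 < \<epsilon>" "finite V" "1 \<le> card V" "\<Gamma> \<subseteq> V" "h * real (card V) \<le> real (card \<Gamma>)"
    "0 \<le> p" "p \<le> 1"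
  have "far_prob t b V \<Gamma> p \<le> bexp p (nsets V t) (\<lambda>_. 0)"
    unfolding far_prob_def
  proof (rule bexp_mono)
    fix A
    have "card (V - reach A `` \<Gamma>) \<le> card (V - \<Gamma>)" using h by (intro card_mono) auto
    moreover have "card (V - \<Gamma>) = card V - card \<Gamma>" "card \<Gamma> \<le> card V"
      using h(2,4) finite_subset[of \<Gamma> V] card_Diff_subset[of \<Gamma> V] card_mono[of V \<Gamma>] by auto
    ultimately have "real (card (V - reach A `` \<Gamma>)) \<le> real (card V) - real (card \<Gamma>)" by linarith
    also have "\<dots> \<le> (1 - h) * real (card V)" using h(5) by (simp add: algebra_simps)
    also have "\<dots> < b * real (card V)" using assms h(3) by (intro mult_strict_right_mono) auto
    finally show "of_bool (b * real (card V) \<le> real (card (V - reach A `` \<Gamma>))) \<le> (0::real)" by simp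
  qed (use h in auto)
  then show "far_prob t b V \<Gamma> p \<le> \<epsilon>" using h by (simp add: finite_imp_finite_nsets)
qed

text \<open>A set of unreached vertices of size \<^term>\<open>b' * n\<close> contains many \<^term>\<open>k\<close>-sets avoiding the cluster, and
  such a \<^term>\<open>k\<close>-set costs about \<^term>\<open>\<rho> ^ k\<close>, where \<^term>\<open>\<rho> = exp (- c * (1 - b ^ (t - 1)))\<close>;
  large \<^term>\<open>k\<close> replaces a variance estimate.\<close>

lemma spread_step:
  assumes "spread t c h b" "2 \<le> t" "0 \<le> b" "b \<le> 1" "0 \<le> h"
    "exp (- c * (1 - b ^ (t - 1))) < b'" "c < c'"
  shows "spread t c' h b'"
proof -
  define r where "r = t - 1"
  have t: "t = Suc r" using assms(2) by (simp add: r_def)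
  define \<rho> where "\<rho> = exp (- c * (1 - b ^ r))"
  \<comment> \<open>Room between \<open>\<rho>\<close> and \<open>b'\<close>: the ratio
    \<open>\<rho> / \<beta>\<close> is below 1, so its \<open>k\<close>-th power can be made
    small.\<close>
  obtain \<beta> where \<beta>: "\<rho> < \<beta>" "\<beta> < b'" using assms(6) dense unfolding \<rho>_def r_def by blast
  have \<rho>: "0 < \<rho>" by (simp add: \<rho>_def)
  show ?thesis
    unfolding spread_def
  proof (intro allI impI)
    fix \<epsilon> :: real assume \<epsilon>: "0 < \<epsilon>"
    have "0 < \<rho> / \<beta>" "\<rho> / \<beta> < 1" using \<rho> \<beta> by auto
    then obtain k where k: "(\<rho> / \<beta>) ^ k < \<epsilon> / 2"
      using real_arch_pow_inv[of "\<epsilon> / 2" "\<rho> / \<beta>"] \<epsilon> by auto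
    \<comment> \<open>The Markov bound below divides by \<open>(\<beta> * n) ^ k\<close>; with this
      choice the error inherited from the hypothesis contributes exactly
      \<open>\<epsilon> / 2\<close>.\<close>
    define \<epsilon>1 where "\<epsilon>1 = \<epsilon> / 2 * \<beta> ^ k"
    have \<epsilon>1: "0 < \<epsilon>1" using \<epsilon> \<rho> \<beta> by (simp add: \<epsilon>1_def)
    with assms(1) obtain n0 where n0: "\<And>(V::nat set) \<Gamma> p. finite V \<and> n0 \<le> card V \<and> \<Gamma> \<subseteq> V \<and>
     h * real (card V) \<le> real (card \<Gamma>) \<and> 0 \<le> p \<and> p \<le> 1 \<and>
     c \<le> p * real (card V choose (t - 1)) \<longrightarrow> far_prob t b V \<Gamma> p \<le> \<epsilon>1"
      unfolding spread_def by blast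
    \<comment> \<open>Deleting \<open>k\<close> vertices multiplies the mean degree by a factor
      tending to 1, which the gap \<open>c < c'\<close> absorbs.\<close>
    have "(\<lambda>n. c' * ((real n - k - r) / real n) ^ r) \<longlonglongrightarrow> c' * 1 ^ r"
      by (intro tendsto_intros) real_asymp
    then have "eventually (\<lambda>n. c < c' * ((real n - k - r) / real n) ^ r) sequentially"
      using assms(7) by (intro order_tendstoD(1)) auto
    moreover have "eventually (\<lambda>n. real k < (b' - \<beta>) * real n) sequentially"
      using \<beta> by real_asymp
    ultimately have "eventually (\<lambda>n. c < c' * ((real n - k - r) / real n) ^ r \<and>
        real k < (b' - \<beta>) * real n \<and> n0 + k + r + 1 \<le> n) sequentially"
      using eventually_ge_at_top[of "n0 + k + r + 1"] by eventually_elim auto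
    then obtain n1 where n1: "\<And>n. n1 \<le> n \<Longrightarrow> c < c' * ((real n - k - r) / real n) ^ r \<and>
        real k < (b' - \<beta>) * real n \<and> n0 + k + r + 1 \<le> n"
      unfolding eventually_sequentially by blast
    show "\<exists>n0. \<forall>(V::nat set) \<Gamma> p. finite V \<and> n0 \<le> card V \<and> \<Gamma> \<subseteq> V \<and>
       h * real (card V) \<le> real (card \<Gamma>) \<and> 0 \<le> p \<and> p \<le> 1 \<and>
       c' \<le> p * real (card V choose (t - 1)) \<longrightarrow> far_prob t b' V \<Gamma> p \<le> \<epsilon>"
    proof (intro exI[of _ n1] allI impI, elim conjE)
      fix V \<Gamma> :: "nat set" and p :: real
      assume h: "finite V" "n1 \<le> card V" "\<Gamma> \<subseteq> V" "h * real (card V) \<le> real (card \<Gamma>)"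
        "0 \<le> p" "p \<le> 1" "c' \<le> p * real (card V choose (t - 1))"
      let ?n = "card V" and ?E = "nsets V t"
      note n = n1[OF h(2)]
      have avoid: "bexp p ?E (\<lambda>A. of_bool (K \<inter> reach A `` \<Gamma> = {})) \<le> \<epsilon>1 + \<rho> ^ k"
        if K: "K \<in> nsets (V - \<Gamma>) k" for K
      proof -
        have K': "K \<subseteq> V - \<Gamma>" "card K = k" "finite K" using K by (auto simp: nsets_def)
        have cVK: "card (V - K) = ?n - k"
          using K' h(1) by (subst card_Diff_subset) auto
        have cd: "c \<le> p * real (card (V - K) choose r)"
        proof -
          have "c \<le> ((real ?n - k - r) / real ?n) ^ r * c'" using n by (simp add: mult.commute)
          also have "\<dots> \<le> ((real ?n - k - r) / real ?n) ^ r * (p * real (?n choose r))"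
            using h(7) n by (intro mult_left_mono zero_le_power divide_nonneg_nonneg) (auto simp: r_def)
          also have "\<dots> = p * (((real (?n - k) - r) / real ?n) ^ r * real (?n choose r))"
            using n by (simp add: of_nat_diff mult_ac)
          also have "\<dots> \<le> p * real ((?n - k) choose r)"
            using n h(5) by (intro mult_left_mono choose_ratio_ge) auto
          finally show ?thesis unfolding cVK .
        qed
        have "far_prob t b (V - K) \<Gamma> p \<le> \<epsilon>1"
        proof -
          \<comment> \<open>\<open>\<Gamma>\<close> stays intact while \<open>V\<close> shrinks, so
            its proportion does not drop below \<open>h\<close>.\<close>
          have "h * real (card (V - K)) \<le> h * real ?n"
            using cVK assms(5) by (intro mult_left_mono) auto
          then show ?thesis using n0[of "V - K" \<Gamma> p] h K' cVK cd n by (auto simp: r_def)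
        qed
        moreover have "exp (- (real (card K) * (p * real (card (V - K) choose r)) * (1 - b ^ r)))
            \<le> \<rho> ^ k"
        proof -
          have "0 \<le> 1 - b ^ r" using assms(3,4) by (simp add: power_le_one)
          then have "real k * (c * (1 - b ^ r)) \<le> real k * (p * real (card (V - K) choose r) * (1 - b ^ r))"
            using cd by (intro mult_left_mono mult_right_mono) auto
          then show ?thesis using K'(2) unfolding \<rho>_def exp_of_nat_mult[symmetric]
            by (simp add: mult_ac)
        qed
        ultimately show ?thesis
          using avoid_cluster_bound[OF h(1,3) K'(1) h(5,6) assms(3,4), of r]
          unfolding far_prob_def t by simp
      qed
      have pos: "0 < (\<beta> * real ?n) ^ k" using \<rho> \<beta> n by simp
      \<comment> \<open>Markov's inequality for \<open>fact k\<close> times the number of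
        \<open>k\<close>-sets that avoid the cluster, hence for the number of ordered tuples of
        distinct unreached vertices.\<close>
      have "far_prob t b' V \<Gamma> p
          \<le> bexp p ?E (\<lambda>A. fact k * (\<Sum>K\<in>nsets (V - \<Gamma>) k. of_bool (K \<inter> reach A `` \<Gamma> = {}))) / (\<beta> * real ?n) ^ k"
        unfolding far_prob_def
      proof (rule bexp_markov)
        fix A assume A: "A \<subseteq> ?E"
        show "0 \<le> fact k * (\<Sum>K\<in>nsets (V - \<Gamma>) k. (of_bool (K \<inter> reach A `` \<Gamma> = {}) :: real))"
          by (intro mult_nonneg_nonneg sum_nonneg) auto
        assume big: "b' * real ?n \<le> real (card (V - reach A `` \<Gamma>))"
        let ?Q = "V - reach A `` \<Gamma>"
        have sub: "\<Gamma> \<subseteq> reach A `` \<Gamma>" by auto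
        have bn: "\<beta> * real ?n \<le> real (card ?Q) - real k" using big n by (simp add: algebra_simps)
        then have "k \<le> card ?Q" using \<rho> \<beta> n
          by (smt (verit) mult_nonneg_nonneg of_nat_0_le_iff of_nat_le_iff)
        have "(\<beta> * real ?n) ^ k \<le> (real (card ?Q) - real k) ^ k"
          using bn \<rho> \<beta> by (intro power_mono) auto
        also have "\<dots> \<le> fact k * real (card ?Q choose k)" by (rule choose_lower) fact
        also have "real (card ?Q choose k) = real (card (nsets ?Q k))"
          using h(1) by (simp add: card_nsets)
        also have "\<dots> = (\<Sum>K\<in>nsets ?Q k. of_bool (K \<inter> reach A `` \<Gamma> = {}))"
        proof -
          have "of_bool (K \<inter> reach A `` \<Gamma> = {}) = (1::real)" if "K \<in> nsets ?Q k" for K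
            using that by (auto simp: nsets_def)
          then show ?thesis by simp
        qed
        also have "\<dots> \<le> (\<Sum>K\<in>nsets (V - \<Gamma>) k. of_bool (K \<inter> reach A `` \<Gamma> = {}))"
          using h(1) sub by (intro sum_mono2 finite_imp_finite_nsets nsets_mono) auto
        finally show "(\<beta> * real ?n) ^ k \<le> fact k * (\<Sum>K\<in>nsets (V - \<Gamma>) k. of_bool (K \<inter> reach A `` \<Gamma> = {}))"
          by simp
      qed (use h pos in auto)
      also have "bexp p ?E (\<lambda>A. fact k * (\<Sum>K\<in>nsets (V - \<Gamma>) k. of_bool (K \<inter> reach A `` \<Gamma> = {})))
          = fact k * (\<Sum>K\<in>nsets (V - \<Gamma>) k. bexp p ?E (\<lambda>A. of_bool (K \<inter> reach A `` \<Gamma> = {})))"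
        by (simp only: bexp_cmult bexp_sum)
      also have "\<dots> \<le> fact k * (\<Sum>K\<in>nsets (V - \<Gamma>) k. \<epsilon>1 + \<rho> ^ k)"
        using avoid by (intro mult_left_mono sum_mono) auto
      also have "\<dots> = (fact k * real (card (V - \<Gamma>) choose k)) * (\<epsilon>1 + \<rho> ^ k)"
        using h(1) by (simp add: card_nsets)
      also have "\<dots> \<le> real ?n ^ k * (\<epsilon>1 + \<rho> ^ k)"
      proof (rule mult_right_mono)
        have "fact k * real (card (V - \<Gamma>) choose k) \<le> real (card (V - \<Gamma>)) ^ k" by (rule choose_upper)
        also have "\<dots> \<le> real ?n ^ k" using h(1) by (intro power_mono) (auto intro: card_mono)
        finally show "fact k * real (card (V - \<Gamma>) choose k) \<le> real ?n ^ k" .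
      qed (use \<epsilon>1 \<rho> in auto)
      also have "real ?n ^ k * (\<epsilon>1 + \<rho> ^ k) / (\<beta> * real ?n) ^ k = \<epsilon> / 2 + (\<rho> / \<beta>) ^ k"
        using n \<rho> \<beta> by (simp add: \<epsilon>1_def power_mult_distrib power_divide field_simps)
      also have "\<dots> \<le> \<epsilon>" using k by simp
      finally show "far_prob t b' V \<Gamma> p \<le> \<epsilon>" using pos by (simp add: divide_right_mono)
    qed
  qed
qed

text \<open>At mean degree \<^term>\<open>cfun t x\<close> the number \<^term>\<open>1 - x\<close> is the fixed point of
  \<^term>\<open>\<lambda>u. exp (- cfun t x * (1 - u ^ (t - 1)))\<close> below 1.\<close>

definition cfun :: "nat \<Rightarrow> real \<Rightarrow> real" where
  "cfun t x = ln (1 - x) / ((1 - x) ^ (t - 1) - 1)"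

lemma cfun_eq:
  assumes "2 \<le> t" "0 < x" "x < 1"
  shows "cfun t x * (1 - (1 - x) ^ (t - 1)) = - ln (1 - x)"
proof -
  have "(1 - x) ^ (t - 1) < 1" using assms by (simp add: power_less_one_iff)
  then show ?thesis by (simp add: cfun_def field_simps)
qed

lemma cfun_pos:
  assumes "2 \<le> t" "0 < x" "x < 1"
  shows "0 < cfun t x"
proof -
  have "(1 - x) ^ (t - 1) < 1" using assms by (simp add: power_less_one_iff)
  then show ?thesis using assms unfolding cfun_def by (intro divide_neg_neg) auto
qed

text \<open>\<open>cfun t x * u ^ (t - 1) - ln u\<close> is convex and takes the value
  \<open>cfun t x\<close> at both \<open>1 - x\<close> and \<open>1\<close>, so it stays below that
  value in between. Equivalently, the recursion at mean degree \<open>cfun t x\<close> maps no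
  \<open>u\<close> between these fixed points upwards.\<close>

lemma cfun_chord:
  assumes "2 \<le> t" "0 < x" "x < 1" "1 - x \<le> u" "u \<le> 1"
  shows "- cfun t x * (1 - u ^ (t - 1)) \<le> ln u"
proof -
  let ?f = "\<lambda>u. cfun t x * u ^ (t - 1) + (- ln u)"
  have "convex_on {0<..} (\<lambda>u::real. - ln u)" using ln_concave by (simp add: concave_on_def)
  moreover have "convex_on {0<..} (\<lambda>u::real. u ^ (t - 1))"
    using convex_power_even[of "t - 1"] convex_power_odd[of "t - 1"]
    by (cases "even (t - 1)") (auto intro: convex_on_subset)
  then have "convex_on {0<..} (\<lambda>u::real. cfun t x * u ^ (t - 1))"
    using cfun_pos[OF assms(1-3)] by (intro convex_on_cmul) auto
  ultimately have cv: "convex_on {0<..} ?f" by (intro convex_on_add)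
  define \<theta> where "\<theta> = (u - (1 - x)) / x"
  have \<theta>: "0 \<le> \<theta>" "\<theta> \<le> 1" using assms by (auto simp: \<theta>_def)
  have u: "u = (1 - \<theta>) *\<^sub>R (1 - x) + \<theta> *\<^sub>R 1"
    using assms by (simp add: \<theta>_def field_simps)
  have "?f u \<le> (1 - \<theta>) * ?f (1 - x) + \<theta> * ?f 1"
    unfolding u by (rule convex_onD[OF cv]) (use assms \<theta> in auto)
  also have "?f (1 - x) = cfun t x" using cfun_eq[OF assms(1-3)] by (simp add: algebra_simps)
  also have "?f 1 = cfun t x" by simp
  finally show ?thesis by (simp add: algebra_simps)
qed

text \<open>Let \<open>b\<close> be the infimum of the proportions attainable with mean degree below
  \<open>c\<close>. If \<open>b > 1 - x\<close>, then \<open>cfun_chord\<close> and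
  \<open>cfun t x < c\<close> make the recursion strictly decreasing at \<open>b\<close>; by
  continuity one step from some attainable \<open>u\<close> near \<open>b\<close> lands below
  \<open>b\<close>, a contradiction.\<close>

lemma spread_limit:
  assumes "2 \<le> t" "0 < x" "x < 1" "cfun t x < c" "0 < h" "h \<le> 1" "0 < \<delta>"
  shows "spread t c h (1 - x + \<delta>)"
proof -
  define r where "r = t - 1"
  have r: "r \<noteq> 0" using assms(1) by (simp add: r_def)
  have c: "0 < c" using cfun_pos[OF assms(1-3)] assms(4) by simp
  \<comment> \<open>The strict \<open>c' < c\<close> leaves room for the increase of the mean degree
    that each application of \<open>spread_step\<close> consumes.\<close>
  define S where "S = {b. 0 \<le> b \<and> b \<le> 1 \<and> (\<exists>c'. 0 < c' \<and> c' < c \<and> spread t c' h b)}"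
  have "1 - h / 2 \<in> S"
    unfolding S_def using assms c
    by (auto intro!: exI[of _ "c / 2"] spread_base)
  then have ne: "S \<noteq> {}" by auto
  have bdd: "bdd_below S" unfolding S_def by (auto intro!: bdd_belowI[of _ 0])
  define b where "b = Inf S"
  have b1: "b < 1" using cInf_lower[OF \<open>1 - h / 2 \<in> S\<close> bdd] assms(5) by (simp add: b_def)
  have "b \<le> 1 - x"
  proof (rule ccontr)
    assume "\<not> b \<le> 1 - x"
    then have bx: "1 - x < b" by simp
    then have bpos: "0 < b" using assms by simp
    define D where "D = 1 - b ^ r"
    have D: "0 < D" using b1 bpos r by (simp add: D_def power_less_one_iff)
    have "- ln b \<le> cfun t x * D" using cfun_chord[OF assms(1-3), of b] bx b1 by (simp add: D_def r_def)
    then have "- ln b / D \<le> cfun t x" by (simp only: pos_divide_le_eq[OF D])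
    then have "- ln b / D < c" using assms(4) by linarith
    then obtain c1 where c1: "- ln b / D < c1" "c1 < c" using dense by blast
    have "- c1 * D < ln b" using c1(1) D by (simp add: field_simps)
    then have "exp (- c1 * D) < b" using bpos by (metis exp_less_mono exp_ln)
    then obtain b' where b': "exp (- c1 * D) < b'" "b' < b" using dense by blast
    have "((\<lambda>u. exp (- c1 * (1 - u ^ r))) \<longlongrightarrow> exp (- c1 * (1 - b ^ r))) (at b)"
      by (intro tendsto_intros)
    then have "eventually (\<lambda>u. exp (- c1 * (1 - u ^ r)) < b') (at b)"
      using b'(1) unfolding D_def by (rule order_tendstoD(2))
    then obtain \<eta> where \<eta>: "0 < \<eta>" "\<And>u. u \<noteq> b \<Longrightarrow> dist u b < \<eta> \<Longrightarrow> exp (- c1 * (1 - u ^ r)) < b'"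
      unfolding eventually_at by auto
    obtain u where u: "u \<in> S" "u < b + \<eta>"
      using cInf_lessD[OF ne, of "b + \<eta>"] \<eta>(1) by (auto simp: b_def)
    have "b \<le> u" using cInf_lower[OF u(1) bdd] by (simp add: b_def)
    then have ub: "exp (- c1 * (1 - u ^ r)) < b'"
      using \<eta>(2)[of u] u(2) b'(1) by (cases "u = b") (auto simp: D_def dist_real_def)
    obtain c2 where c2: "0 < c2" "c2 < c" "spread t c2 h u" and u01: "0 \<le> u" "u \<le> 1"
      using u(1) by (auto simp: S_def)
    \<comment> \<open>The mean degree must serve twice: \<open>c1\<close> makes the step go below
      \<open>b'\<close>, and \<open>c2\<close> is the one for which \<open>u\<close> is known to be
      attainable.\<close>
    define c3 where "c3 = max c1 c2"
    have c3: "0 < c3" "c3 < c" "spread t c3 h u" "c1 \<le> c3"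
      using c2 c1 spread_mono[OF c2(3), of c3 u] by (auto simp: c3_def)
    have "c1 * (1 - u ^ r) \<le> c3 * (1 - u ^ r)"
      using c3(4) u01 by (intro mult_right_mono) (auto simp: power_le_one)
    then have "exp (- c3 * (1 - u ^ r)) \<le> exp (- c1 * (1 - u ^ r))" by simp
    then have "exp (- c3 * (1 - u ^ r)) < b'" using ub by linarith
    then have lt: "exp (- c3 * (1 - u ^ (t - 1))) < b'" unfolding r_def .
    obtain c4 where c4: "c3 < c4" "c4 < c" using c3(2) dense by blast
    have "spread t c4 h b'"
      by (rule spread_step[OF c3(3) assms(1) u01 _ lt c4(1)]) (use assms c3 c4 in auto)
    moreover have "0 \<le> b'" using b'(1) exp_ge_zero[of "- c1 * D"] by linarith
    ultimately have "b' \<in> S" using c3 c4 b' b1 by (auto simp: S_def intro!: exI[of _ c4])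
    then show False using cInf_lower[OF _ bdd, of b'] b'(2) by (simp add: b_def)
  qed
  then obtain u where "u \<in> S" "u < 1 - x + \<delta>"
    using cInf_lessD[OF ne, of "1 - x + \<delta>"] assms(7) by (auto simp: b_def)
  then show ?thesis using spread_mono[of t _ h u c "1 - x + \<delta>"] by (auto simp: S_def)
qed

section \<open>Merging the clusters of green vertices by sprinkling\<close>

text \<open>Take a smallest union \<open>U\<close> of components with at least \<open>d\<close>
  vertices and the component \<open>C\<close> of one of its points. If \<open>C\<close> has
  \<open>d\<close> vertices, it serves itself. Otherwise minimality makes \<open>U - C\<close>
  smaller than \<open>d\<close>, so \<open>U\<close> is smaller than \<open>2 * d\<close> and
  \<open>3 * d \<le> card Z\<close> leaves enough outside.\<close>

lemma balanced_union:
  fixes d :: nat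
  assumes "finite Z" "0 < d" "3 * d \<le> card Z"
    and "\<And>v. v \<in> Z \<Longrightarrow> card (Z \<inter> reach A `` {v}) \<le> card Z - d"
  obtains U where "U \<subseteq> Z" "\<And>u v. u \<in> U \<Longrightarrow> v \<in> Z \<Longrightarrow> (u, v) \<in> reach A \<Longrightarrow> v \<in> U"
    "d \<le> card U" "d \<le> card (Z - U)"
proof -
  define P where "P = (\<lambda>U. U \<subseteq> Z \<and> (\<forall>u\<in>U. \<forall>v\<in>Z. (u, v) \<in> reach A \<longrightarrow> v \<in> U) \<and> d \<le> card U)"
  have "P Z" using assms by (auto simp: P_def)
  then obtain U where U: "P U" "\<And>U'. P U' \<Longrightarrow> card U \<le> card U'"
    using that[OF arg_min_natI[of P Z card] arg_min_nat_le[of P _ card]] by blast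
  have finU: "finite U" using U(1) assms(1) finite_subset by (auto simp: P_def)
  have "U \<noteq> {}" using U(1) assms(2) by (auto simp: P_def)
  then obtain v where v: "v \<in> U" by auto
  then have vZ: "v \<in> Z" using U(1) by (auto simp: P_def)
  define C where "C = Z \<inter> reach A `` {v}"
  have CU: "C \<subseteq> U" using U(1) v by (auto simp: C_def P_def)
  have Ccl: "\<forall>u\<in>C. \<forall>w\<in>Z. (u, w) \<in> reach A \<longrightarrow> w \<in> C"
    unfolding C_def by (auto intro: rtrancl_trans)
  have vC: "v \<in> C" using vZ by (auto simp: C_def)
  show thesis
  proof (cases "d \<le> card C")
    case True
    have "card (Z - C) = card Z - card C"
      using assms(1) by (subst card_Diff_subset) (auto simp: C_def)
    moreover have "card C \<le> card Z - d" using assms(4)[OF vZ] by (simp add: C_def)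
    ultimately show thesis using that[of C] Ccl True assms(3) by (auto simp: C_def)
  next
    case False
    have "\<forall>u\<in>U - C. \<forall>w\<in>Z. (u, w) \<in> reach A \<longrightarrow> w \<in> U - C"
    proof (intro ballI impI)
      fix u w assume h: "u \<in> U - C" "w \<in> Z" "(u, w) \<in> reach A"
      have "u \<in> Z" using h U(1) by (auto simp: P_def)
      then have "w \<notin> C" using Ccl reach_sym[OF h(3)] h(1) by blast
      moreover have "w \<in> U" using h U(1) unfolding P_def by blast
      ultimately show "w \<in> U - C" by simp
    qed
    moreover have "card (U - C) < card U" using finU v vC by (intro psubset_card_mono) auto
    moreover have "U - C \<subseteq> Z" using U(1) unfolding P_def by blast
    moreover have "\<not> P (U - C)" using U(2)[of "U - C"] \<open>card (U - C) < card U\<close> by linarith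
    ultimately have "card (U - C) < d" unfolding P_def by (meson not_le)
    moreover have "card U = card (U - C) + card C"
      using finU CU by (metis card_Diff_subset card_mono finite_subset le_add_diff_inverse2)
    ultimately have "card U < 2 * d" using False by linarith
    moreover have "card (Z - U) = card Z - card U"
      using finU U(1) by (subst card_Diff_subset) (auto simp: P_def)
    ultimately have "d \<le> card (Z - U)" using assms(3) by linarith
    with U(1) show thesis by (intro that[of U]) (auto simp: P_def)
  qed
qed

text \<open>If no component of \<^term>\<open>A \<union> B\<close> contains nearly all of the cluster of \<^term>\<open>\<Gamma>\<close>, then some subset of
  \<^term>\<open>\<Gamma>\<close> has a cluster of intermediate size that no edge of \<^term>\<open>B\<close> leaves within the whole cluster.\<close>

lemma sprinkle_bound:
  fixes V :: "'v set"
  assumes "finite V" "A \<subseteq> nsets V (Suc r)" "\<Gamma> \<subseteq> V" "0 \<le> q" "q \<le> 1" "0 < r"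
    and "0 < d" "3 * d \<le> card (reach A `` \<Gamma>)"
  shows "bexp q (nsets V (Suc r))
      (\<lambda>B. of_bool (\<forall>v\<in>V. card (reach (A \<union> B) `` {v}) \<le> card (reach A `` \<Gamma>) - d))
    \<le> 2 ^ card \<Gamma> * (1 - q) ^ (d * (d choose r))"
proof -
  let ?E = "nsets V (Suc r)"
  define Z where "Z = reach A `` \<Gamma>"
  have ZV: "Z \<subseteq> V" unfolding Z_def using assms(2,3) by (intro reach_subset) (auto simp: nsets_def)
  have finZ: "finite Z" using ZV assms(1) finite_subset by auto
  have finE: "finite ?E" using assms(1) by (rule finite_imp_finite_nsets)
  have fin\<Gamma>: "finite \<Gamma>" using assms(1,3) finite_subset by auto
  define Z1 where "Z1 = (\<lambda>\<Gamma>1. reach A `` \<Gamma>1)"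
  define X where "X = (\<lambda>\<Gamma>1. (\<lambda>(v, \<sigma>). insert v \<sigma>) ` (Z1 \<Gamma>1 \<times> nsets (Z - Z1 \<Gamma>1) r))"
  \<comment> \<open>A union of components of \<open>A\<close> inside \<open>Z\<close> is determined
    by its green vertices. The union bound therefore has at most \<open>2 ^ card \<Gamma>\<close>
    terms, instead of one for every subset of \<open>Z\<close>.\<close>
  define \<G> where "\<G> = {\<Gamma>1 \<in> Pow \<Gamma>. d \<le> card (Z1 \<Gamma>1) \<and> d \<le> card (Z - Z1 \<Gamma>1)}"
  have Z1Z: "Z1 \<Gamma>1 \<subseteq> Z" if "\<Gamma>1 \<subseteq> \<Gamma>" for \<Gamma>1 using that by (auto simp: Z1_def Z_def)
  have fin\<G>: "finite \<G>" using fin\<Gamma> by (auto simp: \<G>_def)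
  have XE: "X \<Gamma>1 \<subseteq> ?E" if "\<Gamma>1 \<in> \<G>" for \<Gamma>1
  proof
    fix e assume "e \<in> X \<Gamma>1"
    then obtain v \<sigma> where "e = insert v \<sigma>" "v \<in> Z1 \<Gamma>1" "\<sigma> \<in> nsets (Z - Z1 \<Gamma>1) r"
      by (auto simp: X_def)
    then show "e \<in> ?E" using Z1Z[of \<Gamma>1] that ZV by (auto simp: nsets_def \<G>_def card_insert_if)
  qed
  have cardX: "d * (d choose r) \<le> card (X \<Gamma>1)" if "\<Gamma>1 \<in> \<G>" for \<Gamma>1
  proof -
    have "card (X \<Gamma>1) = card (Z1 \<Gamma>1) * (card (Z - Z1 \<Gamma>1) choose r)"
      unfolding X_def using inj_on_attach[of "Z1 \<Gamma>1" Z r] finZ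
      by (simp add: card_image card_cartesian_product card_nsets)
    then show ?thesis using that by (auto simp: \<G>_def intro!: mult_le_mono binomial_right_mono)
  qed
  have "bexp q ?E (\<lambda>B. of_bool (\<forall>v\<in>V. card (reach (A \<union> B) `` {v}) \<le> card Z - d))
      \<le> bexp q ?E (\<lambda>B. \<Sum>\<Gamma>1\<in>\<G>. of_bool (B \<inter> X \<Gamma>1 = {}))"
  proof (rule bexp_mono)
    fix B assume B: "B \<subseteq> ?E"
    show "of_bool (\<forall>v\<in>V. card (reach (A \<union> B) `` {v}) \<le> card Z - d)
      \<le> (\<Sum>\<Gamma>1\<in>\<G>. of_bool (B \<inter> X \<Gamma>1 = {}) :: real)"
    proof (cases "\<forall>v\<in>V. card (reach (A \<union> B) `` {v}) \<le> card Z - d")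
      case True
      have "card (Z \<inter> reach (A \<union> B) `` {v}) \<le> card Z - d" if "v \<in> Z" for v
      proof -
        have "reach (A \<union> B) `` {v} \<subseteq> V"
          using that ZV assms(2) B by (intro reach_subset) (auto simp: nsets_def)
        then have "card (Z \<inter> reach (A \<union> B) `` {v}) \<le> card (reach (A \<union> B) `` {v})"
          using assms(1) finite_subset by (intro card_mono) auto
        then show ?thesis using True that ZV by fastforce
      qed
      then obtain U where U: "U \<subseteq> Z" "\<And>u v. u \<in> U \<Longrightarrow> v \<in> Z \<Longrightarrow> (u, v) \<in> reach (A \<union> B) \<Longrightarrow> v \<in> U"
          "d \<le> card U" "d \<le> card (Z - U)"
        using balanced_union[of Z d "A \<union> B"] finZ assms(7,8) by (auto simp: Z_def)
      have "reach A \<subseteq> reach (A \<union> B)" by (rule reach_mono) auto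
      then have U2: "v \<in> U" if "u \<in> U" "v \<in> Z" "(u, v) \<in> reach A" for u v
        using U(2) that by auto
      \<comment> \<open>\<open>U\<close> is closed under reachability in \<open>A\<close> within
        \<open>Z\<close>, and every vertex of \<open>Z\<close> is joined by \<open>A\<close> to a
        green one.\<close>
      have eq: "Z1 (\<Gamma> \<inter> U) = U"
      proof (intro set_eqI iffI)
        fix u assume "u \<in> Z1 (\<Gamma> \<inter> U)"
        then obtain g where "g \<in> \<Gamma>" "g \<in> U" "(g, u) \<in> reach A" by (auto simp: Z1_def)
        then show "u \<in> U" using U2[of g u] by (auto simp: Z_def)
      next
        fix u assume u: "u \<in> U"
        then obtain g where g: "g \<in> \<Gamma>" "(g, u) \<in> reach A" using U(1) by (auto simp: Z_def)
        then have "g \<in> Z" by (auto simp: Z_def)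
        then have "g \<in> U" using U2[OF u _ reach_sym[OF g(2)]] by auto
        then show "u \<in> Z1 (\<Gamma> \<inter> U)" using g by (auto simp: Z1_def)
      qed
      have mem: "\<Gamma> \<inter> U \<in> \<G>" unfolding \<G>_def using eq U by auto
      have "B \<inter> X (\<Gamma> \<inter> U) = {}"
      proof (rule ccontr)
        assume "B \<inter> X (\<Gamma> \<inter> U) \<noteq> {}"
        then obtain e where "e \<in> B" "e \<in> X (\<Gamma> \<inter> U)" by auto
        then obtain v \<sigma> where e: "e = insert v \<sigma>" "v \<in> U" "\<sigma> \<in> nsets (Z - U) r"
          by (auto simp: X_def eq)
        have "\<sigma> \<noteq> {}" using e(3) assms(6) by (auto simp: nsets_def)
        then obtain u where u: "u \<in> \<sigma>" by auto
        then have "(v, u) \<in> reach (A \<union> B)" using reach_edge[of e "A \<union> B" v u] \<open>e \<in> B\<close> e(1) by auto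
        then show False using U(2)[OF e(2)] u e(3) by (auto simp: nsets_def)
      qed
      then have "(1::real) \<le> (\<Sum>\<Gamma>1\<in>{\<Gamma> \<inter> U}. of_bool (B \<inter> X \<Gamma>1 = {}))" by simp
      also have "\<dots> \<le> (\<Sum>\<Gamma>1\<in>\<G>. of_bool (B \<inter> X \<Gamma>1 = {}))"
        using mem fin\<G> by (intro sum_mono2) auto
      finally show ?thesis using True by simp
    next
      case False
      then show ?thesis by (auto intro!: sum_nonneg)
    qed
  qed (use assms in auto)
  also have "\<dots> = (\<Sum>\<Gamma>1\<in>\<G>. (1 - q) ^ card (X \<Gamma>1))"
    unfolding bexp_sum using XE finE by (intro sum.cong bexp_disjoint) auto
  also have "\<dots> \<le> (\<Sum>\<Gamma>1\<in>\<G>. (1 - q) ^ (d * (d choose r)))"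
    using cardX assms(4,5) by (intro sum_mono power_decreasing) auto
  also have "\<dots> \<le> 2 ^ card \<Gamma> * (1 - q) ^ (d * (d choose r))"
  proof -
    have "card \<G> \<le> card (Pow \<Gamma>)" using fin\<Gamma> by (intro card_mono) (auto simp: \<G>_def)
    then have "real (card \<G>) \<le> real (2 ^ card \<Gamma>)" using fin\<Gamma> by (simp add: card_Pow)
    then have "real (card \<G>) \<le> 2 ^ card \<Gamma>" by simp
    then show ?thesis using assms(4,5) by (simp add: mult_right_mono)
  qed
  finally show ?thesis by (simp add: Z_def)
qed

text \<open>The first round makes \<open>\<Gamma>\<close> reach a proportion of nearly
  \<open>x\<close>; the second merges the clusters. \<open>h\<close> is chosen after
  \<open>\<eta>\<close>, so that the entropy of the subsets of \<open>\<Gamma>\<close>, at most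
  \<open>h * n + 1\<close>, loses against the exponent \<open>\<kappa> * n\<close> of the
  sprinkling.\<close>

lemma giant:
  assumes "2 \<le> t" "0 < x" "x < 1" "cfun t x < c" "0 < \<eta>" "0 < \<delta>" "0 < \<epsilon>"
  shows "\<exists>n0. \<forall>(V::nat set) p q. finite V \<and> n0 \<le> card V \<and> 0 \<le> p \<and> p \<le> 1 \<and> 0 \<le> q \<and> q \<le> 1 \<and>
    c \<le> p * real (card V choose (t - 1)) \<and> \<eta> \<le> q * real (card V choose (t - 1)) \<longrightarrow>
    bexp p (nsets V t) (\<lambda>A. bexp q (nsets V t) (\<lambda>B.
      of_bool (\<forall>v\<in>V. real (card (reach (A \<union> B) `` {v})) < (x - \<delta>) * real (card V)))) \<le> \<epsilon>"
proof -
  define r where "r = t - 1"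
  have t: "t = Suc r" and r: "0 < r" using assms(1) by (auto simp: r_def)
  \<comment> \<open>The first round loses \<open>\<delta>1 * n\<close> vertices and the merging at
    most \<open>d \<le> 2 * \<delta>1 * n\<close>, together at most \<open>\<delta> * n\<close>. The
    bound by \<open>x\<close> makes the cluster at least \<open>3 * d\<close> large.\<close>
  define \<delta>1 where "\<delta>1 = min \<delta> (x / 5) / 3"
  have \<delta>1: "0 < \<delta>1" "3 * \<delta>1 \<le> \<delta>" "15 * \<delta>1 \<le> x" using assms by (auto simp: \<delta>1_def)
  \<comment> \<open>\<open>\<kappa> * n\<close> is a lower bound for the expected number of
    sprinkled edges with one vertex on one side of a cut and the rest on the other, when both sides
    have at least \<open>d\<close> vertices.\<close>
  define \<kappa> where "\<kappa> = \<delta>1 * ((\<delta>1 / 2) ^ r * \<eta>)"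
  have \<kappa>: "0 < \<kappa>" using \<delta>1 assms by (simp add: \<kappa>_def)
  define h where "h = min (1 / 2) (\<kappa> / 2)"
  have h: "0 < h" "h \<le> 1" "h \<le> \<kappa> / 2" using \<kappa> by (auto simp: h_def)
  have "0 < \<epsilon> / 2" using assms by simp
  moreover have "spread t c h (1 - x + \<delta>1)" using spread_limit assms h \<delta>1 by blast
  ultimately obtain n0 where n0: "\<And>(V::nat set) \<Gamma> p. finite V \<and> n0 \<le> card V \<and> \<Gamma> \<subseteq> V \<and>
     h * real (card V) \<le> real (card \<Gamma>) \<and> 0 \<le> p \<and> p \<le> 1 \<and>
     c \<le> p * real (card V choose (t - 1)) \<longrightarrow> far_prob t (1 - x + \<delta>1) V \<Gamma> p \<le> \<epsilon> / 2"
    unfolding spread_def by blast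
  have "eventually (\<lambda>n. exp (1 - \<kappa> * real n / 2) < \<epsilon> / 2) sequentially"
  proof -
    have "(\<lambda>n. exp (1 - \<kappa> * real n / 2)) \<longlonglongrightarrow> 0" using \<kappa> by real_asymp
    then show ?thesis using assms(7) by (intro order_tendstoD(2)) auto
  qed
  moreover have "eventually (\<lambda>n. 1 < \<delta>1 * real n \<and> real r < \<delta>1 / 2 * real n) sequentially"
    using \<delta>1(1) by (intro eventually_conj; real_asymp)
  ultimately have "eventually (\<lambda>n. exp (1 - \<kappa> * real n / 2) < \<epsilon> / 2 \<and> 1 < \<delta>1 * real n \<and>
      real r < \<delta>1 / 2 * real n \<and> n0 \<le> n \<and> 2 \<le> n) sequentially"
    using eventually_ge_at_top[of "max n0 2"] by eventually_elim auto
  then obtain n1 where n1: "\<And>n. n1 \<le> n \<Longrightarrow> exp (1 - \<kappa> * real n / 2) < \<epsilon> / 2 \<and> 1 < \<delta>1 * real n \<and>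
      real r < \<delta>1 / 2 * real n \<and> n0 \<le> n \<and> 2 \<le> n"
    unfolding eventually_sequentially by blast
  show ?thesis
  proof (intro exI[of _ n1] allI impI, elim conjE)
    fix V :: "nat set" and p q :: real
    assume H: "finite V" "n1 \<le> card V" "0 \<le> p" "p \<le> 1" "0 \<le> q" "q \<le> 1"
      "c \<le> p * real (card V choose (t - 1))" "\<eta> \<le> q * real (card V choose (t - 1))"
    let ?n = "card V" and ?E = "nsets V t"
    note n = n1[OF H(2)]
    have finE: "finite ?E" using H(1) by (rule finite_imp_finite_nsets)
    define g where "g = nat \<lceil>h * real ?n\<rceil>"
    have g: "h * real ?n \<le> real g" "real g \<le> h * real ?n + 1" "g \<le> ?n"
    proof -
      have "h * real ?n \<le> 1 * real ?n" using h by (intro mult_right_mono) auto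
      then have "\<lceil>h * real ?n\<rceil> \<le> int ?n" by (simp add: ceiling_le_iff)
      then show "g \<le> ?n" by (simp add: g_def nat_le_iff)
      have "0 \<le> h * real ?n" using h by simp
      then show "h * real ?n \<le> real g" "real g \<le> h * real ?n + 1"
        unfolding g_def by linarith+
    qed
    obtain \<Gamma> where \<Gamma>: "\<Gamma> \<subseteq> V" "card \<Gamma> = g" using obtain_subset_with_card_n[OF g(3)] by metis
    define d where "d = nat \<lceil>\<delta>1 * real ?n\<rceil>"
    have d: "\<delta>1 * real ?n \<le> real d" "real d \<le> 2 * \<delta>1 * real ?n" "0 < d"
    proof -
      have "0 < \<delta>1 * real ?n" "1 < \<delta>1 * real ?n" using n by auto
      then show "\<delta>1 * real ?n \<le> real d" "real d \<le> 2 * \<delta>1 * real ?n" "0 < d"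
        unfolding d_def by linarith+
    qed
    have main: "bexp q ?E (\<lambda>B. of_bool (\<forall>v\<in>V. real (card (reach (A \<union> B) `` {v})) < (x - \<delta>) * real ?n))
        \<le> of_bool ((1 - x + \<delta>1) * real ?n \<le> real (card (V - reach A `` \<Gamma>))) + \<epsilon> / 2"
      if A: "A \<subseteq> ?E" for A
    proof (cases "(1 - x + \<delta>1) * real ?n \<le> real (card (V - reach A `` \<Gamma>))")
      case True
      have "bexp q ?E (\<lambda>B. of_bool (\<forall>v\<in>V. real (card (reach (A \<union> B) `` {v})) < (x - \<delta>) * real ?n)) \<le> 1"
        using H finE by (intro bexp_le_const) auto
      then show ?thesis using True assms(7) by simp
    next
      case False
      let ?Z = "reach A `` \<Gamma>"
      have ZV: "?Z \<subseteq> V" using A \<Gamma> by (intro reach_subset) (auto simp: nsets_def)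
      then have "card (V - ?Z) = ?n - card ?Z" "card ?Z \<le> ?n"
        using H(1) finite_subset[OF ZV H(1)] by (auto simp: card_Diff_subset card_mono)
      then have Z: "(x - \<delta>1) * real ?n < real (card ?Z)" using False by (simp add: of_nat_diff algebra_simps)
      have "6 * \<delta>1 * real ?n \<le> (x - \<delta>1) * real ?n" using \<delta>1 by (intro mult_right_mono) auto
      then have d3: "3 * d \<le> card ?Z" using d Z by linarith
      have x3: "(x - \<delta>) * real ?n \<le> real (card ?Z - d)"
      proof -
        have "(x - \<delta>) * real ?n \<le> (x - \<delta>1 - 2 * \<delta>1) * real ?n" using \<delta>1 by (intro mult_right_mono) auto
        also have "\<dots> \<le> real (card ?Z) - real d" using d Z by (simp add: algebra_simps)
        also have "\<dots> = real (card ?Z - d)" using d3 by simp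
        finally show ?thesis .
      qed
      have "bexp q ?E (\<lambda>B. of_bool (\<forall>v\<in>V. real (card (reach (A \<union> B) `` {v})) < (x - \<delta>) * real ?n))
        \<le> bexp q ?E (\<lambda>B. of_bool (\<forall>v\<in>V. card (reach (A \<union> B) `` {v}) \<le> card ?Z - d))"
      proof (rule bexp_mono)
        fix B
        have "card (reach (A \<union> B) `` {v}) \<le> card ?Z - d"
          if "real (card (reach (A \<union> B) `` {v})) < (x - \<delta>) * real ?n" for v
          using that x3 by linarith
        then show "of_bool (\<forall>v\<in>V. real (card (reach (A \<union> B) `` {v})) < (x - \<delta>) * real ?n)
          \<le> (of_bool (\<forall>v\<in>V. card (reach (A \<union> B) `` {v}) \<le> card ?Z - d) :: real)" by auto
      qed (use H in auto)
      also have "\<dots> \<le> 2 ^ card \<Gamma> * (1 - q) ^ (d * (d choose r))"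
        using sprinkle_bound[of V A r \<Gamma> q d] A H \<Gamma>(1) r d(3) d3 unfolding t by blast
      also have "\<dots> \<le> exp (real g) * exp (- \<kappa> * real ?n)"
      proof (rule mult_mono)
        have "(2::real) ^ card \<Gamma> \<le> exp 1 ^ card \<Gamma>"
          using exp_ge_add_one_self[of 1] by (intro power_mono) auto
        then show "(2::real) ^ card \<Gamma> \<le> exp (real g)" by (simp add: \<Gamma>(2) exp_of_nat_mult[symmetric])
        have "\<kappa> * real ?n = (\<delta>1 * real ?n) * ((\<delta>1 / 2) ^ r * \<eta>)" by (simp add: \<kappa>_def)
        also have "\<dots> \<le> real d * ((\<delta>1 / 2) ^ r * (q * real (?n choose r)))"
          using d H(8) \<delta>1 assms(5) unfolding r_def by (intro mult_mono) auto
        also have "\<dots> \<le> real d * (((real d - real r) / real ?n) ^ r * (q * real (?n choose r)))"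
        proof -
          have "\<delta>1 / 2 \<le> (real d - real r) / real ?n"
            using n d by (simp add: field_simps)
          then show ?thesis using \<delta>1 H by (intro mult_left_mono mult_right_mono power_mono) auto
        qed
        also have "\<dots> = real d * (q * (((real d - real r) / real ?n) ^ r * real (?n choose r)))"
          by (simp add: mult_ac)
        also have "\<dots> \<le> real d * (q * real (d choose r))"
        proof -
          have "real r \<le> real d" using n d by linarith
          then show ?thesis using n H by (intro mult_left_mono choose_ratio_ge) auto
        qed
        finally have kq: "\<kappa> * real ?n \<le> q * real (d * (d choose r))" by (simp add: mult_ac)
        have "(1 - q) ^ (d * (d choose r)) \<le> exp (- q) ^ (d * (d choose r))"
          using H exp_ge_add_one_self[of "- q"] by (intro power_mono) auto
        also have "\<dots> = exp (- (q * real (d * (d choose r))))"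
          by (subst exp_of_nat_mult[symmetric]) (simp add: mult_ac)
        also have "\<dots> \<le> exp (- \<kappa> * real ?n)" using kq by simp
        finally show "(1 - q) ^ (d * (d choose r)) \<le> exp (- \<kappa> * real ?n)" .
      qed (use H in auto)
      also have "\<dots> \<le> exp (1 - \<kappa> * real ?n / 2)"
      proof -
        have "h * real ?n \<le> \<kappa> / 2 * real ?n" using h by (intro mult_right_mono) auto
        then have "real g + - \<kappa> * real ?n \<le> 1 - \<kappa> * real ?n / 2" using g by (simp add: algebra_simps)
        then show ?thesis by (simp only: exp_add[symmetric] exp_le_cancel_iff)
      qed
      also have "\<dots> \<le> \<epsilon> / 2" using n by simp
      finally show ?thesis by simp
    qed
    have "bexp p ?E (\<lambda>A. bexp q ?E (\<lambda>B.
        of_bool (\<forall>v\<in>V. real (card (reach (A \<union> B) `` {v})) < (x - \<delta>) * real ?n)))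
      \<le> bexp p ?E (\<lambda>A. of_bool ((1 - x + \<delta>1) * real ?n \<le> real (card (V - reach A `` \<Gamma>))) + \<epsilon> / 2)"
      using H main by (intro bexp_mono) auto
    also have "\<dots> = far_prob t (1 - x + \<delta>1) V \<Gamma> p + \<epsilon> / 2"
      using finE by (simp add: bexp_add far_prob_def)
    also have "\<dots> \<le> \<epsilon>"
      using n0[of V \<Gamma> p] H \<Gamma> g n by auto
    finally show "bexp p ?E (\<lambda>A. bexp q ?E (\<lambda>B.
        of_bool (\<forall>v\<in>V. real (card (reach (A \<union> B) `` {v})) < (x - \<delta>) * real ?n))) \<le> \<epsilon>" .
  qed
qed

section \<open>Level sets of independent weights\<close>

definition level :: "'e set \<Rightarrow> ('e \<Rightarrow> 'b \<Rightarrow> real) \<Rightarrow> real \<Rightarrow> 'b \<Rightarrow> 'e set" where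
  "level E W w \<omega> = {e\<in>E. W e \<omega> \<le> w}"

lemma level_subset: "level E W w \<omega> \<subseteq> E"
  by (auto simp: level_def)

text \<open>Each element lies in \<open>A\<close>, newly in \<open>B\<close>, or in neither, with
  weights \<open>p\<close>, \<open>(1 - p) * r\<close> and \<open>(1 - p) * (1 - r)\<close>; the
  part of \<open>B\<close> inside \<open>A\<close> is averaged out. This is the form to be matched
  with the law of two level sets.\<close>

lemma bexp_bexp:
  assumes "finite E"
  shows "bexp p E (\<lambda>A. bexp r E (\<lambda>B. \<phi> A (A \<union> B))) =
    (\<Sum>A\<in>Pow E. \<Sum>B\<in>Pow (E - A). p ^ card A * ((1 - p) * r) ^ card B *
       ((1 - p) * (1 - r)) ^ card (E - A - B) * \<phi> A (A \<union> B))"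
  unfolding bexp_def[of p]
proof (rule sum.cong)
  fix A assume A: "A \<in> Pow E"
  have "bexp r E (\<lambda>B. \<phi> A (A \<union> B)) = bexp r E (\<lambda>B. \<phi> A (A \<union> (B \<inter> (E - A))))"
    using A by (intro bexp_cong arg_cong[where f = "\<phi> A"]) auto
  also have "\<dots> = bexp r (E - A) (\<lambda>B. \<phi> A (A \<union> B))"
    using assms by (intro bexp_Int) auto
  finally have e: "bexp r E (\<lambda>B. \<phi> A (A \<union> B)) = bexp r (E - A) (\<lambda>B. \<phi> A (A \<union> B))" .
  show "p ^ card A * (1 - p) ^ card (E - A) * bexp r E (\<lambda>B. \<phi> A (A \<union> B)) =
    (\<Sum>B\<in>Pow (E - A). p ^ card A * ((1 - p) * r) ^ card B *
       ((1 - p) * (1 - r)) ^ card (E - A - B) * \<phi> A (A \<union> B))"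
    unfolding e unfolding bexp_def sum_distrib_left
  proof (rule sum.cong)
    fix B assume B: "B \<in> Pow (E - A)"
    have "card (E - A) = card B + card (E - A - B)"
      using B assms card_Diff_subset[of B "E - A"] card_mono[of "E - A" B] finite_subset[of B "E - A"] by simp
    then show "p ^ card A * (1 - p) ^ card (E - A) * (r ^ card B * (1 - r) ^ card (E - A - B) * \<phi> A (A \<union> B))
      = p ^ card A * ((1 - p) * r) ^ card B * ((1 - p) * (1 - r)) ^ card (E - A - B) * \<phi> A (A \<union> B)"
      by (simp add: power_add power_mult_distrib mult_ac)
  qed simp
qed simp

context prob_space
begin

text \<open>For fixed disjoint \<open>A\<close> and \<open>B\<close> the event prescribes one of
  three disjoint intervals for each weight, so independence turns its probability into a
  product.\<close>

lemma prob_levels: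
  fixes W :: "'e \<Rightarrow> 'a \<Rightarrow> real"
  assumes "indep_vars (\<lambda>_. borel) W E" "finite E" "real_distribution D"
    and "\<And>e. e \<in> E \<Longrightarrow> distr M borel (W e) = D"
    and "w < w'" "A \<subseteq> E" "B \<subseteq> E - A"
  shows "prob {\<omega> \<in> space M. level E W w \<omega> = A \<and> level E W w' \<omega> = A \<union> B} =
     cdf D w ^ card A * (cdf D w' - cdf D w) ^ card B * (1 - cdf D w') ^ card (E - A - B)"
    and "{\<omega> \<in> space M. level E W w \<omega> = A \<and> level E W w' \<omega> = A \<union> B} \<in> events"
proof -
  interpret D: real_distribution D by fact
  define S where "S e = (if e \<in> A then {..w} else if e \<in> B then {w<..w'} else {w'<..})" for e
  have S: "S e \<in> sets borel" for e by (auto simp: S_def)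
  have rv: "W e \<in> borel_measurable M" if "e \<in> E" for e
    using assms(1) that by (auto simp: indep_vars_def)
  have eq: "{\<omega> \<in> space M. level E W w \<omega> = A \<and> level E W w' \<omega> = A \<union> B}
      = {\<omega> \<in> space M. \<forall>e\<in>E. W e \<omega> \<in> S e}"
  proof (intro Collect_cong conj_cong refl)
    fix \<omega>
    show "(level E W w \<omega> = A \<and> level E W w' \<omega> = A \<union> B) = (\<forall>e\<in>E. W e \<omega> \<in> S e)"
    proof
      assume h: "level E W w \<omega> = A \<and> level E W w' \<omega> = A \<union> B"
      show "\<forall>e\<in>E. W e \<omega> \<in> S e"
      proof
        fix e assume e: "e \<in> E"
        have "e \<in> level E W w \<omega> \<longleftrightarrow> W e \<omega> \<le> w" "e \<in> level E W w' \<omega> \<longleftrightarrow> W e \<omega> \<le> w'"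
          using e by (simp_all add: level_def)
        then have "e \<in> A \<longleftrightarrow> W e \<omega> \<le> w" "e \<in> A \<union> B \<longleftrightarrow> W e \<omega> \<le> w'"
          using h by simp_all
        then show "W e \<omega> \<in> S e" by (simp add: S_def not_le) linarith
      qed
    next
      assume h: "\<forall>e\<in>E. W e \<omega> \<in> S e"
      have mem: "(W e \<omega> \<le> w) = (e \<in> A)" "(W e \<omega> \<le> w') = (e \<in> A \<union> B)" if "e \<in> E" for e
      proof -
        have "W e \<omega> \<in> S e" using h that by blast
        then show "(W e \<omega> \<le> w) = (e \<in> A)" "(W e \<omega> \<le> w') = (e \<in> A \<union> B)"
          using assms(5) by (cases "e \<in> A"; cases "e \<in> B"; simp add: S_def)+
      qed
      have "level E W w \<omega> = {e \<in> E. e \<in> A}" "level E W w' \<omega> = {e \<in> E. e \<in> A \<union> B}"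
        unfolding level_def by (intro Collect_cong conj_cong refl mem, assumption)+
      then show "level E W w \<omega> = A \<and> level E W w' \<omega> = A \<union> B"
        using assms(6,7) by blast
    qed
  qed
  have "{\<omega> \<in> space M. \<forall>e\<in>E. W e \<omega> \<in> S e} \<in> events"
  proof (rule sets.sets_Collect_finite_All)
    fix e assume "e \<in> E"
    then have "W e -` S e \<inter> space M \<in> events" using rv S by (intro measurable_sets)
    also have "W e -` S e \<inter> space M = {\<omega> \<in> space M. W e \<omega> \<in> S e}" by blast
    finally show "{\<omega> \<in> space M. W e \<omega> \<in> S e} \<in> events" .
  qed fact
  then show "{\<omega> \<in> space M. level E W w \<omega> = A \<and> level E W w' \<omega> = A \<union> B} \<in> events"
    by (simp only: eq)
  have single: "prob (W e -` S e \<inter> space M) = measure D (S e)" if "e \<in> E" for e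
    unfolding assms(4)[OF that, symmetric] using rv[OF that] S by (simp add: measure_distr)
  have "prob {\<omega> \<in> space M. \<forall>e\<in>E. W e \<omega> \<in> S e} = (\<Prod>e\<in>E. measure D (S e))"
  proof (cases "E = {}")
    case False
    have "{\<omega> \<in> space M. \<forall>e\<in>E. W e \<omega> \<in> S e} = (\<Inter>e\<in>E. W e -` S e \<inter> space M)"
      using False by auto
    then have "prob {\<omega> \<in> space M. \<forall>e\<in>E. W e \<omega> \<in> S e} = (\<Prod>e\<in>E. prob (W e -` S e \<inter> space M))"
      using indep_varsD[OF assms(1) False assms(2) order_refl, of S] S by simp
    then show ?thesis using single by simp
  qed (simp add: prob_space)
  also have "\<dots> = (\<Prod>e\<in>A. measure D (S e)) * (\<Prod>e\<in>B. measure D (S e)) * (\<Prod>e\<in>E - A - B. measure D (S e))"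
  proof -
    have finA: "finite A" and finB: "finite B"
      using finite_subset[OF assms(6,2)] finite_subset[OF assms(7)] assms(2) by auto
    have "E = A \<union> (B \<union> (E - A - B))" using assms(6,7) by auto
    then have "(\<Prod>e\<in>E. measure D (S e)) = (\<Prod>e\<in>A \<union> (B \<union> (E - A - B)). measure D (S e))" by simp
    also have "\<dots> = (\<Prod>e\<in>A. measure D (S e)) * (\<Prod>e\<in>B \<union> (E - A - B). measure D (S e))"
      using finA finB assms(2,6,7) by (intro prod.union_disjoint) auto
    also have "(\<Prod>e\<in>B \<union> (E - A - B). measure D (S e)) = (\<Prod>e\<in>B. measure D (S e)) * (\<Prod>e\<in>E - A - B. measure D (S e))"
      using finA finB assms(2,6,7) by (intro prod.union_disjoint) auto
    finally show ?thesis by (simp add: mult_ac)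
  qed
  also have "(\<Prod>e\<in>A. measure D (S e)) = cdf D w ^ card A"
    by (simp add: S_def cdf_def)
  also have "(\<Prod>e\<in>B. measure D (S e)) = (\<Prod>e\<in>B. cdf D w' - cdf D w)"
    using assms(5,7) by (intro prod.cong) (auto simp: S_def D.cdf_diff_eq)
  also have "(\<Prod>e\<in>E - A - B. measure D (S e)) = (\<Prod>e\<in>E - A - B. 1 - cdf D w')"
  proof (rule prod.cong)
    fix e assume "e \<in> E - A - B"
    then have "S e = space D - {..w'}" by (auto simp: S_def)
    then show "measure D (S e) = 1 - cdf D w'"
      using D.prob_compl[of "{..w'}"] by (simp add: cdf_def)
  qed simp
  finally show "prob {\<omega> \<in> space M. level E W w \<omega> = A \<and> level E W w' \<omega> = A \<union> B} =
     cdf D w ^ card A * (cdf D w' - cdf D w) ^ card B * (1 - cdf D w') ^ card (E - A - B)"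
    by (simp add: eq)
qed

text \<open>The higher level set is distributed as the union of the lower one with an independent random set.\<close>

lemma expectation_levels:
  fixes W :: "'e \<Rightarrow> 'a \<Rightarrow> real"
  assumes "indep_vars (\<lambda>_. borel) W E" "finite E" "real_distribution D"
    and "\<And>e. e \<in> E \<Longrightarrow> distr M borel (W e) = D"
    and "w < w'" "cdf D w < 1"
  shows "integrable M (\<lambda>\<omega>. \<phi> (level E W w \<omega>) (level E W w' \<omega>) :: real)"
    and "expectation (\<lambda>\<omega>. \<phi> (level E W w \<omega>) (level E W w' \<omega>)) =
      bexp (cdf D w) E (\<lambda>A. bexp ((cdf D w' - cdf D w) / (1 - cdf D w)) E (\<lambda>B. \<phi> A (A \<union> B)))"
proof -
  define Z where "Z = (\<lambda>A B. {\<omega> \<in> space M. level E W w \<omega> = A \<and> level E W w' \<omega> = A \<union> B})"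
  have Z: "Z A B \<in> events" "prob (Z A B) =
     cdf D w ^ card A * (cdf D w' - cdf D w) ^ card B * (1 - cdf D w') ^ card (E - A - B)"
    if "A \<in> Pow E" "B \<in> Pow (E - A)" for A B
    using prob_levels[OF assms(1-5)] that unfolding Z_def by auto
  define f where "f = (\<lambda>\<omega>. \<Sum>A\<in>Pow E. \<Sum>B\<in>Pow (E - A). indicator (Z A B) \<omega> * \<phi> A (A \<union> B))"
  have eq: "\<phi> (level E W w \<omega>) (level E W w' \<omega>) = f \<omega>" if \<omega>: "\<omega> \<in> space M" for \<omega>
  proof -
    let ?A = "level E W w \<omega>" and ?B = "level E W w' \<omega> - level E W w \<omega>"
    have sub: "level E W w \<omega> \<subseteq> level E W w' \<omega>" using assms(5) by (auto simp: level_def)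
    have "f \<omega> = (\<Sum>A\<in>{?A}. \<Sum>B\<in>Pow (E - A). indicator (Z A B) \<omega> * \<phi> A (A \<union> B))"
      unfolding f_def using assms(2) level_subset[of E W w \<omega>]
      by (intro sum.mono_neutral_right) (auto simp: Z_def intro!: sum.neutral)
    also have "\<dots> = (\<Sum>B\<in>Pow (E - ?A). indicator (Z ?A B) \<omega> * \<phi> ?A (?A \<union> B))" by simp
    also have "\<dots> = (\<Sum>B\<in>{?B}. indicator (Z ?A B) \<omega> * \<phi> ?A (?A \<union> B))"
    proof (rule sum.mono_neutral_right)
      show "{?B} \<subseteq> Pow (E - ?A)" using level_subset[of E W w' \<omega>] by auto
      show "\<forall>B\<in>Pow (E - ?A) - {?B}. indicator (Z ?A B) \<omega> * \<phi> ?A (?A \<union> B) = 0"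
      proof
        fix B assume B: "B \<in> Pow (E - ?A) - {?B}"
        have "level E W w' \<omega> \<noteq> ?A \<union> B"
        proof
          assume "level E W w' \<omega> = ?A \<union> B"
          then have "B = ?B" using B by auto
          then show False using B by simp
        qed
        then show "indicator (Z ?A B) \<omega> * \<phi> ?A (?A \<union> B) = 0" by (simp add: Z_def)
      qed
    qed (use assms(2) in auto)
    also have "\<dots> = \<phi> ?A (?A \<union> ?B)" using \<omega> sub by (simp add: Z_def Un_absorb1)
    also have "?A \<union> ?B = level E W w' \<omega>" using sub by auto
    finally show ?thesis by simp
  qed
  have int: "integrable M (\<lambda>\<omega>. indicator (Z A B) \<omega> * \<phi> A (A \<union> B))"
    if "A \<in> Pow E" "B \<in> Pow (E - A)" for A B
    using Z(1)[OF that] by (intro integrable_mult_left integrable_real_indicator) (auto simp: emeasure_eq_measure)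
  have intf: "integrable M f"
    unfolding f_def using int by (intro Bochner_Integration.integrable_sum) auto
  then show "integrable M (\<lambda>\<omega>. \<phi> (level E W w \<omega>) (level E W w' \<omega>) :: real)"
    by (subst Bochner_Integration.integrable_cong[OF refl eq]) auto
  let ?p = "cdf D w" and ?r = "(cdf D w' - cdf D w) / (1 - cdf D w)"
  have pr: "(1 - ?p) * ?r = cdf D w' - cdf D w" "(1 - ?p) * (1 - ?r) = 1 - cdf D w'"
    using assms(6) by (auto simp: field_simps)
  have "expectation (\<lambda>\<omega>. \<phi> (level E W w \<omega>) (level E W w' \<omega>)) = expectation f"
    by (rule Bochner_Integration.integral_cong[OF refl eq])
  also have "\<dots> = (\<Sum>A\<in>Pow E. \<Sum>B\<in>Pow (E - A). prob (Z A B) * \<phi> A (A \<union> B))"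
  proof -
    have "expectation f = (\<Sum>A\<in>Pow E. expectation (\<lambda>\<omega>. \<Sum>B\<in>Pow (E - A). indicator (Z A B) \<omega> * \<phi> A (A \<union> B)))"
      unfolding f_def using int
      by (intro Bochner_Integration.integral_sum Bochner_Integration.integrable_sum) auto
    also have "\<dots> = (\<Sum>A\<in>Pow E. \<Sum>B\<in>Pow (E - A). expectation (\<lambda>\<omega>. indicator (Z A B) \<omega> * \<phi> A (A \<union> B)))"
      using int by (intro sum.cong refl Bochner_Integration.integral_sum) auto
    also have "\<dots> = (\<Sum>A\<in>Pow E. \<Sum>B\<in>Pow (E - A). prob (Z A B) * \<phi> A (A \<union> B))"
      using Z(1) by (intro sum.cong refl) simp
    finally show ?thesis .
  qed
  also have "\<dots> = bexp ?p E (\<lambda>A. bexp ?r E (\<lambda>B. \<phi> A (A \<union> B)))"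
    unfolding bexp_bexp[OF assms(2)] pr using Z(2) by (intro sum.cong refl) (auto simp: mult_ac)
  finally show "expectation (\<lambda>\<omega>. \<phi> (level E W w \<omega>) (level E W w' \<omega>)) =
      bexp ?p E (\<lambda>A. bexp ?r E (\<lambda>B. \<phi> A (A \<union> B)))" .
qed

lemma prob_level_pair:
  fixes W :: "'e \<Rightarrow> 'a \<Rightarrow> real"
  assumes "indep_vars (\<lambda>_. borel) W E" "finite E" "real_distribution D"
    and "\<And>e. e \<in> E \<Longrightarrow> distr M borel (W e) = D"
    and "w < w'" "cdf D w < 1"
  shows "{\<omega> \<in> space M. Q (level E W w \<omega>) (level E W w' \<omega>)} \<in> events"
    and "prob {\<omega> \<in> space M. Q (level E W w \<omega>) (level E W w' \<omega>)} =
      bexp (cdf D w) E (\<lambda>A. bexp ((cdf D w' - cdf D w) / (1 - cdf D w)) E (\<lambda>B. of_bool (Q A (A \<union> B))))"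
proof -
  let ?S = "{\<omega> \<in> space M. Q (level E W w \<omega>) (level E W w' \<omega>)}"
  let ?f = "\<lambda>\<omega>. of_bool (Q (level E W w \<omega>) (level E W w' \<omega>)) :: real"
  note * = expectation_levels[OF assms, of "\<lambda>A B. of_bool (Q A B)"]
  have "?f \<in> borel_measurable M" using *(1) by auto
  then have "?f -` {1} \<inter> space M \<in> events" by (rule measurable_sets) auto
  also have "?f -` {1} \<inter> space M = ?S" by auto
  finally show S: "?S \<in> events" .
  have "prob ?S = expectation (indicator ?S)" using S by simp
  also have "\<dots> = expectation ?f" by (intro Bochner_Integration.integral_cong) (auto simp: indicator_def)
  finally show "prob ?S =
      bexp (cdf D w) E (\<lambda>A. bexp ((cdf D w' - cdf D w) / (1 - cdf D w)) E (\<lambda>B. of_bool (Q A (A \<union> B))))"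
    using *(2) by simp
qed

lemma prob_level:
  fixes W :: "'e \<Rightarrow> 'a \<Rightarrow> real"
  assumes "indep_vars (\<lambda>_. borel) W E" "finite E" "real_distribution D"
    and "\<And>e. e \<in> E \<Longrightarrow> distr M borel (W e) = D" "cdf D w < 1"
  shows "{\<omega> \<in> space M. Q (level E W w \<omega>)} \<in> events"
    and "prob {\<omega> \<in> space M. Q (level E W w \<omega>)} = bexp (cdf D w) E (\<lambda>A. of_bool (Q A))"
proof -
  \<comment> \<open>A dummy upper level: the event ignores it, and the inner expectation is one of a
    constant.\<close>
  have w: "w < w + 1" by simp
  note * = prob_level_pair[OF assms(1-4) w assms(5), where Q = "\<lambda>A _. Q A"]
  show "{\<omega> \<in> space M. Q (level E W w \<omega>)} \<in> events" by (rule *(1))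
  show "prob {\<omega> \<in> space M. Q (level E W w \<omega>)} = bexp (cdf D w) E (\<lambda>A. of_bool (Q A))"
    using *(2) assms(2) by simp
qed

end

section \<open>Isolated vertices\<close>

lemma choose_over_power:
  "(\<lambda>n. real ((n - j) choose r) / real n ^ r) \<longlonglongrightarrow> 1 / fact r"
proof (rule tendsto_sandwich)
  show "(\<lambda>n. ((real n - j - r) / real n) ^ r / fact r) \<longlonglongrightarrow> 1 / fact r"
  proof -
    have "(\<lambda>n. ((real n - j - r) / real n) ^ r / fact r) \<longlonglongrightarrow> 1 ^ r / fact r"
      by (intro tendsto_intros) (real_asymp, simp)
    then show ?thesis by simp
  qed
  show "\<forall>\<^sub>F n in sequentially. ((real n - j - r) / real n) ^ r / fact r \<le> real ((n - j) choose r) / real n ^ r"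
    using eventually_ge_at_top[of "j + r + 1"]
  proof eventually_elim
    case (elim n)
    have "(real (n - j) - real r) ^ r \<le> fact r * real ((n - j) choose r)"
      using elim by (intro choose_lower) auto
    then show ?case using elim by (simp add: power_divide of_nat_diff field_simps)
  qed
  show "\<forall>\<^sub>F n in sequentially. real ((n - j) choose r) / real n ^ r \<le> 1 / fact r"
    using eventually_gt_at_top[of 0]
  proof eventually_elim
    case (elim n)
    have "fact r * real ((n - j) choose r) \<le> real (n - j) ^ r" by (rule choose_upper)
    also have "\<dots> \<le> real n ^ r" by (intro power_mono) auto
    finally show ?case using elim by (simp add: field_simps)
  qed
qed simp

text \<open>Identifies \<open>c\<close> as the limiting mean degree. The shift \<open>j\<close>
  covers edges through one vertex that avoid finitely many others, which leaves the limit
  unchanged.\<close>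

lemma density_choose:
  assumes "(\<lambda>n. p n * real n ^ r) \<longlonglongrightarrow> c * fact r"
  shows "(\<lambda>n. p n * real ((n - j) choose r)) \<longlonglongrightarrow> c"
proof -
  have "(\<lambda>n. (p n * real n ^ r) * (real ((n - j) choose r) / real n ^ r)) \<longlonglongrightarrow> (c * fact r) * (1 / fact r)"
    by (intro tendsto_mult assms choose_over_power)
  moreover have "\<forall>\<^sub>F n in sequentially. (p n * real n ^ r) * (real ((n - j) choose r) / real n ^ r)
      = p n * real ((n - j) choose r)"
    using eventually_gt_at_top[of 0] by eventually_elim simp
  ultimately show ?thesis by (simp add: tendsto_cong)
qed

lemma density_to_0:
  assumes "(\<lambda>n. p n * real n ^ r) \<longlonglongrightarrow> c" "0 < r"
  shows "p \<longlonglongrightarrow> 0"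
proof -
  have "(\<lambda>n. (p n * real n ^ r) * inverse (real n ^ r)) \<longlonglongrightarrow> c * 0"
    using assms(2) by (intro tendsto_mult assms(1)) real_asymp
  moreover have "\<forall>\<^sub>F n in sequentially. (p n * real n ^ r) * inverse (real n ^ r) = p n"
    using eventually_gt_at_top[of 0] by eventually_elim simp
  ultimately show ?thesis by (simp add: tendsto_cong)
qed

text \<open>Squeezed through \<open>exp (- p / (1 - p)) \<le> 1 - p \<le> exp (- p)\<close>.\<close>

lemma one_minus_power_tendsto_exp:
  fixes p :: "nat \<Rightarrow> real"
  assumes "p \<longlonglongrightarrow> 0" "\<And>n. 0 \<le> p n" "(\<lambda>n. p n * real (N n)) \<longlonglongrightarrow> c"
  shows "(\<lambda>n. (1 - p n) ^ N n) \<longlonglongrightarrow> exp (- c)"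
proof (rule tendsto_sandwich)
  have "(\<lambda>n. exp (- ((p n * real (N n)) / (1 - p n)))) \<longlonglongrightarrow> exp (- (c / (1 - 0)))"
    by (intro tendsto_intros assms) simp
  then show "(\<lambda>n. exp (- ((p n * real (N n)) / (1 - p n)))) \<longlonglongrightarrow> exp (- c)" by simp
  show "(\<lambda>n. exp (- (p n * real (N n)))) \<longlonglongrightarrow> exp (- c)" by (intro tendsto_intros assms)
  have small: "\<forall>\<^sub>F n in sequentially. p n < 1" using assms(1) by (intro order_tendstoD(2)) auto
  then show "\<forall>\<^sub>F n in sequentially. exp (- ((p n * real (N n)) / (1 - p n))) \<le> (1 - p n) ^ N n"
  proof eventually_elim
    case (elim n)
    have "1 / (1 - p n) = 1 + p n / (1 - p n)" using elim by (simp add: field_simps)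
    also have "\<dots> \<le> exp (p n / (1 - p n))" by (rule exp_ge_add_one_self)
    finally have "exp (- (p n / (1 - p n))) \<le> 1 - p n" using elim by (simp add: exp_minus field_simps)
    then have "exp (- (p n / (1 - p n))) ^ N n \<le> (1 - p n) ^ N n" by (intro power_mono) auto
    then show ?case by (simp add: exp_of_nat_mult[symmetric] mult_ac)
  qed
  from small show "\<forall>\<^sub>F n in sequentially. (1 - p n) ^ N n \<le> exp (- (p n * real (N n)))"
  proof eventually_elim
    case (elim n)
    have "(1 - p n) ^ N n \<le> exp (- p n) ^ N n"
      using elim exp_ge_add_one_self[of "- p n"] by (intro power_mono) auto
    then show ?case by (simp add: exp_of_nat_mult[symmetric] mult_ac)
  qed
qed

lemma card_nsets_at:
  assumes "finite V" "v \<in> V"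
  shows "card {e \<in> nsets V (Suc r). v \<in> e} = (card V - 1) choose r"
proof -
  have eq: "{e \<in> nsets V (Suc r). v \<in> e} = nsets V (Suc r) - nsets (V - {v}) (Suc r)"
    by (auto simp: nsets_def)
  have fin: "finite (nsets (V - {v}) (Suc r))" using assms(1) by (intro finite_imp_finite_nsets) auto
  have "card {e \<in> nsets V (Suc r). v \<in> e} = (card V choose Suc r) - ((card V - 1) choose Suc r)"
    unfolding eq using assms fin
    by (subst card_Diff_subset) (auto simp: card_nsets nsets_mono)
  moreover have "0 < card V" using assms by (auto simp: card_gt_0_iff)
  then obtain m where "card V = Suc m" by (cases "card V") auto
  ultimately show ?thesis by simp
qed

lemma card_nsets_at2:
  assumes "finite V" "u \<in> V" "v \<in> V" "u \<noteq> v"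
  shows "card {e \<in> nsets V (Suc r). u \<in> e \<or> v \<in> e} = ((card V - 1) choose r) + ((card V - 2) choose r)"
proof -
  have "{e \<in> nsets V (Suc r). u \<in> e \<or> v \<in> e}
      = {e \<in> nsets V (Suc r). u \<in> e} \<union> {e \<in> nsets (V - {u}) (Suc r). v \<in> e}"
    by (auto simp: nsets_def)
  also have "card \<dots> = card {e \<in> nsets V (Suc r). u \<in> e} + card {e \<in> nsets (V - {u}) (Suc r). v \<in> e}"
    using assms(1) by (intro card_Un_disjoint finite_Collect_conjI disjI1 finite_imp_finite_nsets) (auto simp: nsets_def)
  finally show ?thesis using assms by (simp add: card_nsets_at numeral_2_eq_2)
qed

definition isolated :: "'v set \<Rightarrow> 'v set set \<Rightarrow> 'v set" where
  "isolated V A = {v\<in>V. \<forall>e\<in>A. v \<notin> e}"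

text \<open>Two distinct vertices are both isolated with probability \<open>\<mu> * \<nu>\<close>,
  where \<open>\<nu>\<close> accounts for the edges at the second that avoid the first. The
  covariance is \<open>\<mu> * (\<nu> - \<mu>)\<close>, and the diagonal contributes at most
  \<open>n\<close>.\<close>

lemma isolated_variance:
  fixes r :: nat and p :: real
  assumes "finite V" "0 \<le> p" "p \<le> 1"
  defines "n \<equiv> card V"
  defines "\<mu> \<equiv> (1 - p) ^ ((n - 1) choose r)" and "\<nu> \<equiv> (1 - p) ^ ((n - 2) choose r)"
  shows "bexp p (nsets V (Suc r)) (\<lambda>A. (real (card (isolated V A)) - real n * \<mu>)\<^sup>2)
    \<le> real n + (real n)\<^sup>2 * (\<nu> - \<mu>)"
proof -
  let ?E = "nsets V (Suc r)"
  have finE: "finite ?E" using assms(1) by (rule finite_imp_finite_nsets)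
  have ind: "of_bool (v \<in> isolated V A) = (of_bool (A \<inter> {e \<in> ?E. v \<in> e} = {}) :: real)"
    if "A \<subseteq> ?E" "v \<in> V" for A v
    using that by (auto simp: isolated_def)
  have ind2: "of_bool (u \<in> isolated V A) * of_bool (v \<in> isolated V A)
      = (of_bool (A \<inter> {e \<in> ?E. u \<in> e \<or> v \<in> e} = {}) :: real)"
    if "A \<subseteq> ?E" "u \<in> V" "v \<in> V" for A u v
    using that by (auto simp: isolated_def)
  have card_eq: "real (card (isolated V A)) = (\<Sum>v\<in>V. of_bool (v \<in> isolated V A))" for A
  proof -
    have "(\<Sum>v\<in>V. of_bool (v \<in> isolated V A)) = (\<Sum>v\<in>isolated V A. 1::real)"
      using assms(1) by (intro sum.mono_neutral_cong_right) (auto simp: isolated_def)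
    then show ?thesis by simp
  qed
  have \<mu>: "0 \<le> \<mu>" "\<mu> \<le> 1" "0 \<le> \<nu>" "\<mu> \<le> \<nu>"
    unfolding \<mu>_def \<nu>_def using assms(2,3)
    by (auto intro!: power_le_one power_decreasing binomial_right_mono)
  have e1: "bexp p ?E (\<lambda>A. of_bool (v \<in> isolated V A)) = \<mu>" if "v \<in> V" for v
  proof -
    have "bexp p ?E (\<lambda>A. of_bool (v \<in> isolated V A)) = bexp p ?E (\<lambda>A. of_bool (A \<inter> {e \<in> ?E. v \<in> e} = {}))"
      using ind that by (intro bexp_cong) auto
    also have "\<dots> = (1 - p) ^ card {e \<in> ?E. v \<in> e}" using finE by (intro bexp_disjoint) auto
    finally show ?thesis using that assms(1) by (simp add: card_nsets_at \<mu>_def n_def)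
  qed
  have E1: "bexp p ?E (\<lambda>A. real (card (isolated V A))) = real n * \<mu>"
    unfolding card_eq bexp_sum by (simp add: e1 n_def)
  have e2: "bexp p ?E (\<lambda>A. of_bool (u \<in> isolated V A) * of_bool (v \<in> isolated V A))
      \<le> of_bool (u = v) + \<mu> * \<nu>" if "u \<in> V" "v \<in> V" for u v
  proof (cases "u = v")
    case True
    have "bexp p ?E (\<lambda>A. of_bool (u \<in> isolated V A) * of_bool (v \<in> isolated V A)) \<le> 1"
      using finE assms(2,3) by (intro bexp_le_const) auto
    then show ?thesis using True \<mu> by (simp add: add_increasing2)
  next
    case False
    have "bexp p ?E (\<lambda>A. of_bool (u \<in> isolated V A) * of_bool (v \<in> isolated V A))
        = bexp p ?E (\<lambda>A. of_bool (A \<inter> {e \<in> ?E. u \<in> e \<or> v \<in> e} = {}))"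
      using ind2 that by (intro bexp_cong) auto
    also have "\<dots> = (1 - p) ^ card {e \<in> ?E. u \<in> e \<or> v \<in> e}" using finE by (intro bexp_disjoint) auto
    finally show ?thesis using that assms(1) False
      by (simp add: card_nsets_at2 \<mu>_def \<nu>_def n_def power_add)
  qed
  have "bexp p ?E (\<lambda>A. (real (card (isolated V A)))\<^sup>2)
      = (\<Sum>u\<in>V. \<Sum>v\<in>V. bexp p ?E (\<lambda>A. of_bool (u \<in> isolated V A) * of_bool (v \<in> isolated V A)))"
    unfolding power2_eq_square card_eq sum_product bexp_sum ..
  also have "\<dots> \<le> (\<Sum>u\<in>V. \<Sum>v\<in>V. of_bool (u = v) + \<mu> * \<nu>)"
    by (intro sum_mono e2)
  also have "\<dots> = real n + (real n)\<^sup>2 * (\<mu> * \<nu>)"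
    using assms(1) by (simp add: sum.distrib n_def power2_eq_square of_bool_def algebra_simps)
  finally have E2: "bexp p ?E (\<lambda>A. (real (card (isolated V A)))\<^sup>2) \<le> real n + (real n)\<^sup>2 * (\<mu> * \<nu>)" .
  have "bexp p ?E (\<lambda>A. (real (card (isolated V A)) - real n * \<mu>)\<^sup>2)
      = bexp p ?E (\<lambda>A. (real (card (isolated V A)))\<^sup>2 + ((- 2 * real n * \<mu>) * real (card (isolated V A)) + (real n * \<mu>)\<^sup>2))"
    by (intro bexp_cong) (auto simp: power2_eq_square algebra_simps)
  also have "\<dots> = bexp p ?E (\<lambda>A. (real (card (isolated V A)))\<^sup>2)
      + ((- 2 * real n * \<mu>) * bexp p ?E (\<lambda>A. real (card (isolated V A))) + (real n * \<mu>)\<^sup>2)"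
    using finE by (simp only: bexp_add bexp_cmult bexp_const)
  also have "\<dots> \<le> real n + (real n)\<^sup>2 * (\<mu> * \<nu>) - (real n)\<^sup>2 * (\<mu> * \<mu>)"
    using E2 unfolding E1 by (simp add: power2_eq_square algebra_simps)
  also have "\<dots> = real n + (real n)\<^sup>2 * (\<mu> * (\<nu> - \<mu>))" by (simp add: algebra_simps)
  also have "\<mu> * (\<nu> - \<mu>) \<le> \<nu> - \<mu>" using \<mu> by (simp add: mult_left_le_one_le)
  finally show ?thesis by (simp add: mult_left_mono)
qed

text \<open>Chebyshev's inequality: \<open>\<mu>\<close> and \<open>\<nu>\<close> have the same
  limit \<open>exp (- c)\<close>, so the variance is of smaller order than the square of
  \<open>n\<close>.\<close>

lemma isolated_whp:
  fixes p :: "nat \<Rightarrow> real"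
  assumes "0 < r" "\<And>n. 0 \<le> p n" "\<And>n. p n \<le> 1"
    and "(\<lambda>n. p n * real n ^ r) \<longlonglongrightarrow> c * fact r" "0 < \<delta>"
  shows "(\<lambda>n. bexp (p n) (nsets {..<n} (Suc r))
     (\<lambda>A. of_bool (real (card (isolated {..<n} A)) < (exp (- c) - \<delta>) * real n))) \<longlonglongrightarrow> 0"
proof -
  define \<mu> where "\<mu> n = (1 - p n) ^ ((n - 1) choose r)" for n
  define \<nu> where "\<nu> n = (1 - p n) ^ ((n - 2) choose r)" for n
  have p0: "p \<longlonglongrightarrow> 0" by (rule density_to_0[OF assms(4,1)])
  have \<mu>: "\<mu> \<longlonglongrightarrow> exp (- c)" and \<nu>: "\<nu> \<longlonglongrightarrow> exp (- c)"
    unfolding \<mu>_def \<nu>_def by (intro one_minus_power_tendsto_exp p0 assms(2) density_choose[OF assms(4)])+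
  have "(\<lambda>n. (1 / real n + (\<nu> n - \<mu> n)) / (\<delta> / 2)\<^sup>2) \<longlonglongrightarrow> (0 + (exp (- c) - exp (- c))) / (\<delta> / 2)\<^sup>2"
    using assms(5) by (intro tendsto_intros \<mu> \<nu> lim_1_over_n) simp
  then have lim: "(\<lambda>n. (1 / real n + (\<nu> n - \<mu> n)) / (\<delta> / 2)\<^sup>2) \<longlonglongrightarrow> 0" by simp
  have "\<forall>\<^sub>F n in sequentially. exp (- c) - \<delta> / 2 < \<mu> n"
    using \<mu> assms(5) by (intro order_tendstoD(1)) auto
  then have ub: "\<forall>\<^sub>F n in sequentially. bexp (p n) (nsets {..<n} (Suc r))
     (\<lambda>A. of_bool (real (card (isolated {..<n} A)) < (exp (- c) - \<delta>) * real n))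
     \<le> (1 / real n + (\<nu> n - \<mu> n)) / (\<delta> / 2)\<^sup>2"
    using eventually_gt_at_top[of 0]
  proof eventually_elim
    case (elim n)
    have pos: "0 < (\<delta> / 2 * real n)\<^sup>2" using elim assms(5) by simp
    have "bexp (p n) (nsets {..<n} (Suc r))
        (\<lambda>A. of_bool (real (card (isolated {..<n} A)) < (exp (- c) - \<delta>) * real n))
      \<le> bexp (p n) (nsets {..<n} (Suc r)) (\<lambda>A. (real (card (isolated {..<n} A)) - real n * \<mu> n)\<^sup>2)
          / (\<delta> / 2 * real n)\<^sup>2"
    proof (rule bexp_markov[OF assms(2,3) pos])
      fix A assume *: "real (card (isolated {..<n} A)) < (exp (- c) - \<delta>) * real n"
      have "(exp (- c) - \<delta>) * real n \<le> (\<mu> n - \<delta> / 2) * real n" using elim by (intro mult_right_mono) auto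
      with * have "\<delta> / 2 * real n \<le> real n * \<mu> n - real (card (isolated {..<n} A))"
        by (simp add: algebra_simps)
      then have "(\<delta> / 2 * real n)\<^sup>2 \<le> (real n * \<mu> n - real (card (isolated {..<n} A)))\<^sup>2"
        using assms(5) by (intro power_mono) auto
      then show "(\<delta> / 2 * real n)\<^sup>2 \<le> (real (card (isolated {..<n} A)) - real n * \<mu> n)\<^sup>2"
        by (simp add: power2_commute)
    qed auto
    also have "\<dots> \<le> (real n + (real n)\<^sup>2 * (\<nu> n - \<mu> n)) / (\<delta> / 2 * real n)\<^sup>2"
      using isolated_variance[of "{..<n}" "p n" r] assms(2,3) pos unfolding \<mu>_def \<nu>_def
      by (intro divide_right_mono) auto
    also have "\<dots> = (1 / real n + (\<nu> n - \<mu> n)) / (\<delta> / 2)\<^sup>2"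
      using elim by (simp add: power_mult_distrib add_divide_distrib power2_eq_square)
    finally show ?case .
  qed
  show ?thesis
    by (rule tendsto_sandwich[OF _ ub tendsto_const lim])
      (intro always_eventually allI bexp_nonneg assms, simp)
qed

section \<open>Deterministic bounds on the spanning weight\<close>

lemma sum_UN_le:
  fixes f :: "'e \<Rightarrow> real" and m :: nat
  assumes "\<And>i. i < m \<Longrightarrow> finite (F i)" "\<And>i e. i < m \<Longrightarrow> e \<in> F i \<Longrightarrow> 0 \<le> f e"
  shows "sum f (\<Union>i<m. F i) \<le> (\<Sum>i<m. sum f (F i))"
  using assms
proof (induction m)
  case (Suc m)
  have "sum f (\<Union>i<Suc m. F i) = sum f (F m \<union> (\<Union>i<m. F i))"
    by (simp add: lessThan_Suc)
  also have "\<dots> \<le> sum f (F m) + sum f (\<Union>i<m. F i)"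
  proof -
    have fin: "finite (F m)" "finite (\<Union>i<m. F i)" using Suc.prems(1) by simp_all
    have "0 \<le> sum f (F m \<inter> (\<Union>i<m. F i))"
      using Suc.prems(2)[of m] by (intro sum_nonneg) blast
    then show ?thesis using sum.union_inter[OF fin, of f] by linarith
  qed
  also have "\<dots> \<le> sum f (F m) + (\<Sum>i<m. sum f (F i))"
  proof -
    have "sum f (\<Union>i<m. F i) \<le> (\<Sum>i<m. sum f (F i))"
    proof (rule Suc.IH)
      show "finite (F i)" if "i < m" for i using Suc.prems(1)[of i] that by simp
      show "0 \<le> f e" if "i < m" "e \<in> F i" for i e using Suc.prems(2)[of i e] that by simp
    qed
    then show ?thesis by simp
  qed
  finally show ?case by simp
qed simp

lemma finite_sums: "finite E \<Longrightarrow> finite {\<Sum>e\<in>H. w e | H. H \<subseteq> E \<and> hg_connected V H}"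
  by (rule finite_subset[of _ "sum w ` Pow E"]) auto

lemma mst_weight_le:
  assumes "finite E" "H \<subseteq> E" "hg_connected V H"
  shows "mst_weight V E w \<le> (\<Sum>e\<in>H. w e)"
  unfolding mst_weight_def using assms by (intro Min_le finite_sums) auto

lemma mst_weight_ge:
  assumes "finite E" "hg_connected V E" "\<And>H. H \<subseteq> E \<Longrightarrow> hg_connected V H \<Longrightarrow> b \<le> (\<Sum>e\<in>H. w e)"
  shows "b \<le> mst_weight V E w"
  unfolding mst_weight_def using assms by (intro Min.boundedI finite_sums) auto

text \<open>Any two vertices lie in a common edge, so the set under \<open>Min\<close> in
  \<open>mst_weight\<close> is nonempty and lower bounds for all its members pass to the
  minimum.\<close>

lemma hg_connected_nsets:
  assumes "finite V" "2 \<le> t" "t \<le> card V"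
  shows "hg_connected V (nsets V t)"
  unfolding hg_connected_def
proof (intro ballI)
  fix u v assume uv: "u \<in> V" "v \<in> V"
  show "(u, v) \<in> reach (nsets V t)"
  proof (cases "u = v")
    case False
    have "card {u, v} \<le> t" using assms(2) False by simp
    then obtain e where "{u, v} \<subseteq> e" "e \<subseteq> V" "card e = t"
      using exists_subset_between[of "{u, v}" t V] assms uv by auto
    moreover have "finite e" using \<open>e \<subseteq> V\<close> assms(1) by (rule finite_subset)
    ultimately show ?thesis by (intro reach_edge[of e]) (auto simp: nsets_def)
  qed simp
qed

section \<open>Lower bound for the spanning weight through isolated vertices\<close>

text \<open>Each vertex other than the root is assigned an edge leading towards the root; the vertex of an
  edge nearest to the root is never assigned that edge, whence the bound on the fibres.\<close>

lemma parent_edges: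
  assumes "hg_connected V H" "v0 \<in> V" "\<And>e. e \<in> H \<Longrightarrow> e \<subseteq> V \<and> finite e \<and> card e = Suc r"
  obtains f where "\<And>v. v \<in> V - {v0} \<Longrightarrow> f v \<in> H \<and> v \<in> f v"
    "\<And>e. e \<in> H \<Longrightarrow> card {v \<in> V - {v0}. f v = e} \<le> r"
proof -
  let ?R = "clique_expansion H"
  define d where "d v = (LEAST k. (v0, v) \<in> ?R ^^ k)" for v
  have dex: "(v0, v) \<in> ?R ^^ d v" if "v \<in> V" for v
  proof -
    have "(v0, v) \<in> ?R\<^sup>*" using assms(1,2) that by (auto simp: hg_connected_def)
    then obtain k where "(v0, v) \<in> ?R ^^ k" by (auto simp: rtrancl_power)
    then show ?thesis unfolding d_def by (rule LeastI)
  qed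
  have dle: "d v \<le> k" if "(v0, v) \<in> ?R ^^ k" for v k
    unfolding d_def using that by (rule Least_le)
  have "\<exists>e u. e \<in> H \<and> u \<in> e \<and> v \<in> e \<and> d u < d v" if "v \<in> V - {v0}" for v
  proof -
    have dv: "(v0, v) \<in> ?R ^^ d v" using dex that by simp
    then have "d v \<noteq> 0" using that by (cases "d v") auto
    then obtain k where k: "d v = Suc k" by (cases "d v") auto
    obtain u where u: "(v0, u) \<in> ?R ^^ k" "(u, v) \<in> ?R" using dv unfolding k by auto
    then have "d u < d v" using dle[OF u(1)] k by simp
    with u(2) show ?thesis by (auto simp: clique_expansion_def)
  qed
  then obtain f where f: "\<And>v. v \<in> V - {v0} \<Longrightarrow> \<exists>u. f v \<in> H \<and> u \<in> f v \<and> v \<in> f v \<and> d u < d v"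
    by metis
  show thesis
  proof (rule that[of f])
    show "f v \<in> H \<and> v \<in> f v" if "v \<in> V - {v0}" for v using f[OF that] by auto
    fix e assume e: "e \<in> H"
    have fe: "finite e" "card e = Suc r" using assms(3)[OF e] by auto
    then have "e \<noteq> {}" by auto
    then obtain u where u: "u \<in> e" "\<And>u'. u' \<in> e \<Longrightarrow> d u \<le> d u'"
      using ex_min_if_finite[of "d ` e"] fe(1) by (metis (no_types, lifting) arg_min_if_finite(1) arg_min_least)
    have "{v \<in> V - {v0}. f v = e} \<subseteq> e - {u}"
    proof
      fix v assume v: "v \<in> {v \<in> V - {v0}. f v = e}"
      then obtain u' where "u' \<in> e" "v \<in> e" "d u' < d v" using f[of v] by auto
      moreover have "v \<noteq> u" using u(2)[of u'] \<open>u' \<in> e\<close> \<open>d u' < d v\<close> by auto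
      ultimately show "v \<in> e - {u}" by simp
    qed
    then have "card {v \<in> V - {v0}. f v = e} \<le> card (e - {u})" using fe by (intro card_mono) auto
    then show "card {v \<in> V - {v0}. f v = e} \<le> r" using fe u(1) by simp
  qed
qed

lemma connected_weight_lower:
  assumes "finite V" "H \<subseteq> nsets V (Suc r)" "hg_connected V H" "v0 \<in> V"
    and "\<And>e. e \<in> nsets V (Suc r) \<Longrightarrow> 0 \<le> w e"
    and "\<And>v. v \<in> V \<Longrightarrow> \<forall>e\<in>nsets V (Suc r). v \<in> e \<longrightarrow> Y v \<le> w e"
  shows "(\<Sum>v\<in>V - {v0}. Y v) \<le> real r * (\<Sum>e\<in>H. w e)"
proof -
  have finH: "finite H" using finite_subset[OF assms(2) finite_imp_finite_nsets[OF assms(1)]] .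
  have "e \<subseteq> V \<and> finite e \<and> card e = Suc r" if "e \<in> H" for e
    using that assms(2) by (auto simp: nsets_def)
  from parent_edges[OF assms(3,4) this]
  obtain f where f: "\<And>v. v \<in> V - {v0} \<Longrightarrow> f v \<in> H \<and> v \<in> f v"
    "\<And>e. e \<in> H \<Longrightarrow> card {v \<in> V - {v0}. f v = e} \<le> r" by metis
  have "(\<Sum>v\<in>V - {v0}. Y v) \<le> (\<Sum>v\<in>V - {v0}. w (f v))"
  proof (rule sum_mono)
    fix v assume v: "v \<in> V - {v0}"
    then show "Y v \<le> w (f v)" using f(1)[OF v] assms(2,6) by blast
  qed
  also have "\<dots> = (\<Sum>e\<in>H. \<Sum>v\<in>{v \<in> V - {v0}. f v = e}. w (f v))"
    using assms(1) finH f(1) by (intro sum.group[symmetric]) auto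
  also have "\<dots> = (\<Sum>e\<in>H. real (card {v \<in> V - {v0}. f v = e}) * w e)"
    by (intro sum.cong refl) simp
  also have "\<dots> \<le> (\<Sum>e\<in>H. real r * w e)"
    using f(2) assms(2,5) by (intro sum_mono mult_right_mono) auto
  also have "\<dots> = real r * (\<Sum>e\<in>H. w e)" by (simp add: sum_distrib_left)
  finally show ?thesis .
qed

text \<open>A discretised layer-cake sum. At the largest \<open>i\<close> whose condition holds, the
  full sum is \<open>i * \<delta> < x\<close>; later terms vanish.\<close>

lemma staircase_le:
  assumes "0 < \<delta>" "0 \<le> (x::real)"
  shows "(\<Sum>i=1..m. \<delta> * of_bool (real i * \<delta> < x)) \<le> x"
proof (induction m)
  case (Suc m)
  show ?case
  proof (cases "real (Suc m) * \<delta> < x")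
    case True
    have "(\<Sum>i=1..Suc m. \<delta> * of_bool (real i * \<delta> < x)) \<le> (\<Sum>i=1..Suc m. \<delta>)"
      using assms(1) by (intro sum_mono) auto
    also have "\<dots> \<le> x" using True by simp
    finally show ?thesis .
  next
    case False
    then show ?thesis using Suc by simp
  qed
qed (use assms in simp)

text \<open>\<open>\<delta>\<close> times the number of levels at which \<open>v\<close> is isolated
  is at most the weight of every edge at \<open>v\<close>, by \<open>staircase_le\<close>. Summing
  over the vertices and exchanging the sums produces the counts of isolated vertices; the subtracted
  1 stands for the root.\<close>

lemma mst_weight_lower:
  assumes "finite V" "2 \<le> Suc r" "Suc r \<le> card V" "\<And>e. e \<in> nsets V (Suc r) \<Longrightarrow> 0 \<le> w e" "0 < \<delta>"
  shows "(\<Sum>i=1..m. \<delta> * (real (card (isolated V {e \<in> nsets V (Suc r). w e \<le> real i * \<delta>})) - 1))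
    \<le> real r * mst_weight V (nsets V (Suc r)) w"
proof -
  let ?E = "nsets V (Suc r)"
  define I where "I i = isolated V {e \<in> ?E. w e \<le> real i * \<delta>}" for i :: nat
  have finE: "finite ?E" using assms(1) by (rule finite_imp_finite_nsets)
  have "V \<noteq> {}" using assms(3) by auto
  then obtain v0 where v0: "v0 \<in> V" by auto
  define Y where "Y v = (\<Sum>i=1..m. \<delta> * of_bool (v \<in> I i))" for v
  have Y: "Y v \<le> w e" if "v \<in> V" "e \<in> ?E" "v \<in> e" for v e
  proof -
    have "Y v \<le> (\<Sum>i=1..m. \<delta> * of_bool (real i * \<delta> < w e))"
      unfolding Y_def using that assms(5)
      by (intro sum_mono mult_left_mono) (auto simp: I_def isolated_def not_le)
    also have "\<dots> \<le> w e" using that assms by (intro staircase_le) auto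
    finally show ?thesis .
  qed
  have "(\<Sum>i=1..m. \<delta> * (real (card (I i)) - 1)) \<le> (\<Sum>v\<in>V - {v0}. Y v)"
  proof -
    have "(\<Sum>v\<in>V - {v0}. Y v) = (\<Sum>i=1..m. \<delta> * (\<Sum>v\<in>V - {v0}. of_bool (v \<in> I i)))"
      unfolding Y_def by (subst sum.swap) (simp add: sum_distrib_left)
    moreover have "real (card (I i)) - 1 \<le> (\<Sum>v\<in>V - {v0}. of_bool (v \<in> I i))" for i
    proof -
      have "(\<Sum>v\<in>V - {v0}. of_bool (v \<in> I i)) = (\<Sum>v\<in>I i - {v0}. 1::real)"
        using assms(1) by (intro sum.mono_neutral_cong_right) (auto simp: I_def isolated_def)
      moreover have "card (I i) - 1 \<le> card (I i - {v0})" by (simp add: card_Diff_singleton_if)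
      ultimately show ?thesis by simp
    qed
    ultimately show ?thesis using assms(5) by (auto intro!: sum_mono mult_left_mono)
  qed
  moreover have "(\<Sum>v\<in>V - {v0}. Y v) / real r \<le> mst_weight V ?E w"
  proof (rule mst_weight_ge[OF finE])
    show "hg_connected V ?E" using assms by (intro hg_connected_nsets)
    fix H assume H: "H \<subseteq> ?E" "hg_connected V H"
    have "(\<Sum>v\<in>V - {v0}. Y v) \<le> real r * (\<Sum>e\<in>H. w e)"
      using Y by (intro connected_weight_lower[OF assms(1) H v0 assms(4)]) auto
    then show "(\<Sum>v\<in>V - {v0}. Y v) / real r \<le> (\<Sum>e\<in>H. w e)"
      using assms(2) by (simp add: divide_le_eq mult.commute)
  qed
  moreover have "0 < real r" using assms(2) by simp
  ultimately show ?thesis unfolding I_def by (simp add: field_simps)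
qed

section \<open>Upper bound for the spanning weight along a mesh of levels\<close>

text \<open>An edge present at the new level is old, is kept, or lies inside \<open>S m\<close>,
  whose vertices are already joined at the level below. In each case its ends are connected by kept
  edges.\<close>

lemma reach_restricted_levels:
  assumes "\<And>i. i < m \<Longrightarrow> A i \<subseteq> A (Suc i)" "A 0 = {}"
    and "\<And>i. i \<le> m \<Longrightarrow> S i \<times> S i \<subseteq> reach (A i)"
  shows "reach (A m) \<subseteq> reach (\<Union>i<m. {e \<in> A (Suc i) - A i. \<not> e \<subseteq> S i})"
  using assms(1,3)
proof (induction m)
  case 0
  then show ?case using assms(2) by simp
next
  case (Suc m)
  let ?H = "\<lambda>m. \<Union>i<m. {e \<in> A (Suc i) - A i. \<not> e \<subseteq> S i}"
  have IH: "reach (A m) \<subseteq> reach (?H m)" using Suc by simp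
  have mono: "reach (?H m) \<subseteq> reach (?H (Suc m))" by (rule reach_mono) (auto simp: lessThan_Suc)
  show ?case
  proof (rule reach_cover)
    fix e u v assume e: "e \<in> A (Suc m)" "u \<in> e" "v \<in> e"
    consider "e \<in> A m" | "e \<subseteq> S m" | "e \<in> ?H (Suc m)" using e(1) by (auto simp: lessThan_Suc)
    then show "(u, v) \<in> reach (?H (Suc m))"
    proof cases
      case 1
      then have "(u, v) \<in> reach (A m)" using e(2,3) by (intro reach_edge[of e]) auto
      then show ?thesis using IH mono by blast
    next
      case 2
      then have "(u, v) \<in> reach (A m)" using Suc.prems(2)[of m] e(2,3) by auto
      then show ?thesis using IH mono by blast
    next
      case 3
      then show ?thesis using e(2,3) by (intro reach_edge[of e]) auto
    qed
  qed
qed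

text \<open>The kept edges connect \<open>S m\<close>. Each vertex outside receives one further edge
  whose other vertices lie in \<open>S m\<close>; its weight is bounded through the level
  \<open>y j\<close> at which such an edge is found. \<open>B j\<close> collects the vertices that
  have none up to \<open>y j\<close>, so summing over vertices turns these bounds into the sizes of
  the \<open>B j\<close>.\<close>

lemma mst_weight_upper:
  fixes x y :: "nat \<Rightarrow> real"
  assumes "finite V" "0 < r" "\<And>e. e \<in> nsets V (Suc r) \<Longrightarrow> 0 \<le> w e"
  defines "A \<equiv> \<lambda>z. {e \<in> nsets V (Suc r). w e \<le> z}"
  assumes "A (x 0) = {}" "\<And>i. x i \<le> x (Suc i)" "\<And>i. 0 \<le> x i" "\<And>i. 0 \<le> y i"
    and "\<And>i. i \<le> m \<Longrightarrow> S i \<subseteq> V \<and> S i \<times> S i \<subseteq> reach (A (x i))" "S m \<noteq> {}"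
  defines "B \<equiv> \<lambda>j. {v \<in> V - S m. \<forall>e\<in>A (y j). v \<in> e \<longrightarrow> \<not> e - {v} \<subseteq> S m}"
  assumes "B J = {}"
  shows "mst_weight V (nsets V (Suc r)) w
    \<le> (\<Sum>i<m. x (Suc i) * real (card {e \<in> A (x (Suc i)) - A (x i). \<not> e \<subseteq> S i}))
      + (y 0 * real (card (V - S m)) + (\<Sum>j<J. y (Suc j) * real (card (B j))))"
proof -
  let ?E = "nsets V (Suc r)"
  have finE: "finite ?E" using assms(1) by (rule finite_imp_finite_nsets)
  define F where "F i = {e \<in> A (x (Suc i)) - A (x i). \<not> e \<subseteq> S i}" for i
  have FE: "F i \<subseteq> ?E" for i by (auto simp: F_def A_def)
  have finF: "finite (F i)" for i using FE finE by (rule finite_subset)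
  define G where "G = (\<Union>i<m. F i)"
  have AG: "reach (A (x m)) \<subseteq> reach G"
    unfolding G_def F_def
  proof (rule reach_restricted_levels)
    show "A (x i) \<subseteq> A (x (Suc i))" for i using assms(6)[of i] by (auto simp: A_def)
  qed (use assms(5,9) in auto)
  have ex: "\<exists>e. e \<in> ?E \<and> v \<in> e \<and> e - {v} \<subseteq> S m \<and>
      w e \<le> y 0 + (\<Sum>j<J. y (Suc j) * of_bool (v \<in> B j))" if v: "v \<in> V - S m" for v
  proof -
    \<comment> \<open>The first level at which \<open>v\<close> can be attached. If it is positive,
      \<open>v\<close> lies in the preceding \<open>B\<close>, and that one summand already equals
      \<open>y j\<close>.\<close>
    define j where "j = (LEAST j. v \<notin> B j)"
    have vj: "v \<notin> B j" unfolding j_def by (rule LeastI[of _ J]) (simp add: assms(12))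
    have jJ: "j \<le> J" unfolding j_def by (rule Least_le) (simp add: assms(12))
    obtain e where e: "e \<in> A (y j)" "v \<in> e" "e - {v} \<subseteq> S m" using vj v by (auto simp: B_def)
    have nn: "0 \<le> (\<Sum>j<J. y (Suc j) * of_bool (v \<in> B j))" using assms(8) by (intro sum_nonneg) auto
    have "y j \<le> y 0 + (\<Sum>j<J. y (Suc j) * of_bool (v \<in> B j))"
    proof (cases j)
      case 0
      then show ?thesis using nn by simp
    next
      case (Suc k)
      then have "v \<in> B k" unfolding j_def using not_less_Least[of k "\<lambda>j. v \<notin> B j"] by auto
      then have "y j = (\<Sum>j\<in>{k}. y (Suc j) * of_bool (v \<in> B j))" using Suc by simp
      also have "\<dots> \<le> (\<Sum>j<J. y (Suc j) * of_bool (v \<in> B j))"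
        using Suc jJ assms(8) by (intro sum_mono2) auto
      finally show ?thesis using assms(8)[of 0] by simp
    qed
    then show ?thesis using e by (intro exI[of _ e]) (auto simp: A_def)
  qed
  have "\<exists>f. \<forall>v\<in>V - S m. f v \<in> ?E \<and> v \<in> f v \<and> f v - {v} \<subseteq> S m \<and>
      w (f v) \<le> y 0 + (\<Sum>j<J. y (Suc j) * of_bool (v \<in> B j))"
    by (intro bchoice ballI ex)
  then obtain f where "\<forall>v\<in>V - S m. f v \<in> ?E \<and> v \<in> f v \<and> f v - {v} \<subseteq> S m \<and>
      w (f v) \<le> y 0 + (\<Sum>j<J. y (Suc j) * of_bool (v \<in> B j))" ..
  note f = bspec[OF this]
  define H where "H = G \<union> f ` (V - S m)"
  have HE: "H \<subseteq> ?E" using f FE by (auto simp: H_def G_def)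
  obtain s where s: "s \<in> S m" using assms(10) by auto
  have GH: "reach G \<subseteq> reach H" by (rule reach_mono) (auto simp: H_def)
  have S: "(s, v) \<in> reach H" if "v \<in> S m" for v
    using assms(9)[of m] s that AG GH by blast
  have "(s, v) \<in> reach H" if v: "v \<in> V" for v
  proof (cases "v \<in> S m")
    case False
    then have fv: "f v \<in> ?E" "v \<in> f v" "f v - {v} \<subseteq> S m" "f v \<in> H" using f[of v] v by (auto simp: H_def)
    have "f v \<noteq> {v}" using fv(1) assms(2) by (auto simp: nsets_def)
    then obtain u where u: "u \<in> f v" "u \<noteq> v" using fv(2) by auto
    then have "(s, u) \<in> reach H" using S[of u] fv(3) by auto
    moreover have "(u, v) \<in> reach H" using reach_edge[OF fv(4) u(1) fv(2)] .
    ultimately show ?thesis by (rule rtrancl_trans)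
  qed (rule S)
  then have "hg_connected V H"
    unfolding hg_connected_def by (meson reach_sym rtrancl_trans)
  then have "mst_weight V ?E w \<le> (\<Sum>e\<in>H. w e)" by (rule mst_weight_le[OF finE HE])
  also have "\<dots> \<le> sum w G + sum w (f ` (V - S m))"
  proof -
    have "finite G" using finF by (auto simp: G_def)
    moreover have "0 \<le> sum w (G \<inter> f ` (V - S m))"
      using FE assms(3) by (intro sum_nonneg) (auto simp: G_def)
    moreover have "finite (f ` (V - S m))" using assms(1) by auto
    ultimately show ?thesis unfolding H_def using sum.union_inter[of G "f ` (V - S m)" w] by simp
  qed
  also have "sum w G \<le> (\<Sum>i<m. sum w (F i))"
    unfolding G_def using finF FE assms(3) by (intro sum_UN_le) auto
  also have "\<dots> \<le> (\<Sum>i<m. x (Suc i) * real (card (F i)))"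
  proof (rule sum_mono)
    fix i
    have "sum w (F i) \<le> real (card (F i)) * x (Suc i)"
      by (rule sum_bounded_above) (auto simp: F_def A_def)
    then show "sum w (F i) \<le> x (Suc i) * real (card (F i))" by (simp add: mult.commute)
  qed
  also have "sum w (f ` (V - S m)) \<le> (\<Sum>v\<in>V - S m. w (f v))"
    using sum_image_le[of "V - S m" w f] assms(1,3) f by (simp add: o_def)
  also have "\<dots> \<le> (\<Sum>v\<in>V - S m. y 0 + (\<Sum>j<J. y (Suc j) * of_bool (v \<in> B j)))"
    using f by (intro sum_mono) auto
  also have "\<dots> = y 0 * real (card (V - S m)) + (\<Sum>j<J. y (Suc j) * (\<Sum>v\<in>V - S m. of_bool (v \<in> B j)))"
    unfolding sum.distrib by (subst sum.swap) (simp add: sum_distrib_left)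
  also have "(\<Sum>j<J. y (Suc j) * (\<Sum>v\<in>V - S m. of_bool (v \<in> B j))) = (\<Sum>j<J. y (Suc j) * real (card (B j)))"
  proof (intro sum.cong refl arg_cong2[where f = "(*)"])
    fix j
    have "(\<Sum>v\<in>V - S m. of_bool (v \<in> B j)) = (\<Sum>v\<in>B j. 1::real)"
      using assms(1) by (intro sum.mono_neutral_cong_right) (auto simp: B_def)
    then show "(\<Sum>v\<in>V - S m. of_bool (v \<in> B j)) = real (card (B j))" by simp
  qed
  finally show ?thesis unfolding F_def by simp
qed

section \<open>The limit constants\<close>

abbreviation unit_integral :: "(real \<Rightarrow> real) \<Rightarrow> real" where
  "unit_integral f \<equiv> (LBINT x:{0<..<1}. f x)"

abbreviation unit_integrable :: "(real \<Rightarrow> real) \<Rightarrow> bool" where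
  "unit_integrable f \<equiv> set_integrable lborel {0<..<1} f"

section \<open>Integrability of powers of logarithms on the unit interval\<close>

lemma FTC_open_interval:
  fixes a b :: real
  assumes "a < b" "\<And>x. a < x \<Longrightarrow> x < b \<Longrightarrow> (F has_real_derivative f x) (at x)"
    "\<And>x. a < x \<Longrightarrow> x < b \<Longrightarrow> isCont f x" "\<And>x. a < x \<Longrightarrow> x < b \<Longrightarrow> 0 \<le> f x"
    "(F \<longlongrightarrow> A) (at_right a)" "(F \<longlongrightarrow> B) (at_left b)"
  shows "set_integrable lborel {a<..<b} f" "(LBINT x:{a<..<b}. f x) = B - A"
proof -
  have e: "einterval (ereal a) (ereal b) = {a<..<b}" by (auto simp: einterval_def)
  have lim: "((F \<circ> real_of_ereal) \<longlongrightarrow> A) (at_right (ereal a))" "((F \<circ> real_of_ereal) \<longlongrightarrow> B) (at_left (ereal b))"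
    using assms(5,6) by (simp_all add: ereal_tendsto_simps)
  note * = interval_integral_FTC_nonneg[of "ereal a" "ereal b" F f A B, OF _ _ _ _ lim]
  show "set_integrable lborel {a<..<b} f" using *(1) assms by (auto simp: e)
  have "(LBINT x=ereal a..ereal b. f x) = B - A" using *(2) assms by (auto simp: e)
  then show "(LBINT x:{a<..<b}. f x) = B - A"
    using assms(1) by (simp add: interval_lebesgue_integral_def e)
qed

lemma inverse_sqrt_tail:
  assumes "0 \<le> a" "a < 1"
  shows "set_integrable lborel {a<..<1} (\<lambda>x. (1 - x) powr (-1/2))"
    "(LBINT x:{a<..<1}. (1 - x) powr (-1/2)) = 2 * sqrt (1 - a)"
proof -
  let ?F = "\<lambda>x::real. - 2 * (1 - x) powr (1/2)"
  have d: "(?F has_real_derivative (1 - x) powr (-1/2)) (at x)" if "a < x" "x < 1" for x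
    using that by (auto intro!: derivative_eq_intros simp: divide_simps powr_diff powr_minus)
  have c: "isCont (\<lambda>x. (1 - x) powr (-1/2)) x" if "a < x" "x < 1" for x
    using that by (auto intro!: continuous_intros)
  have l1: "(?F \<longlongrightarrow> - 2 * (1 - a) powr (1/2)) (at_right a)"
    using assms by (intro tendsto_intros) auto
  have l2: "(?F \<longlongrightarrow> 0) (at_left 1)" by real_asymp
  note * = FTC_open_interval[OF assms(2) d c _ l1 l2]
  show "set_integrable lborel {a<..<1} (\<lambda>x. (1 - x) powr (-1/2))" using *(1) by auto
  show "(LBINT x:{a<..<1}. (1 - x) powr (-1/2)) = 2 * sqrt (1 - a)"
    using *(2) assms by (auto simp: powr_half_sqrt)
qed

text \<open>The integrands grow at 1 no faster than a power of \<open>lg\<close> with exponent at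
  most 2, and \<open>(1 - x) powr (-1/2)\<close> dominates all of them.\<close>

lemma unit_integrable_bound:
  assumes "f \<in> borel_measurable borel" "\<And>x. 0 < x \<Longrightarrow> x < 1 \<Longrightarrow> 0 \<le> f x \<and> f x \<le> k * (1 - x) powr (-1/2)"
  shows "unit_integrable f"
proof (rule set_integrable_bound)
  show "unit_integrable (\<lambda>x. k * (1 - x) powr (-1/2))"
    using inverse_sqrt_tail(1)[of 0] by (intro set_integrable_mult_right) auto
  show "set_borel_measurable lborel {0<..<1} f"
    unfolding set_borel_measurable_def using assms(1) by measurable
  show "AE x in lborel. x \<in> {0<..<1} \<longrightarrow> norm (f x) \<le> norm (k * (1 - x) powr (-1/2))"
    using assms(2) by (intro AE_I2) force
qed

text \<open>For \<open>x\<close> uniform on the unit interval this is a standard exponential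
  variable. Its tail \<open>exp (- c)\<close> is the limiting proportion of isolated vertices at
  mean degree \<open>c\<close>, so \<open>lg x\<close> plays the mean degree at which a vertex
  ceases to be isolated.\<close>

definition lg :: "real \<Rightarrow> real" where "lg x = - ln (1 - x)"

lemma lg_measurable [measurable]: "lg \<in> borel_measurable borel"
  unfolding lg_def by measurable

lemma cfun_measurable [measurable]: "cfun t \<in> borel_measurable borel"
  unfolding cfun_def by measurable

lemma lg_pos: "0 < x \<Longrightarrow> x < 1 \<Longrightarrow> 0 < lg x"
  by (simp add: lg_def)

text \<open>\<open>ln z \<le> z - 1\<close> at \<open>z = (a * u) powr (-1/4)\<close>; the exponent
  leaves the square of the bound integrable. Scaling by \<open>a\<close> extracts
  \<open>ln a\<close>, for use where \<open>u\<close> is of order \<open>1 / a\<close>.\<close>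

lemma lg_bound:
  fixes u a :: real
  assumes "0 < u" "u \<le> 1" "0 < a"
  shows "- ln u \<le> ln a + 4 * ((a * u) powr (-1/4) - 1)"
proof -
  have "- ln ((a * u) powr (1/4)) = ln ((a * u) powr (-1/4))"
    using assms by (simp add: ln_powr)
  also have "\<dots> \<le> (a * u) powr (-1/4) - 1" using assms by (intro ln_le_minus_one) simp
  finally have "- ln (a * u) \<le> 4 * ((a * u) powr (-1/4) - 1)" using assms by (simp add: ln_powr)
  then show ?thesis using assms by (simp add: ln_mult)
qed

lemma powr_quarter:
  fixes u :: real
  assumes "0 < u"
  shows "(u powr (-1/4))\<^sup>2 = u powr (-1/2)"
  using assms by (simp add: power2_eq_square powr_add[symmetric])

lemma powr_le_sq:
  fixes y b p :: real
  assumes "0 \<le> y" "y \<le> b" "1 \<le> b" "0 \<le> p" "p \<le> 2"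
  shows "y powr p \<le> b\<^sup>2"
proof -
  have "y powr p \<le> b powr p" using assms by (intro powr_mono2) auto
  also have "\<dots> \<le> b powr 2" using assms by (intro powr_mono) auto
  finally show ?thesis using assms by (simp add: powr_numeral)
qed

lemma quarter_ge_1: "0 < u \<Longrightarrow> u \<le> 1 \<Longrightarrow> 1 \<le> (u::real) powr (-1/4)"
  using powr_mono2'[of "-1/4" u 1] by simp

lemma lg_powr_bound:
  assumes "0 < x" "x < 1" "0 \<le> p" "p \<le> 2"
  shows "lg x powr p \<le> 16 * (1 - x) powr (-1/2)"
proof -
  have "1 \<le> (1 - x) powr (-1/4)" using quarter_ge_1[of "1 - x"] assms by simp
  moreover have "lg x \<le> 4 * (1 - x) powr (-1/4)"
    using lg_bound[of "1 - x" 1] assms by (simp add: lg_def)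
  ultimately have "lg x powr p \<le> (4 * (1 - x) powr (-1/4))\<^sup>2"
    using assms lg_pos[of x] by (intro powr_le_sq) auto
  then show ?thesis using assms by (simp add: power_mult_distrib powr_quarter[simplified])
qed

lemma lg_powr_integrable:
  assumes "0 \<le> p" "p \<le> 2"
  shows "unit_integrable (\<lambda>x. lg x powr p)"
  using lg_powr_bound assms by (intro unit_integrable_bound[where k = 16]) auto

lemma one_minus_power_bounds:
  fixes x :: real
  assumes "0 < x" "x < 1" "0 < r"
  shows "x \<le> 1 - (1 - x) ^ r" "1 - (1 - x) ^ r \<le> real r * x" "1 - (1 - x) ^ r \<le> 1"
proof -
  have "(1 - x) ^ r \<le> (1 - x) ^ 1" using assms by (intro power_decreasing) auto
  then show "x \<le> 1 - (1 - x) ^ r" by simp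
  have "1 + real r * (- x) \<le> (1 + (- x)) ^ r" using assms by (intro Bernoulli_inequality) auto
  then show "1 - (1 - x) ^ r \<le> real r * x" by simp
  show "1 - (1 - x) ^ r \<le> 1" using assms by simp
qed

lemma cfun_lg: "cfun t x = lg x / (1 - (1 - x) ^ (t - 1))"
  by (simp add: cfun_def lg_def) (metis minus_diff_eq minus_divide_right)

text \<open>Follows from \<open>x \<le> lg x\<close> and Bernoulli's inequality. The bound
  \<open>1 / (t - 1)\<close> is the critical mean degree, the limit of \<open>cfun\<close> at 0; it
  allows an additive error in \<open>cfun\<close> to be treated as a multiplicative one.\<close>

lemma cfun_lower:
  assumes "2 \<le> t" "0 < x" "x < 1"
  shows "1 \<le> (real t - 1) * cfun t x"
proof -
  have b: "0 < 1 - (1 - x) ^ (t - 1)" "1 - (1 - x) ^ (t - 1) \<le> real (t - 1) * x"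
    using one_minus_power_bounds[of x "t - 1"] assms by auto
  have "x \<le> lg x" using ln_le_minus_one[of "1 - x"] assms by (simp add: lg_def)
  then have "real (t - 1) * x \<le> real (t - 1) * lg x" by (intro mult_left_mono) auto
  then have "1 - (1 - x) ^ (t - 1) \<le> real (t - 1) * lg x" using b by linarith
  then have "1 \<le> real (t - 1) * lg x / (1 - (1 - x) ^ (t - 1))" using b by (simp add: le_divide_eq)
  then show ?thesis using assms(1) by (simp add: cfun_lg of_nat_diff)
qed

text \<open>Near 0 the denominator of \<open>cfun\<close> may be as small as \<open>x\<close>, so
  the bound on \<open>lg x\<close> has to carry a factor \<open>x\<close>. It comes from
  \<open>1 - (1 - x) powr (1/4) \<le> x\<close>.\<close>

lemma cfun_powr_bound:
  assumes "2 \<le> t" "0 < x" "x < 1" "0 \<le> p" "p \<le> 2"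
  shows "cfun t x powr p \<le> 16 * (1 - x) powr (-1/2)"
proof -
  let ?u = "1 - x"
  have q: "1 \<le> ?u powr (-1/4)" using quarter_ge_1[of ?u] assms by simp
  have "lg x \<le> 4 * (?u powr (-1/4) - 1)"
    using lg_bound[of "1 - x" 1] assms by (simp add: lg_def)
  also have "\<dots> \<le> 4 * (?u powr (-1/4)) * x"
  proof -
    have "?u \<le> ?u powr (1/4)" using powr_mono'[of "1/4" 1 ?u] assms by simp
    then have "1 - ?u powr (1/4) \<le> x" by simp
    then have "?u powr (-1/4) * (1 - ?u powr (1/4)) \<le> ?u powr (-1/4) * x" by (intro mult_left_mono) auto
    moreover have "?u powr (-1/4) * ?u powr (1/4) = 1" using assms by (simp add: powr_add[symmetric])
    ultimately show ?thesis by (simp add: right_diff_distrib)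
  qed
  also have "\<dots> \<le> 4 * (?u powr (-1/4)) * (1 - ?u ^ (t - 1))"
    using one_minus_power_bounds(1)[of x "t - 1"] assms by (intro mult_left_mono) auto
  finally have "cfun t x \<le> 4 * (?u powr (-1/4))"
    using one_minus_power_bounds(1)[of x "t - 1"] assms by (simp add: cfun_lg divide_le_eq)
  then have "cfun t x powr p \<le> (4 * ?u powr (-1/4))\<^sup>2"
    using assms cfun_pos[of t x] q by (intro powr_le_sq) auto
  then show ?thesis using assms by (simp add: power_mult_distrib powr_quarter[simplified])
qed

lemma exponent_eq:
  assumes "2 \<le> t"
  shows "real t / (real t - 1) = 1 + 1 / real (t - 1)" "1 / real (t - 1) \<le> 1"
  using assms by (auto simp: field_simps of_nat_diff)

lemma constants_integrable:
  assumes "2 \<le> t"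
  shows "unit_integrable (\<lambda>x. cfun t x powr (real t / (real t - 1)) * x ^ (t - 1))"
    "unit_integrable (\<lambda>x. cfun t x powr (real t / (real t - 1)) * (1 - (1 - x) ^ (t - 1)))"
proof -
  have p: "0 \<le> real t / (real t - 1)" "real t / (real t - 1) \<le> 2" using assms by (auto simp: field_simps)
  show "unit_integrable (\<lambda>x. cfun t x powr (real t / (real t - 1)) * x ^ (t - 1))"
  proof (rule unit_integrable_bound[where k = 16])
    fix x :: real assume x: "0 < x" "x < 1"
    have "cfun t x powr (real t / (real t - 1)) * x ^ (t - 1) \<le> cfun t x powr (real t / (real t - 1)) * 1"
      using x by (intro mult_left_mono power_le_one) auto
    then show "0 \<le> cfun t x powr (real t / (real t - 1)) * x ^ (t - 1) \<and>
      cfun t x powr (real t / (real t - 1)) * x ^ (t - 1) \<le> 16 * (1 - x) powr (-1/2)"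
      using cfun_powr_bound[OF assms x p] x by simp
  qed measurable
  show "unit_integrable (\<lambda>x. cfun t x powr (real t / (real t - 1)) * (1 - (1 - x) ^ (t - 1)))"
  proof (rule unit_integrable_bound[where k = 16])
    fix x :: real assume x: "0 < x" "x < 1"
    have "cfun t x powr (real t / (real t - 1)) * (1 - (1 - x) ^ (t - 1)) \<le> cfun t x powr (real t / (real t - 1)) * 1"
      using x by (intro mult_left_mono) auto
    then show "0 \<le> cfun t x powr (real t / (real t - 1)) * (1 - (1 - x) ^ (t - 1)) \<and>
      cfun t x powr (real t / (real t - 1)) * (1 - (1 - x) ^ (t - 1)) \<le> 16 * (1 - x) powr (-1/2)"
      using cfun_powr_bound[OF assms x p] x by (simp add: power_le_one)
  qed measurable
qed

lemma unit_integral_mono: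
  assumes "unit_integrable f" "unit_integrable g" "\<And>x. 0 < x \<Longrightarrow> x < 1 \<Longrightarrow> f x \<le> g x"
  shows "unit_integral f \<le> unit_integral g"
  using assms by (intro set_integral_mono) auto

section \<open>Comparing the bound from isolated vertices with \<open>L_const\<close>\<close>

lemma powr_inverse_Bernoulli:
  assumes "0 \<le> y" "0 < r"
  shows "(1 + y) powr (1 / real r) \<le> 1 + y / real r"
proof -
  have "1 + real r * (y / real r) \<le> (1 + y / real r) ^ r"
    using assms by (intro Bernoulli_inequality) (auto simp: field_simps)
  then have "(1 + y) powr (1 / real r) \<le> ((1 + y / real r) ^ r) powr (1 / real r)"
    using assms by (intro powr_mono2) auto
  also have "\<dots> = ((1 + y / real r) powr real r) powr (1 / real r)"
    using assms by (subst powr_realpow) (auto intro: add_pos_nonneg)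
  also have "\<dots> = 1 + y / real r" using assms by (simp add: powr_powr)
  finally show ?thesis .
qed

text \<open>The functional equation of the Gamma function, since both integrals are moments of an
  exponential variable. \<open>(1 - x) * lg x powr (1 + s)\<close> vanishes at both ends, so its
  derivative has integral 0.\<close>

lemma lg_powr_Suc_integral:
  assumes "0 < s" "s \<le> 1"
  shows "unit_integral (\<lambda>x. lg x powr (1 + s)) = (1 + s) * unit_integral (\<lambda>x. lg x powr s)"
proof -
  let ?f = "\<lambda>x. (1 + s) * lg x powr s - lg x powr (1 + s)"
  let ?F = "\<lambda>x. (1 - x) * lg x powr (1 + s)"
  have int: "unit_integrable (\<lambda>x. lg x powr s)" "unit_integrable (\<lambda>x. lg x powr (1 + s))"
    using assms by (auto intro!: lg_powr_integrable)
  then have intf: "unit_integrable ?f" by auto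
  have e: "einterval (ereal 0) (ereal 1) = {0<..<1}" by (auto simp: einterval_def)
  have d: "(?F has_vector_derivative ?f x) (at x)" if "ereal 0 < ereal x" "ereal x < ereal 1" for x
  proof -
    have x: "0 < x" "x < 1" "0 < lg x" using that lg_pos by auto
    have "(lg has_real_derivative 1 / (1 - x)) (at x)"
      unfolding lg_def using x by (auto intro!: derivative_eq_intros simp: field_simps)
    from DERIV_fun_powr[OF this x(3), of "1 + s"]
    have "((\<lambda>x. lg x powr (1 + s)) has_real_derivative (1 + s) * lg x powr s * (1 / (1 - x))) (at x)" by simp
    moreover have "((\<lambda>x. 1 - x) has_real_derivative - 1) (at x)"
      by (auto intro!: derivative_eq_intros)
    ultimately have "(?F has_real_derivative (1 - x) * ((1 + s) * lg x powr s * (1 / (1 - x))) + (- 1) * lg x powr (1 + s)) (at x)"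
      by (rule DERIV_mult'[rotated])
    moreover have "(1 - x) * ((1 + s) * lg x powr s * (1 / (1 - x))) + (- 1) * lg x powr (1 + s) = ?f x"
      using x by simp
    ultimately have "(?F has_real_derivative ?f x) (at x)" by (simp only:)
    then show ?thesis by (simp add: has_real_derivative_iff_has_vector_derivative)
  qed
  have c: "isCont ?f x" if "ereal 0 < ereal x" "ereal x < ereal 1" for x
    using that unfolding lg_def by (auto intro!: continuous_intros)
  have l: "((?F \<circ> real_of_ereal) \<longlongrightarrow> 0) (at_right (ereal 0))" "((?F \<circ> real_of_ereal) \<longlongrightarrow> 0) (at_left (ereal 1))"
    unfolding ereal_tendsto_simps lg_def using assms by real_asymp+
  have "(LBINT x=ereal 0..ereal 1. ?f x) = 0 - 0"
    by (rule interval_integral_FTC_integrable[OF _ d c _ l]) (use intf e in auto)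
  then have "unit_integral ?f = 0" by (simp add: interval_lebesgue_integral_def e)
  then show ?thesis using int by (simp add: set_integral_diff)
qed

lemma unit_integral_nonneg:
  assumes "\<And>x. 0 < x \<Longrightarrow> x < 1 \<Longrightarrow> 0 \<le> f x"
  shows "0 \<le> unit_integral f"
  unfolding set_lebesgue_integral_def using assms
  by (intro Bochner_Integration.integral_nonneg) (auto simp: indicator_def)

text \<open>With \<open>D = 1 - (1 - x) ^ r\<close> the integrand is
  \<open>lg x powr (1 + s)\<close> times \<open>(1 / D) powr s\<close>, and the last factor is at
  most \<open>1 + s^2 / lg x\<close>. The Gamma recursion turns the result into
  \<open>(1 + s + s^2) * K\<close>, and the prefactor is compensated by
  \<open>r^2 + r + 1 \<le> (r + 1)^2\<close>.\<close>

lemma L_const_le: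
  assumes "2 \<le> t"
  shows "L_const t \<le> root (t - 1) (fact (t - 1)) / real (t - 1) * unit_integral (\<lambda>x. lg x powr (1 / real (t - 1)))"
proof -
  define r where "r = t - 1"
  define s where "s = 1 / real r"
  have r: "0 < r" "t = Suc r" using assms by (auto simp: r_def)
  have s: "0 < s" "s \<le> 1" using r by (auto simp: s_def)
  define K where "K = unit_integral (\<lambda>x. lg x powr s)"
  have e: "real t / (real t - 1) = 1 + s" using exponent_eq(1)[OF assms] by (simp add: s_def r_def)
  have ints: "unit_integrable (\<lambda>x. lg x powr s)" "unit_integrable (\<lambda>x. lg x powr (1 + s))"
    using s by (auto intro!: lg_powr_integrable)
  have K0: "0 \<le> K" unfolding K_def by (intro unit_integral_nonneg) auto
  have pw: "cfun t x powr (1 + s) * (1 - (1 - x) ^ r) \<le> lg x powr (1 + s) + s\<^sup>2 * lg x powr s"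
    if x: "0 < x" "x < 1" for x
  proof -
    define D where "D = 1 - (1 - x) ^ r"
    define L where "L = lg x"
    have L: "0 < L" using lg_pos x by (simp add: L_def)
    have D: "0 < D" using one_minus_power_bounds(1)[OF x r(1)] x by (simp add: D_def)
    have "(1 - x) ^ r = exp (- (real r * L))"
      using x by (simp add: L_def lg_def exp_of_nat_mult)
    also have "\<dots> = 1 / exp (real r * L)" by (simp add: exp_minus field_simps)
    also have "\<dots> \<le> 1 / (1 + real r * L)"
      using L r exp_ge_add_one_self[of "real r * L"] by (intro divide_left_mono) (auto intro!: mult_pos_pos add_pos_pos)
    finally have "(1 - x) ^ r \<le> 1 / (1 + real r * L)" .
    then have "real r * L / (1 + real r * L) \<le> D" 
    proof -
      have "0 < 1 + real r * L" using L by (simp add: add_pos_nonneg)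
      then have "real r * L / (1 + real r * L) = 1 - 1 / (1 + real r * L)" by (simp add: field_simps)
      then show ?thesis using \<open>(1 - x) ^ r \<le> 1 / (1 + real r * L)\<close> by (simp add: D_def)
    qed
    then have "1 / D \<le> 1 / (real r * L / (1 + real r * L))"
      using L r D by (intro divide_left_mono) (auto intro!: mult_pos_pos divide_pos_pos add_pos_pos)
    also have "\<dots> = 1 + s / L" using L r by (simp add: s_def field_simps)
    finally have "(1 / D) powr s \<le> (1 + s / L) powr s" using D s by (intro powr_mono2) auto
    also have "\<dots> \<le> 1 + s / L / real r"
      unfolding s_def using L r s by (intro powr_inverse_Bernoulli) (auto simp: s_def)
    also have "\<dots> = 1 + s\<^sup>2 / L" by (simp add: s_def power2_eq_square)
    finally have b: "(1 / D) powr s \<le> 1 + s\<^sup>2 / L" .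
    have cf: "cfun t x = L / D" by (simp add: cfun_lg r_def D_def L_def)
    have "cfun t x powr (1 + s) * D = L powr (1 + s) * (1 / D) powr s"
      using L D unfolding cf by (simp add: powr_divide powr_add)
    also have "\<dots> \<le> L powr (1 + s) * (1 + s\<^sup>2 / L)" using b by (intro mult_left_mono) auto
    also have "\<dots> = L powr (1 + s) + s\<^sup>2 * L powr s" using L by (simp add: powr_add field_simps)
    finally show ?thesis by (simp add: D_def L_def)
  qed
  have "unit_integral (\<lambda>x. cfun t x powr (1 + s) * (1 - (1 - x) ^ r))
      \<le> unit_integral (\<lambda>x. lg x powr (1 + s) + s\<^sup>2 * lg x powr s)"
    using constants_integrable(2)[OF assms] ints pw unfolding e r_def[symmetric]
    by (intro unit_integral_mono) auto
  also have "\<dots> = (1 + s) * K + s\<^sup>2 * K"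
    using ints lg_powr_Suc_integral[OF s] by (simp add: K_def)
  finally have J: "unit_integral (\<lambda>x. cfun t x powr (1 + s) * (1 - (1 - x) ^ r)) \<le> (1 + s + s\<^sup>2) * K"
    by (simp add: algebra_simps)
  have "real r / (real t)\<^sup>2 * unit_integral (\<lambda>x. cfun t x powr (1 + s) * (1 - (1 - x) ^ r))
      \<le> real r / (real t)\<^sup>2 * ((1 + s + s\<^sup>2) * K)"
    by (intro mult_left_mono J) auto
  also have "\<dots> = (real r / (real t)\<^sup>2 * (1 + s + s\<^sup>2)) * K" by simp
  also have "\<dots> \<le> (1 / real r) * K"
  proof (rule mult_right_mono[OF _ K0])
    have "real r * real r * (1 + s + s\<^sup>2) = real r * real r + real r + 1"
      using r by (simp add: s_def field_simps power2_eq_square)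
    also have "\<dots> \<le> (real t)\<^sup>2" using r by (simp add: power2_eq_square algebra_simps)
    finally have "real r * (real r * (1 + s + s\<^sup>2)) \<le> (real t)\<^sup>2" by simp
    then show "real r / (real t)\<^sup>2 * (1 + s + s\<^sup>2) \<le> 1 / real r"
      using r by (simp add: divide_le_eq le_divide_eq mult_ac)
  qed
  finally have main: "real r / (real t)\<^sup>2 * unit_integral (\<lambda>x. cfun t x powr (1 + s) * (1 - (1 - x) ^ r)) \<le> K / real r"
    by simp
  have "L_const t = root r (fact r) * (real r / (real t)\<^sup>2 * unit_integral (\<lambda>x. cfun t x powr (1 + s) * (1 - (1 - x) ^ r)))"
    using r by (simp add: L_const_def cfun_def e[symmetric] r_def[symmetric] mult_ac)
  also have "\<dots> \<le> root r (fact r) * (K / real r)"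
    by (intro mult_left_mono main real_root_ge_zero) simp
  finally show ?thesis by (simp add: K_def s_def r_def)
qed

lemma staircase_ge:
  fixes y \<delta> :: real
  assumes "0 < \<delta>" "0 \<le> y"
  shows "min y (real m * \<delta>) - \<delta> \<le> (\<Sum>i=1..m. \<delta> * of_bool (real i * \<delta> < y))"
proof -
  define g where "g i = \<delta> * of_bool (real i * \<delta> < y)" for i :: nat
  have all: "(\<Sum>i=1..k. g i) = real k * \<delta>" if "real k * \<delta> < y" for k
  proof -
    have "real i * \<delta> < y" if "i \<le> k" for i
    proof -
      have "real i * \<delta> \<le> real k * \<delta>" using that assms by (intro mult_right_mono) auto
      then show ?thesis using \<open>real k * \<delta> < y\<close> by simp
    qed
    then have "(\<Sum>i=1..k. g i) = (\<Sum>i=1..k. \<delta>)" by (intro sum.cong) (auto simp: g_def)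
    then show ?thesis by simp
  qed
  have "min y (real m * \<delta>) - \<delta> \<le> (\<Sum>i=1..m. g i)"
  proof (induction m)
    case (Suc m)
    have S: "real (Suc m) * \<delta> = real m * \<delta> + \<delta>" by (simp add: algebra_simps)
    consider "real (Suc m) * \<delta> < y" | "real m * \<delta> < y" "\<not> real (Suc m) * \<delta> < y" | "\<not> real m * \<delta> < y" by blast
    then show ?case
    proof cases
      case 1
      then show ?thesis using all[OF 1] assms by linarith
    next
      case 2
      then have "g (Suc m) = 0" by (simp add: g_def)
      then show ?thesis using all[OF 2(1)] 2 S by simp
    next
      case 3
      then have "g (Suc m) = 0" using assms(1) S by (simp add: g_def)
      then show ?thesis using Suc 3 assms(1) S by simp
    qed
  qed (use assms in simp)
  then show ?thesis by (simp add: g_def)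
qed

lemma unit_interval_cdf:
  assumes "0 \<le> a"
  shows "unit_integral (\<lambda>x. of_bool (a < lg x)) = exp (- a)"
    "unit_integrable (\<lambda>x. of_bool (a < lg x))"
proof -
  have "of_bool (a < lg x) * indicator {0<..<1} x = (indicator {1 - exp (- a)<..<1} x :: real)" for x
  proof (cases "0 < x \<and> x < 1")
    case True
    have "a < lg x \<longleftrightarrow> 1 - x < exp (- a)"
      using True by (simp add: lg_def ln_less_cancel_iff[of "1 - x" "exp (- a)", simplified, symmetric])
        linarith
    then show ?thesis using True by (auto simp: indicator_def)
  next
    case False
    have "exp (- a) \<le> 1" using assms by simp
    then have "\<not> (1 - exp (- a) < x \<and> x < 1)" using False by linarith
    then have "x \<notin> {1 - exp (- a)<..<1}" by simp
    moreover have "x \<notin> {0<..<1}" using False by simp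
    ultimately show ?thesis by (simp del: greaterThanLessThan_iff)
  qed
  then have e: "indicator {0<..<1} x *\<^sub>R of_bool (a < lg x) = (indicator {1 - exp (- a)<..<1} x :: real)" for x
    by (simp add: mult.commute)
  show "unit_integral (\<lambda>x. of_bool (a < lg x)) = exp (- a)"
    unfolding set_lebesgue_integral_def e by simp
  show "unit_integrable (\<lambda>x. of_bool (a < lg x))"
    unfolding set_integrable_def e by simp
qed

text \<open>A layer-cake lower sum for \<open>lg x powr s\<close> with step \<open>\<delta>\<close>,
  integrated term by term: each threshold event has measure
  \<open>exp (- ((i * \<delta>) ^ r))\<close>. Rounding loses \<open>\<delta>\<close>; cutting off
  at \<open>q = m * \<delta>\<close> loses at most \<open>K2 / q\<close>, by
  \<open>y - y^2 / q \<le> min y q\<close>. Both losses are at most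
  \<open>\<epsilon> / 2\<close>.\<close>

lemma exp_sum_lower:
  assumes "0 < r" "0 < \<epsilon>"
  shows "\<exists>\<delta> m. 0 < \<delta> \<and>
    unit_integral (\<lambda>x. lg x powr (1 / real r)) - \<epsilon> \<le> (\<Sum>i=1..m. \<delta> * exp (- ((real i * \<delta>) ^ r)))"
proof -
  define s where "s = 1 / real r"
  have s: "0 < s" "s \<le> 1" using assms by (auto simp: s_def)
  define K where "K = unit_integral (\<lambda>x. lg x powr s)"
  define K2 where "K2 = unit_integral (\<lambda>x. lg x powr (2 * s))"
  have ints: "unit_integrable (\<lambda>x. lg x powr s)" "unit_integrable (\<lambda>x. lg x powr (2 * s))"
    using s by (auto intro!: lg_powr_integrable)
  have K2: "0 \<le> K2" unfolding K2_def by (intro unit_integral_nonneg) auto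
  define \<delta> where "\<delta> = \<epsilon> / 2"
  have \<delta>: "0 < \<delta>" using assms by (simp add: \<delta>_def)
  obtain m :: nat where m: "K2 / (\<delta> * \<delta>) + 1 < real m" using reals_Archimedean2 by blast
  then have mpos: "0 < real m" using K2 \<delta> by (smt (verit) divide_nonneg_pos mult_pos_pos)
  have "K2 / (\<delta> * \<delta>) < real m" using m by simp
  then have "K2 < real m * (\<delta> * \<delta>)" using \<delta> by (simp add: pos_divide_less_eq)
  then have K2m: "K2 / (real m * \<delta>) \<le> \<delta>" using \<delta> mpos by (simp add: divide_le_eq mult_ac)
  have pw: "lg x powr s - 1 / (real m * \<delta>) * lg x powr (2 * s) - \<delta>
      \<le> (\<Sum>i=1..m. \<delta> * of_bool ((real i * \<delta>) ^ r < lg x))" if x: "0 < x" "x < 1" for x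
  proof -
    define y where "y = lg x powr s"
    define q where "q = real m * \<delta>"
    have q: "0 < q" using mpos \<delta> by (simp add: q_def)
    have L: "0 < lg x" using lg_pos x by simp
    have y: "0 \<le> y" by (simp add: y_def)
    have yr: "y ^ r = lg x" using L assms(1) by (simp add: y_def s_def powr_powr powr_realpow[symmetric])
    have y2: "lg x powr (2 * s) = y\<^sup>2" by (simp add: y_def power2_eq_square powr_add[symmetric])
    have "y - 1 / q * y\<^sup>2 \<le> min y q"
    proof (cases "y \<le> q")
      case False
      then have "q * y \<le> y * y" using q by (intro mult_right_mono) auto
      then have "y \<le> y\<^sup>2 / q" using q by (simp add: power2_eq_square le_divide_eq mult.commute)
      then show ?thesis using False q by simp
    qed (use q in auto)
    then have "y - 1 / q * y\<^sup>2 - \<delta> \<le> (\<Sum>i=1..m. \<delta> * of_bool (real i * \<delta> < y))"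
      using staircase_ge[OF \<delta> y, of m] unfolding q_def by linarith
    also have "\<dots> = (\<Sum>i=1..m. \<delta> * of_bool ((real i * \<delta>) ^ r < lg x))"
    proof (intro sum.cong refl arg_cong2[where f = "(*)"] arg_cong[where f = of_bool])
      fix i :: nat
      have "0 \<le> real i * \<delta>" using \<delta> by simp
      then show "(real i * \<delta> < y) = ((real i * \<delta>) ^ r < lg x)"
        using power_mono_iff[OF y, of "real i * \<delta>" r] assms(1) unfolding yr by linarith
    qed
    finally show ?thesis using y2 by (simp add: y_def q_def)
  qed
  have i1: "unit_integrable (\<lambda>x. \<delta> * of_bool ((real i * \<delta>) ^ r < lg x))" for i :: nat
    using unit_interval_cdf(2)[of "(real i * \<delta>) ^ r"] \<delta> by auto
  have c: "unit_integrable (\<lambda>x. \<delta>)" by (simp add: set_integrable_def)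
  have "unit_integral (\<lambda>x. lg x powr s - 1 / (real m * \<delta>) * lg x powr (2 * s) - \<delta>)
      \<le> unit_integral (\<lambda>x. \<Sum>i=1..m. \<delta> * of_bool ((real i * \<delta>) ^ r < lg x))"
  proof (rule unit_integral_mono)
    show "unit_integrable (\<lambda>x. lg x powr s - 1 / (real m * \<delta>) * lg x powr (2 * s) - \<delta>)"
      using ints c by (intro set_integral_diff set_integrable_mult_right) auto
    show "unit_integrable (\<lambda>x. \<Sum>i=1..m. \<delta> * of_bool ((real i * \<delta>) ^ r < lg x))"
      using i1 unfolding set_integrable_def scaleR_sum_right by (intro Bochner_Integration.integrable_sum) auto
  qed (rule pw)
  also have "\<dots> = (\<Sum>i=1..m. unit_integral (\<lambda>x. \<delta> * of_bool ((real i * \<delta>) ^ r < lg x)))"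
    using i1 unfolding set_integrable_def set_lebesgue_integral_def scaleR_sum_right
    by (intro Bochner_Integration.integral_sum) auto
  also have "\<dots> = (\<Sum>i=1..m. \<delta> * exp (- ((real i * \<delta>) ^ r)))"
    using unit_interval_cdf(1) \<delta> by (intro sum.cong refl) simp
  also have "unit_integral (\<lambda>x. lg x powr s - 1 / (real m * \<delta>) * lg x powr (2 * s) - \<delta>)
      = K - 1 / (real m * \<delta>) * K2 - \<delta>"
  proof -
    have a: "unit_integrable (\<lambda>x. 1 / (real m * \<delta>) * lg x powr (2 * s))"
      using ints(2) by (intro set_integrable_mult_right) auto
    have "unit_integral (\<lambda>x. \<delta>) = \<delta>" by (simp add: set_lebesgue_integral_def)
    then show ?thesis
      using set_integral_diff(2)[OF set_integral_diff(1)[OF ints(1) a] c] set_integral_diff(2)[OF ints(1) a]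
      by (simp add: K_def K2_def)
  qed
  finally show ?thesis using \<delta> K2m unfolding K_def s_def
    by (intro exI[of _ \<delta>] exI[of _ m]) (simp add: \<delta>_def)
qed

section \<open>The size of the giant component and the Riemann sum for
  \<open>U_const\<close>\<close>

text \<open>A generalised inverse of \<open>cfun t\<close>. The inserted 0 is its value when no
  \<open>x\<close> qualifies, as for \<open>c\<close> at most the critical mean degree, and also for
  the negative argument that the mesh produces at index 0.\<close>

definition giant_frac :: "nat \<Rightarrow> real \<Rightarrow> real" where
  "giant_frac t c = Sup (insert 0 {x. 0 < x \<and> x < 1 \<and> cfun t x < c})"

lemma giant_frac_bdd: "bdd_above (insert 0 {x. 0 < x \<and> x < 1 \<and> cfun t x < c})"
  by (rule bdd_aboveI[of _ 1]) auto

lemma giant_frac_bounds: "0 \<le> giant_frac t c" "giant_frac t c \<le> 1"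
proof -
  show "0 \<le> giant_frac t c" unfolding giant_frac_def by (rule cSup_upper[OF _ giant_frac_bdd]) simp
  show "giant_frac t c \<le> 1" unfolding giant_frac_def by (rule cSup_least) auto
qed

lemma giant_frac_upper: "0 < x \<Longrightarrow> x < 1 \<Longrightarrow> cfun t x < c \<Longrightarrow> x \<le> giant_frac t c"
  unfolding giant_frac_def by (intro cSup_upper giant_frac_bdd) auto

lemma giant_frac_approx:
  assumes "0 < \<delta>" "\<delta> < giant_frac t c"
  obtains x where "0 < x" "x < 1" "cfun t x < c" "giant_frac t c - \<delta> < x"
proof -
  have "giant_frac t c - \<delta> < Sup (insert 0 {x. 0 < x \<and> x < 1 \<and> cfun t x < c})"
    using assms by (simp add: giant_frac_def)
  then obtain x where "x \<in> insert 0 {x. 0 < x \<and> x < 1 \<and> cfun t x < c}" "giant_frac t c - \<delta> < x"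
    using less_cSupD[OF insert_not_empty] by blast
  then show thesis using assms that[of x] by auto
qed

text \<open>At \<open>x = 1 - exp (- c / 2)\<close> the denominator of \<open>cfun\<close> exceeds
  \<open>1/2\<close>, so \<open>cfun\<close> is below \<open>c\<close>. The exponential decay of the
  remainder makes the tail beyond a large level cheap.\<close>

lemma giant_frac_lower:
  assumes "2 \<le> t" "2 \<le> c"
  shows "1 - exp (- c / 2) \<le> giant_frac t c"
proof (rule giant_frac_upper)
  show "0 < 1 - exp (- c / 2)" "1 - exp (- c / 2) < 1" using assms by auto
  have "exp (- c / 2) ^ (t - 1) \<le> exp (- c / 2) ^ 1" using assms by (intro power_decreasing) auto
  also have "\<dots> \<le> exp (- 1)" using assms by simp
  also have "\<dots> < 1 / 2"
  proof -
    have "2 < exp (1::real)" using exp_ge_one_plus_x_over_n_power_n[of 2 1] by (simp add: power2_eq_square)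
    then show ?thesis by (simp add: exp_minus field_simps)
  qed
  finally have "1 / 2 < 1 - exp (- c / 2) ^ (t - 1)" by simp
  then have "c * (1 / 2) < c * (1 - exp (- c / 2) ^ (t - 1))"
    using assms by (intro mult_strict_left_mono) auto
  then have "c / 2 < c * (1 - exp (- c / 2) ^ (t - 1))" by simp
  then have "c / 2 / (1 - exp (- c / 2) ^ (t - 1)) < c"
    using \<open>1 / 2 < 1 - exp (- c / 2) ^ (t - 1)\<close> by (subst pos_divide_less_eq) auto
  moreover have lg: "lg (1 - exp (- c / 2)) = c / 2" by (simp add: lg_def)
  have "cfun t (1 - exp (- c / 2)) = c / 2 / (1 - exp (- c / 2) ^ (t - 1))"
    unfolding cfun_lg lg by simp
  ultimately show "cfun t (1 - exp (- c / 2)) < c" by (simp only:)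
qed

lemma powr_increment:
  assumes "0 \<le> y" "0 < \<Delta>" "0 < (s::real)"
  shows "y powr s * \<Delta> \<le> (y + \<Delta>) powr (1 + s) / (1 + s) - y powr (1 + s) / (1 + s)"
proof -
  let ?f = "\<lambda>z. z powr (1 + s) / (1 + s)"
  have d: "(?f has_real_derivative z powr s) (at z)" if "y < z" for z
    using that assms by (auto intro!: derivative_eq_intros)
  have "continuous_on {y..y + \<Delta>} ?f"
    using assms by (intro continuous_intros continuous_on_powr') auto
  moreover have "?f differentiable (at z)" if "y < z" "z < y + \<Delta>" for z
    using d[OF that(1)] by (auto simp: real_differentiable_def)
  ultimately obtain l z where z0: "y < z" "z < y + \<Delta>" "(?f has_real_derivative l) (at z)"
    "?f (y + \<Delta>) - ?f y = (y + \<Delta> - y) * l"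
    using MVT[of y "y + \<Delta>" ?f] assms by auto
  moreover have "l = z powr s" using DERIV_unique[OF z0(3) d[OF z0(1)]] .
  ultimately have z: "y < z" "?f (y + \<Delta>) - ?f y = \<Delta> * z powr s" by auto
  have "y powr s \<le> z powr s" using z assms by (intro powr_mono2) auto
  then show ?thesis using z assms by (simp add: mult.commute mult_left_mono)
qed

text \<open>Comparison of a right-endpoint sum for \<open>z powr s\<close> with its primitive. If
  \<open>m\<close> is the last index satisfying \<open>Q\<close>, the primitive is evaluated at
  \<open>(m + 2) * \<Delta>\<close>, and \<open>(m - 1) * \<Delta> \<le> c\<close> turns this into
  \<open>c + 3 * \<Delta>\<close>.\<close>

lemma staircase_powr:
  assumes "0 < \<Delta>" "0 < s" "0 \<le> c" "\<And>i. Q i \<Longrightarrow> (real i - 1) * \<Delta> \<le> c"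
  shows "(\<Sum>i<m. (real (Suc i) * \<Delta>) powr s * \<Delta> * of_bool (Q i)) \<le> (c + 3 * \<Delta>) powr (1 + s) / (1 + s)"
proof (induction m)
  case (Suc m)
  show ?case
  proof (cases "Q m")
    case True
    have "(\<Sum>i<k. (real (Suc i) * \<Delta>) powr s * \<Delta>) \<le> (real (Suc k) * \<Delta>) powr (1 + s) / (1 + s)" for k
    proof (induction k)
      case (Suc k)
      have "(real (Suc k) * \<Delta>) powr s * \<Delta> \<le> (real (Suc k) * \<Delta> + \<Delta>) powr (1 + s) / (1 + s) - (real (Suc k) * \<Delta>) powr (1 + s) / (1 + s)"
        using assms by (intro powr_increment) auto
      moreover have "real (Suc k) * \<Delta> + \<Delta> = real (Suc (Suc k)) * \<Delta>" by (simp add: algebra_simps)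
      ultimately show ?case using Suc by simp
    qed (use assms in simp)
    from this[of "Suc m"] have "(\<Sum>i<Suc m. (real (Suc i) * \<Delta>) powr s * \<Delta>) \<le> (real (Suc (Suc m)) * \<Delta>) powr (1 + s) / (1 + s)" .
    moreover have "(\<Sum>i<Suc m. (real (Suc i) * \<Delta>) powr s * \<Delta> * of_bool (Q i)) \<le> (\<Sum>i<Suc m. (real (Suc i) * \<Delta>) powr s * \<Delta>)"
      using assms by (intro sum_mono) auto
    moreover have "(real (Suc (Suc m)) * \<Delta>) powr (1 + s) / (1 + s) \<le> (c + 3 * \<Delta>) powr (1 + s) / (1 + s)"
    proof -
      have "real (Suc (Suc m)) * \<Delta> \<le> c + 3 * \<Delta>" using assms(4)[OF True] by (simp add: algebra_simps)
      then show ?thesis using assms by (intro divide_right_mono powr_mono2) auto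
    qed
    ultimately show ?thesis by linarith
  next
    case False
    then show ?thesis using Suc by simp
  qed
qed (use assms in simp)

text \<open>Writes the cost factor \<open>(1 - X ^ t) / t\<close> as an integral over the unit
  interval, so that the sum over levels can be moved inside.\<close>

lemma power_tail_integral:
  assumes "0 \<le> X" "X \<le> 1"
  shows "unit_integrable (\<lambda>x. x ^ r * of_bool (X < x))"
    "unit_integral (\<lambda>x. x ^ r * of_bool (X < x)) = (1 - X ^ Suc r) / real (Suc r)"
proof -
  have e: "indicator {0<..<1} x *\<^sub>R (x ^ r * of_bool (X < x)) = indicator {X<..<1} x *\<^sub>R (x ^ r)" for x :: real
    using assms by (auto simp: indicator_def)
  have "set_integrable lborel {X<..<1} (\<lambda>x. x ^ r) \<and> (LBINT x:{X<..<1}. x ^ r) = (1 - X ^ Suc r) / real (Suc r)"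
  proof (cases "X = 1")
    case True
    then show ?thesis by (simp add: set_integrable_def set_lebesgue_integral_def)
  next
    case False
    then have X: "X < 1" using assms by simp
    let ?F = "\<lambda>x::real. x ^ Suc r / real (Suc r)"
    have d: "(?F has_real_derivative x ^ r) (at x)" for x
      by (auto intro!: derivative_eq_intros simp del: power_Suc)
    have l: "(?F \<longlongrightarrow> X ^ Suc r / real (Suc r)) (at_right X)" "(?F \<longlongrightarrow> 1 ^ Suc r / real (Suc r)) (at_left 1)"
      by (intro tendsto_intros; simp)+
    have c: "isCont (\<lambda>x::real. x ^ r) x" for x by (intro continuous_intros)
    have nn: "0 \<le> x ^ r" if "X < x" for x using that assms by simp
    show ?thesis using FTC_open_interval[OF X d c nn l] by (simp add: diff_divide_distrib)
  qed
  then show "unit_integrable (\<lambda>x. x ^ r * of_bool (X < x))"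
    "unit_integral (\<lambda>x. x ^ r * of_bool (X < x)) = (1 - X ^ Suc r) / real (Suc r)"
    unfolding set_integrable_def set_lebesgue_integral_def e by auto
qed

text \<open>Discrete integration by parts. After the sum has been moved inside the integral, the
  levels contributing at \<open>x\<close> are those with giant fraction below \<open>x\<close>,
  hence with \<open>(i - 1) * \<Delta> \<le> cfun t x\<close>; \<open>staircase_powr\<close> sums
  them. The index \<open>i - 1\<close> appears because one mesh width of mean degree is spent on
  sprinkling.\<close>

lemma U_const_sum:
  assumes "2 \<le> t" "0 < \<Delta>"
  defines "s \<equiv> 1 / real (t - 1)"
  shows "root (t - 1) (fact (t - 1)) *
      (\<Sum>i<m. (real (Suc i) * \<Delta>) powr s * \<Delta> * ((1 - giant_frac t ((real i - 1) * \<Delta>) ^ t) / real t))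
    \<le> (1 + 3 * \<Delta> * real (t - 1)) powr (1 + s) * U_const t"
proof -
  define r where "r = t - 1"
  have r: "0 < r" "t = Suc r" using assms by (auto simp: r_def)
  have s: "0 < s" "s \<le> 1" using r by (auto simp: s_def)
  have e: "real t / (real t - 1) = 1 + s" using exponent_eq(1)[OF assms(1)] by (simp add: s_def r_def)
  define X where "X i = giant_frac t ((real i - 1) * \<Delta>)" for i :: nat
  define w where "w i = (real (Suc i) * \<Delta>) powr s * \<Delta>" for i :: nat
  define \<kappa> where "\<kappa> = (1 + 3 * \<Delta> * real r) powr (1 + s)"
  have X: "0 \<le> X i" "X i \<le> 1" for i using giant_frac_bounds by (auto simp: X_def)
  have ints: "unit_integrable (\<lambda>x. w i * (x ^ r * of_bool (X i < x)))" for i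
    using power_tail_integral(1)[OF X] by (intro set_integrable_mult_right) auto
  have intU: "unit_integrable (\<lambda>x. cfun t x powr (1 + s) * x ^ r)"
    using constants_integrable(1)[OF assms(1)] unfolding e r_def .
  have pw: "(\<Sum>i<m. w i * (x ^ r * of_bool (X i < x))) \<le> \<kappa> / (1 + s) * (cfun t x powr (1 + s) * x ^ r)"
    if x: "0 < x" "x < 1" for x
  proof -
    have cp: "0 < cfun t x" using cfun_pos[OF assms(1) x] .
    have Q: "(real i - 1) * \<Delta> \<le> cfun t x" if "X i < x" for i
      using giant_frac_upper[OF x, of t "(real i - 1) * \<Delta>"] that by (force simp: X_def)
    have "(\<Sum>i<m. w i * (x ^ r * of_bool (X i < x))) = x ^ r * (\<Sum>i<m. w i * of_bool (X i < x))"
      unfolding sum_distrib_left by (intro sum.cong refl) (simp only: mult_ac)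
    also have "\<dots> \<le> x ^ r * ((cfun t x + 3 * \<Delta>) powr (1 + s) / (1 + s))"
      unfolding w_def using x assms s cp Q by (intro mult_left_mono staircase_powr) auto
    also have "\<dots> \<le> x ^ r * (((1 + 3 * \<Delta> * real r) * cfun t x) powr (1 + s) / (1 + s))"
    proof -
      \<comment> \<open>\<open>cfun_lower\<close> turns the additive mesh error into a factor that
        is the same for all \<open>x\<close>.\<close>
      have "3 * \<Delta> * 1 \<le> 3 * \<Delta> * (real r * cfun t x)"
        using cfun_lower[OF assms(1) x] assms r by (intro mult_left_mono) auto
      then have "cfun t x + 3 * \<Delta> \<le> (1 + 3 * \<Delta> * real r) * cfun t x" by (simp add: algebra_simps)
      then show ?thesis using x s cp assms
        by (intro mult_left_mono divide_right_mono powr_mono2) auto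
    qed
    also have "\<dots> = \<kappa> / (1 + s) * (cfun t x powr (1 + s) * x ^ r)"
      using cp assms by (simp add: \<kappa>_def powr_mult)
    finally show ?thesis .
  qed
  have "(\<Sum>i<m. w i * ((1 - X i ^ t) / real t)) = (\<Sum>i<m. unit_integral (\<lambda>x. w i * (x ^ r * of_bool (X i < x))))"
    using power_tail_integral(2)[OF X] r(2) by (intro sum.cong refl) simp
  also have "\<dots> = unit_integral (\<lambda>x. \<Sum>i<m. w i * (x ^ r * of_bool (X i < x)))"
    using ints unfolding set_integrable_def set_lebesgue_integral_def scaleR_sum_right
    by (intro Bochner_Integration.integral_sum[symmetric]) auto
  also have "\<dots> \<le> unit_integral (\<lambda>x. \<kappa> / (1 + s) * (cfun t x powr (1 + s) * x ^ r))"
  proof (rule unit_integral_mono)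
    show "unit_integrable (\<lambda>x. \<Sum>i<m. w i * (x ^ r * of_bool (X i < x)))"
      using ints unfolding set_integrable_def scaleR_sum_right by (intro Bochner_Integration.integrable_sum) auto
    show "unit_integrable (\<lambda>x. \<kappa> / (1 + s) * (cfun t x powr (1 + s) * x ^ r))"
      using intU by (intro set_integrable_mult_right) auto
  qed (rule pw)
  also have "\<dots> = \<kappa> / (1 + s) * unit_integral (\<lambda>x. cfun t x powr (1 + s) * x ^ r)" by simp
  also have "\<kappa> / (1 + s) = \<kappa> * ((real t - 1) / real t)"
    using r by (simp add: s_def field_simps)
  finally have "root r (fact r) * (\<Sum>i<m. w i * ((1 - X i ^ t) / real t))
      \<le> root r (fact r) * (\<kappa> * ((real t - 1) / real t) * unit_integral (\<lambda>x. cfun t x powr (1 + s) * x ^ r))"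
    by (intro mult_left_mono real_root_ge_zero) auto
  also have "\<dots> = \<kappa> * (root r (fact r) * ((real t - 1) / real t) * unit_integral (\<lambda>x. cfun t x powr (1 + s) * x ^ r))"
    by (simp only: mult_ac)
  also have "root r (fact r) * ((real t - 1) / real t) * unit_integral (\<lambda>x. cfun t x powr (1 + s) * x ^ r) = U_const t"
    unfolding U_const_def cfun_def e[symmetric] r_def ..
  finally show ?thesis by (simp add: w_def X_def \<kappa>_def r_def)
qed

section \<open>Growth of the ratio of the two constants\<close>

text \<open>The factor \<open>x ^ (t - 1)\<close> concentrates the mass where \<open>1 - x\<close>
  is of order \<open>1 / t\<close>; there \<open>cfun\<close> is of order \<open>ln t\<close>, so
  the integral is of order \<open>ln t / t\<close>.\<close>

lemma U_integral_upper:
  assumes "4 \<le> t"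
  shows "unit_integral (\<lambda>x. cfun t x powr (real t / (real t - 1)) * x ^ (t - 1))
    \<le> (3 * ln (real (t - 3)) + 112) / real (t - 3)"
proof -
  \<comment> \<open>Two powers of \<open>x\<close> are set aside to cancel the denominator in
    \<open>cfun t x \<le> lg x / x\<close>, which is raised to the power
    \<open>1 + s \<le> 2\<close>.\<close>
  define m where "m = t - 3"
  define r where "r = t - 1"
  define s where "s = 1 / real r"
  have m: "1 \<le> m" "r = m + 2" using assms by (auto simp: m_def r_def)
  have s: "0 < s" "s \<le> 1" using m by (auto simp: s_def)
  have e: "real t / (real t - 1) = 1 + s" using exponent_eq(1)[of t] assms by (simp add: s_def r_def)
  define A where "A = 3 * ln (real m) + 4"
  have lm: "0 \<le> ln (real m)" "s * ln (real m) \<le> 1"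
  proof -
    show "0 \<le> ln (real m)" using m by simp
    have "ln (real m) \<le> real r" using ln_le_minus_one[of "real m"] m by simp
    then show "s * ln (real m) \<le> 1" using m by (simp add: s_def divide_le_eq)
  qed
  have pw: "cfun t x powr (1 + s) * x ^ r \<le> (A + 36) * x ^ m
      + 36 / sqrt (real m) * ((1 - x) powr (-1/2) * of_bool (1 - 1 / real m < x))"
    if x: "0 < x" "x < 1" for x
  proof -
    define L where "L = lg x"
    define Q where "Q = (real m * (1 - x)) powr (-1/2)"
    define q where "q = (real m * (1 - x)) powr (-1/4)"
    have L: "0 < L" using lg_pos x by (simp add: L_def)
    have mx: "0 < real m * (1 - x)" using m x by simp
    have q: "0 < q" "q\<^sup>2 = Q" using mx m powr_quarter[OF mx] by (auto simp: q_def Q_def)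
    have D: "x \<le> 1 - (1 - x) ^ r" by (rule one_minus_power_bounds(1)[OF x]) (simp add: m)
    have "cfun t x \<le> L / x"
      unfolding cfun_lg r_def[symmetric] L_def[symmetric] using L D x by (intro divide_left_mono) auto
    then have "cfun t x powr (1 + s) \<le> (L / x) powr (1 + s)"
      using cfun_pos[of t x] x assms s by (intro powr_mono2) auto
    also have "\<dots> = L powr (1 + s) / x powr (1 + s)" using L x by (simp add: powr_divide)
    also have "\<dots> \<le> L powr (1 + s) / x powr 2"
      using x s L by (intro divide_left_mono powr_mono') auto
    also have "x powr 2 = x\<^sup>2" using x by (simp add: powr_numeral)
    finally have "cfun t x powr (1 + s) * x ^ r \<le> L powr (1 + s) / x\<^sup>2 * x ^ r"
      using x by (intro mult_right_mono) auto
    also have "\<dots> = L powr (1 + s) * x ^ m" using x m by (simp add: power_add power2_eq_square)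
    also have "\<dots> \<le> (A + 36 * Q) * x ^ m"
    proof (rule mult_right_mono)
      have "L powr s \<le> (1 + L) powr s" using L s by (intro powr_mono2) auto
      also have "\<dots> \<le> 1 + L / real r" unfolding s_def using L m by (intro powr_inverse_Bernoulli) auto
      finally have "L powr s \<le> 1 + s * L" by (simp add: s_def)
      then have "L * L powr s \<le> L * (1 + s * L)" using L by (intro mult_left_mono) auto
      then have 1: "L powr (1 + s) \<le> L + s * L\<^sup>2" using L by (simp add: powr_add power2_eq_square algebra_simps)
      have Lq: "L \<le> ln (real m) + 4 * q"
        using lg_bound[of "1 - x" "real m"] x m by (simp add: L_def lg_def q_def)
      then have "L\<^sup>2 \<le> (ln (real m) + 4 * q)\<^sup>2" using L by (intro power_mono) auto
      also have "\<dots> \<le> 2 * (ln (real m))\<^sup>2 + 32 * q\<^sup>2"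
        using sum_squares_ge_zero[of "ln (real m) - 4 * q" 0] by (simp add: power2_eq_square algebra_simps)
      finally have "s * L\<^sup>2 \<le> s * (2 * (ln (real m))\<^sup>2 + 32 * Q)" using s q by (intro mult_left_mono) auto
      also have "\<dots> = 2 * ((s * ln (real m)) * ln (real m)) + s * (32 * Q)" by (simp add: power2_eq_square algebra_simps)
      also have "\<dots> \<le> 2 * (1 * ln (real m)) + 1 * (32 * Q)"
        using lm s q by (intro add_mono mult_left_mono mult_right_mono) (auto simp: Q_def)
      finally have 2: "s * L\<^sup>2 \<le> 2 * ln (real m) + 32 * Q" by simp
      have "q \<le> 1 + Q" using sum_squares_ge_zero[of "q - 1 / 2" 0] q by (simp add: power2_eq_square algebra_simps)
      then show "L powr (1 + s) \<le> A + 36 * Q" using 1 2 Lq by (simp add: A_def)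
    qed (use x in simp)
    also have "\<dots> = A * x ^ m + 36 * (Q * x ^ m)" by (simp add: algebra_simps)
    also have "Q = (1 - x) powr (-1/2) / sqrt (real m)"
      unfolding Q_def using m x by (simp add: powr_mult powr_minus_divide powr_half_sqrt)
    \<comment> \<open>Up to \<open>1 - 1 / m\<close> the factor is at most 1 and
      \<open>x ^ m\<close> remains; beyond, \<open>x ^ m\<close> is dropped and the singularity is
      integrated over an interval of length \<open>1 / m\<close>.\<close>
    also have "(1 - x) powr (-1/2) / sqrt (real m) * x ^ m
        \<le> x ^ m + (1 - x) powr (-1/2) * of_bool (1 - 1 / real m < x) / sqrt (real m)"
    proof (cases "1 - 1 / real m < x")
      case True
      have "(1 - x) powr (-1/2) / sqrt (real m) * x ^ m \<le> (1 - x) powr (-1/2) / sqrt (real m) * 1"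
        using x by (intro mult_left_mono power_le_one) auto
      then show ?thesis using True x by (simp add: add_increasing)
    next
      case False
      then have "1 / real m \<le> 1 - x" by simp
      then have "(1 - x) powr (-1/2) \<le> (1 / real m) powr (-1/2)"
        using m by (intro powr_mono2') auto
      also have "\<dots> = sqrt (real m)" using m by (simp add: powr_minus_divide powr_divide powr_half_sqrt)
      finally have "(1 - x) powr (-1/2) / sqrt (real m) \<le> 1" using m by (simp add: divide_le_eq)
      then have "(1 - x) powr (-1/2) / sqrt (real m) * x ^ m \<le> 1 * x ^ m"
        using x by (intro mult_right_mono) auto
      then show ?thesis using False by simp
    qed
    finally show ?thesis by (simp add: algebra_simps)
  qed
  have i1: "unit_integrable (\<lambda>x. x ^ m)" "unit_integral (\<lambda>x. x ^ m) = 1 / real (Suc m)"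
  proof -
    have e0: "indicator {0<..<1} x *\<^sub>R (x ^ m * of_bool (0 < x)) = indicator {0<..<1} x *\<^sub>R (x ^ m)" for x :: real
      by (auto simp: indicator_def)
    show "unit_integrable (\<lambda>x. x ^ m)" "unit_integral (\<lambda>x. x ^ m) = 1 / real (Suc m)"
      using power_tail_integral[of 0 m] unfolding set_integrable_def set_lebesgue_integral_def e0 by auto
  qed
  have b: "0 \<le> 1 - 1 / real m" "1 - 1 / real m < 1" using m by (auto simp: field_simps)
  have e2: "indicator {0<..<1} x *\<^sub>R ((1 - x) powr (-1/2) * of_bool (1 - 1 / real m < x))
      = indicator {1 - 1 / real m<..<1} x *\<^sub>R ((1 - x) powr (-1/2))" for x :: real
  proof (cases "1 - 1 / real m < x")
    case True
    then have "0 < x" using b by linarith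
    then show ?thesis using True by (simp add: indicator_def)
  qed simp
  have i2: "unit_integrable (\<lambda>x. (1 - x) powr (-1/2) * of_bool (1 - 1 / real m < x))"
    "unit_integral (\<lambda>x. (1 - x) powr (-1/2) * of_bool (1 - 1 / real m < x)) = 2 * sqrt (1 - (1 - 1 / real m))"
    using inverse_sqrt_tail[OF b] unfolding set_integrable_def set_lebesgue_integral_def e2 by auto
  have i3: "unit_integrable (\<lambda>x. (A + 36) * x ^ m)" using i1 by (intro set_integrable_mult_right) auto
  have i4: "unit_integrable (\<lambda>x. 36 / sqrt (real m) * ((1 - x) powr (-1/2) * of_bool (1 - 1 / real m < x)))"
    using i2(1) by (intro set_integrable_mult_right) auto
  have "unit_integral (\<lambda>x. cfun t x powr (1 + s) * x ^ r) \<le> unit_integral (\<lambda>x. (A + 36) * x ^ m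
      + 36 / sqrt (real m) * ((1 - x) powr (-1/2) * of_bool (1 - 1 / real m < x)))"
    using constants_integrable(1)[of t] assms set_integral_add(1)[OF i3 i4] pw unfolding e r_def
    by (intro unit_integral_mono) auto
  also have "\<dots> = (A + 36) * (1 / real (Suc m)) + 36 / sqrt (real m) * (2 * sqrt (1 - (1 - 1 / real m)))"
    using set_integral_add(2)[OF i3 i4] i1(2) i2(2) by simp
  also have "\<dots> \<le> (A + 36) * (1 / real m) + 72 * (1 / real m)"
  proof -
    have "36 / sqrt (real m) * (2 * sqrt (1 - (1 - 1 / real m))) = 72 * (1 / real m)"
      using m by (simp add: real_sqrt_divide)
    moreover have "(A + 36) * (1 / real (Suc m)) \<le> (A + 36) * (1 / real m)"
      using lm m by (intro mult_left_mono divide_left_mono) (auto simp: A_def)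
    ultimately show ?thesis by simp
  qed
  also have "\<dots> = (3 * ln (real m) + 112) / real m" by (simp add: A_def add_divide_distrib)
  finally show ?thesis unfolding e by (simp add: m_def r_def)
qed

text \<open>The integrand equals \<open>cfun t x powr s * lg x\<close> and
  \<open>lg x \<le> cfun t x\<close>, so it is at least 1 on \<open>lg x > 1\<close>, a set of
  measure \<open>exp (- 1)\<close>.\<close>

lemma L_integral_lower:
  assumes "2 \<le> t"
  shows "exp (- 1) \<le> unit_integral (\<lambda>x. cfun t x powr (real t / (real t - 1)) * (1 - (1 - x) ^ (t - 1)))"
proof -
  define r where "r = t - 1"
  define s where "s = 1 / real r"
  have r: "0 < r" using assms by (simp add: r_def)
  have s: "0 < s" using r by (simp add: s_def)
  have e: "real t / (real t - 1) = 1 + s" using exponent_eq(1)[OF assms] by (simp add: s_def r_def)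
  have pw: "of_bool (1 < lg x) \<le> cfun t x powr (1 + s) * (1 - (1 - x) ^ r)" if x: "0 < x" "x < 1" for x
  proof (cases "1 < lg x")
    case True
    have D: "0 < 1 - (1 - x) ^ r" "1 - (1 - x) ^ r \<le> 1"
      using one_minus_power_bounds(1,3)[OF x r] x by auto
    have eq: "cfun t x * (1 - (1 - x) ^ r) = lg x" using D by (simp add: cfun_lg r_def)
    have "lg x \<le> cfun t x"
      unfolding eq[symmetric] using D cfun_pos[OF assms x] by (simp add: mult_left_le)
    then have "1 \<le> cfun t x powr s" using True s by (intro ge_one_powr_ge_zero) auto
    then have "1 * 1 \<le> cfun t x powr s * lg x" using True by (intro mult_mono) auto
    also have "\<dots> = cfun t x powr (1 + s) * (1 - (1 - x) ^ r)"
      unfolding eq[symmetric] using cfun_pos[OF assms x] by (simp add: powr_add mult_ac)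
    finally show ?thesis using True by simp
  next
    case False
    have "0 \<le> 1 - (1 - x) ^ r" using x by (simp add: power_le_one)
    then show ?thesis using False by simp
  qed
  have "unit_integral (\<lambda>x. of_bool (1 < lg x)) \<le> unit_integral (\<lambda>x. cfun t x powr (1 + s) * (1 - (1 - x) ^ r))"
    using constants_integrable(2)[OF assms] unit_interval_cdf(2)[of 1] pw unfolding e r_def
    by (intro unit_integral_mono) auto
  then show ?thesis using unit_interval_cdf(1)[of 1] by (simp only: e r_def)
qed

lemma U_L_ratio: "(\<lambda>s. U_const s / L_const s) \<in> O(\<lambda>s. ln (real s))"
\<comment> \<open>\<open>1380 = 3 * 4 * (3 + 112)\<close>: 3 bounds \<open>exp 1\<close>, the
  reciprocal of the lower bound for the integral in \<open>L_const\<close>; 4 bounds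
  \<open>t / (t - 3)\<close>; and \<open>1 \<le> ln t\<close> absorbs the constant 112.\<close>
proof (rule bigoI[where c = 1380])
  show "\<forall>\<^sub>F t in at_top. norm (U_const t / L_const t) \<le> 1380 * norm (ln (real t))"
    using eventually_ge_at_top[of 4]
  proof eventually_elim
    case (elim t)
    define JU where "JU = unit_integral (\<lambda>x. cfun t x powr (real t / (real t - 1)) * x ^ (t - 1))"
    define JL where "JL = unit_integral (\<lambda>x. cfun t x powr (real t / (real t - 1)) * (1 - (1 - x) ^ (t - 1)))"
    define R where "R = root (t - 1) (fact (t - 1))"
    have R: "0 < R" using elim by (simp add: R_def)
    have U: "U_const t = R * ((real t - 1) / real t) * JU" by (simp add: U_const_def R_def JU_def cfun_def)
    have L: "L_const t = R * ((real t - 1) / (real t)\<^sup>2) * JL" by (simp add: L_const_def R_def JL_def cfun_def)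
    have JL: "exp (- 1) \<le> JL" using L_integral_lower[of t] elim by (simp add: JL_def)
    then have JLp: "0 < JL" using exp_gt_zero[of "- 1::real"] by linarith
    have JU0: "0 \<le> JU" unfolding JU_def by (intro unit_integral_nonneg) auto
    have JU: "JU \<le> (3 * ln (real (t - 3)) + 112) / real (t - 3)"
      unfolding JU_def by (rule U_integral_upper[OF elim])
    have ln1: "1 \<le> ln (real t)"
    proof -
      have "exp 1 \<le> (3::real)" by (rule exp_le)
      then have "ln (exp 1) \<le> ln (real t)" using elim by (subst ln_le_cancel_iff) auto
      then show ?thesis by simp
    qed
    have "U_const t / L_const t = real t * JU / JL"
      unfolding U L using R elim JLp by (simp add: field_simps power2_eq_square)
    also have "\<dots> \<le> real t * JU / exp (- 1)"
      using JL JU0 JLp by (intro divide_left_mono) auto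
    also have "\<dots> = exp 1 * (real t * JU)" by (simp add: exp_minus field_simps)
    also have "\<dots> \<le> 3 * (real t * ((3 * ln (real (t - 3)) + 112) / real (t - 3)))"
      using JU JU0 exp_le by (intro mult_mono) auto
    also have "\<dots> \<le> 3 * (4 * (3 * ln (real (t - 3)) + 112))"
    proof -
      have "0 \<le> ln (real (t - 3))" using elim by simp
      moreover have "real t / real (t - 3) \<le> 4" using elim by (simp add: divide_le_eq of_nat_diff)
      ultimately have "real t / real (t - 3) * (3 * ln (real (t - 3)) + 112) \<le> 4 * (3 * ln (real (t - 3)) + 112)"
        by (intro mult_right_mono) auto
      then show ?thesis by simp
    qed
    also have "\<dots> \<le> 3 * (4 * (3 * ln (real t) + 112))" using elim by simp
    also have "\<dots> \<le> 1380 * ln (real t)" using ln1 by simp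
    finally have ub: "U_const t / L_const t \<le> 1380 * ln (real t)" .
    have "0 \<le> U_const t / L_const t"
      unfolding U L using R elim JLp JU0 by (intro divide_nonneg_nonneg mult_nonneg_nonneg) auto
    then show ?case using ub ln1 by simp
  qed
qed

section \<open>Concentration of the spanning weight\<close>

lemma cdf_asymptotics:
  fixes F :: "real \<Rightarrow> real"
  assumes "0 < r" "0 < a" "\<And>x. 0 \<le> F x" "((\<lambda>x. x / root r (F x)) \<longlongrightarrow> a) (at_right 0)"
  shows "((\<lambda>x. F x / x ^ r) \<longlongrightarrow> 1 / a ^ r) (at_right 0)"
proof -
  have "((\<lambda>x. inverse ((x / root r (F x)) ^ r)) \<longlongrightarrow> inverse (a ^ r)) (at_right 0)"
    using assms(2) by (intro tendsto_inverse tendsto_power assms(4)) simp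
  moreover have "inverse ((x / root r (F x)) ^ r) = F x / x ^ r" for x
    using assms(1,3) by (simp add: power_divide real_root_pow_pos2)
  ultimately show ?thesis by (simp add: inverse_eq_divide)
qed

section \<open>Scaling of the levels\<close>

locale random_weights =
  fixes r :: nat and a :: real and D :: "real measure"
    and M :: "nat \<Rightarrow> 'b measure" and W :: "nat \<Rightarrow> nat set \<Rightarrow> 'b \<Rightarrow> real"
  assumes r: "0 < r" and a: "0 < a" and D: "real_distribution D"
    and F0: "cdf D 0 = 0"
    and F_lim: "((\<lambda>x. cdf D x / x ^ r) \<longlongrightarrow> 1 / a ^ r) (at_right 0)"
    and M: "prob_space (M n)"
    and indep: "prob_space.indep_vars (M n) (\<lambda>_. borel) (W n) (nsets {..<n} (Suc r))"
    and W_distr: "e \<in> nsets {..<n} (Suc r) \<Longrightarrow> distr (M n) borel (W n e) = D"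
begin

interpretation D: real_distribution D by (rule D)

abbreviation "E n \<equiv> nsets {..<n::nat} (Suc r)"

definition \<rho> :: real where "\<rho> = root r (fact r)"

definition lv :: "nat \<Rightarrow> real \<Rightarrow> real" where
  "lv n c = a * \<rho> * c powr (1 / real r) / real n"

abbreviation "F \<equiv> cdf D"

abbreviation "G n z \<omega> \<equiv> level (E n) (W n) z \<omega>"

definition cond_p :: "real \<Rightarrow> real \<Rightarrow> real" where
  "cond_p w w' = (F w' - F w) / (1 - F w)"

lemma \<rho>: "0 < \<rho>" "\<rho> ^ r = fact r"
  using r by (auto simp: \<rho>_def real_root_pow_pos2)

lemma F_bounds: "0 \<le> F x" "F x \<le> 1"
  by (rule D.cdf_nonneg, rule D.cdf_bounded_prob)

lemma finite_E: "finite (E n)" by (rule finite_imp_finite_nsets) simp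

lemma lv_nonneg: "0 \<le> lv n c"
  using a \<rho> by (simp add: lv_def)

lemma lv_0: "lv n 0 = 0"
  by (simp add: lv_def)

lemma lv_mono: "0 \<le> c \<Longrightarrow> c \<le> c' \<Longrightarrow> lv n c \<le> lv n c'"
  using a \<rho> unfolding lv_def by (intro divide_right_mono mult_left_mono powr_mono2) auto

lemma lv_less: "0 \<le> c \<Longrightarrow> c < c' \<Longrightarrow> 0 < n \<Longrightarrow> lv n c < lv n c'"
  using a \<rho> r unfolding lv_def by (intro divide_strict_right_mono mult_strict_left_mono powr_less_mono2) auto

lemma lv_power: "0 \<le> c \<Longrightarrow> (lv n c / a) ^ r = fact r * c / real n ^ r"
proof -
  assume c: "0 \<le> c"
  have "(c powr (1 / real r)) ^ r = c"
  proof (cases "c = 0")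
    case False
    then show ?thesis using c r by (simp add: powr_realpow[symmetric] powr_powr)
  qed (use r in simp)
  then show ?thesis using a \<rho> by (simp add: lv_def power_divide power_mult_distrib)
qed

lemma lv_at_right: "0 < c \<Longrightarrow> filterlim (\<lambda>n. lv n c) (at_right 0) sequentially"
proof -
  assume c: "0 < c"
  define k where "k = a * \<rho> * c powr (1 / real r)"
  have "0 < k" using a \<rho> c by (simp add: k_def)
  then have "filterlim (\<lambda>n. k / real n) (at_right 0) sequentially" by real_asymp
  then show ?thesis by (simp add: lv_def k_def)
qed

lemma F_lv_lim:
  assumes "0 \<le> c"
  shows "(\<lambda>n. F (lv n c) * real n ^ r) \<longlonglongrightarrow> c * fact r"
proof (cases "c = 0")
  case False
  then have c: "0 < c" using assms by simp
  have "(\<lambda>n. F (lv n c) / lv n c ^ r * (a ^ r * (fact r * c))) \<longlonglongrightarrow> 1 / a ^ r * (a ^ r * (fact r * c))"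
    by (intro tendsto_mult tendsto_const filterlim_compose[OF F_lim lv_at_right[OF c]])
  moreover have "\<forall>\<^sub>F n in sequentially. F (lv n c) / lv n c ^ r * (a ^ r * (fact r * c)) = F (lv n c) * real n ^ r"
    using eventually_gt_at_top[of 0]
  proof eventually_elim
    case (elim n)
    have "lv n c ^ r = a ^ r * (lv n c / a) ^ r" using a by (simp add: power_divide)
    also have "\<dots> = a ^ r * (fact r * c) / real n ^ r" using lv_power[OF assms] by simp
    finally have l: "lv n c ^ r = a ^ r * (fact r * c) / real n ^ r" .
    have "a ^ r * (fact r * c) \<noteq> 0" using a c by simp
    then show ?case unfolding l by simp
  qed
  ultimately show ?thesis using a by (simp add: tendsto_cong mult.commute)
qed (simp add: lv_0 F0)

lemma F_lv_0: "0 \<le> c \<Longrightarrow> (\<lambda>n. F (lv n c)) \<longlonglongrightarrow> 0"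
  using density_to_0[OF F_lv_lim r] .

lemma F_lv_lt_1: "0 \<le> c \<Longrightarrow> \<forall>\<^sub>F n in sequentially. F (lv n c) < 1"
  by (intro order_tendstoD(2)[OF F_lv_0]) auto

text \<open>Mean degrees add up: the edges that appear between two levels form a random set of mean
  degree \<open>c' - c\<close>, independent of the lower level set.\<close>

lemma cond_p_lim:
  assumes "0 \<le> c" "0 \<le> c'"
  shows "(\<lambda>n. cond_p (lv n c) (lv n c') * real n ^ r) \<longlonglongrightarrow> (c' - c) * fact r"
proof -
  have "(\<lambda>n. (F (lv n c') * real n ^ r - F (lv n c) * real n ^ r) / (1 - F (lv n c)))
      \<longlonglongrightarrow> (c' * fact r - c * fact r) / (1 - 0)"
    by (intro tendsto_intros F_lv_lim F_lv_0 assms) simp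
  then show ?thesis by (simp add: cond_p_def left_diff_distrib)
qed

lemma cond_p_bounds:
  assumes "w \<le> w'" "F w < 1"
  shows "0 \<le> cond_p w w'" "cond_p w w' \<le> 1"
  using D.cdf_nondecreasing[OF assms(1)] assms(2) F_bounds(2)[of w']
  by (auto simp: cond_p_def divide_le_eq)

section \<open>Events of small outer probability and the lower bound\<close>

text \<open>Outer probabilities spare the measurability of most events; an explicit bound \<^term>\<open>\<eta>\<close> is needed since
  the failure probability in the tail estimate is small but does not vanish for fixed parameters.\<close>

definition err :: "(nat \<Rightarrow> 'b \<Rightarrow> bool) \<Rightarrow> real \<Rightarrow> bool" where
  "err P \<eta> \<longleftrightarrow> (\<forall>\<^sub>F n in sequentially. \<exists>B\<in>sets (M n).
     {\<omega> \<in> space (M n). \<not> P n \<omega>} \<subseteq> B \<and> measure (M n) B \<le> \<eta>)"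

lemma errI:
  assumes "\<forall>\<^sub>F n in sequentially. {\<omega> \<in> space (M n). \<not> P n \<omega>} \<in> sets (M n) \<and>
    measure (M n) {\<omega> \<in> space (M n). \<not> P n \<omega>} \<le> \<eta>"
  shows "err P \<eta>"
  unfolding err_def using assms by eventually_elim blast

lemma err_mono:
  assumes "err P \<eta>" "\<eta> \<le> \<eta>'" "\<forall>\<^sub>F n in sequentially. \<forall>\<omega>\<in>space (M n). P n \<omega> \<longrightarrow> Q n \<omega>"
  shows "err Q \<eta>'"
  using assms(1,3) unfolding err_def
proof eventually_elim
  case (elim n)
  then obtain B where "B \<in> sets (M n)" "{\<omega> \<in> space (M n). \<not> P n \<omega>} \<subseteq> B" "measure (M n) B \<le> \<eta>" by blast
  then show ?case using elim assms(2) by (intro bexI[of _ B]) auto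
qed

lemma err_conj:
  assumes "err P \<eta>" "err Q \<eta>'"
  shows "err (\<lambda>n \<omega>. P n \<omega> \<and> Q n \<omega>) (\<eta> + \<eta>')"
  using assms unfolding err_def
proof eventually_elim
  case (elim n)
  interpret prob_space "M n" by (rule M)
  obtain B C where B: "B \<in> sets (M n)" "{\<omega> \<in> space (M n). \<not> P n \<omega>} \<subseteq> B" "measure (M n) B \<le> \<eta>"
    and C: "C \<in> sets (M n)" "{\<omega> \<in> space (M n). \<not> Q n \<omega>} \<subseteq> C" "measure (M n) C \<le> \<eta>'"
    using elim by blast
  have "measure (M n) (B \<union> C) \<le> \<eta> + \<eta>'" using measure_Un_le[OF B(1) C(1)] B(3) C(3) by linarith
  then show ?case using B C by (intro bexI[of _ "B \<union> C"]) auto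
qed

definition whp :: "(nat \<Rightarrow> 'b \<Rightarrow> bool) \<Rightarrow> bool" where
  "whp P \<longleftrightarrow> (\<forall>\<eta>>0. err P \<eta>)"

lemma whp_conj: "whp P \<Longrightarrow> whp Q \<Longrightarrow> whp (\<lambda>n \<omega>. P n \<omega> \<and> Q n \<omega>)"
  unfolding whp_def
proof (intro allI impI)
  fix \<eta> :: real assume "\<forall>\<eta>>0. err P \<eta>" "\<forall>\<eta>>0. err Q \<eta>" "0 < \<eta>"
  then show "err (\<lambda>n \<omega>. P n \<omega> \<and> Q n \<omega>) \<eta>" using err_conj[of P "\<eta> / 2" Q "\<eta> / 2"] by simp
qed

lemma whp_mono:
  assumes "whp P" "\<forall>\<^sub>F n in sequentially. \<forall>\<omega>\<in>space (M n). P n \<omega> \<longrightarrow> Q n \<omega>"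
  shows "whp Q"
  using assms err_mono unfolding whp_def by blast

lemma whp_True: "\<forall>\<^sub>F n in sequentially. \<forall>\<omega>\<in>space (M n). P n \<omega> \<Longrightarrow> whp P"
  unfolding whp_def err_def
proof (intro allI impI)
  fix \<eta> :: real assume "0 < \<eta>" and ev: "\<forall>\<^sub>F n in sequentially. \<forall>\<omega>\<in>space (M n). P n \<omega>"
  from ev show "\<forall>\<^sub>F n in sequentially. \<exists>B\<in>sets (M n). {\<omega> \<in> space (M n). \<not> P n \<omega>} \<subseteq> B \<and> measure (M n) B \<le> \<eta>"
    by eventually_elim (use \<open>0 < \<eta>\<close> in \<open>auto intro!: bexI[of _ "{}"]\<close>)
qed

lemma whp_all:
  assumes "finite I" "\<And>i. i \<in> I \<Longrightarrow> whp (P i)"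
  shows "whp (\<lambda>n \<omega>. \<forall>i\<in>I. P i n \<omega>)"
  using assms
proof (induction I rule: finite_induct)
  case empty
  show ?case by (rule whp_True) simp
next
  case (insert i I)
  have "whp (\<lambda>n \<omega>. P i n \<omega> \<and> (\<forall>i\<in>I. P i n \<omega>))"
    using insert by (intro whp_conj) auto
  then show ?case by simp
qed

lemma err_levels:
  assumes "\<forall>\<^sub>F n in sequentially. w n < w' n \<and> F (w n) < 1"
    and "\<forall>\<^sub>F n in sequentially. bexp (F (w n)) (E n) (\<lambda>A. bexp (cond_p (w n) (w' n)) (E n)
           (\<lambda>B. of_bool (\<not> Q n A (A \<union> B)))) \<le> \<eta>"
  shows "err (\<lambda>n \<omega>. Q n (G n (w n) \<omega>) (G n (w' n) \<omega>)) \<eta>"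
proof (rule errI)
  show "\<forall>\<^sub>F n in sequentially. {\<omega> \<in> space (M n). \<not> Q n (G n (w n) \<omega>) (G n (w' n) \<omega>)} \<in> sets (M n) \<and>
    measure (M n) {\<omega> \<in> space (M n). \<not> Q n (G n (w n) \<omega>) (G n (w' n) \<omega>)} \<le> \<eta>"
    using assms
  proof eventually_elim
    case (elim n)
    interpret prob_space "M n" by (rule M)
    show ?case
      using prob_level_pair[OF indep finite_E D W_distr, of "w n" "w' n" "\<lambda>A B. \<not> Q n A B"] elim
      by (auto simp: cond_p_def)
  qed
qed

lemma err_level:
  assumes "\<forall>\<^sub>F n in sequentially. F (w n) < 1"
    and "\<forall>\<^sub>F n in sequentially. bexp (F (w n)) (E n) (\<lambda>A. of_bool (\<not> Q n A)) \<le> \<eta>"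
  shows "err (\<lambda>n \<omega>. Q n (G n (w n) \<omega>)) \<eta>"
proof (rule errI)
  show "\<forall>\<^sub>F n in sequentially. {\<omega> \<in> space (M n). \<not> Q n (G n (w n) \<omega>)} \<in> sets (M n) \<and>
    measure (M n) {\<omega> \<in> space (M n). \<not> Q n (G n (w n) \<omega>)} \<le> \<eta>"
    using assms
  proof eventually_elim
    case (elim n)
    interpret prob_space "M n" by (rule M)
    show ?case
      using prob_level[OF indep finite_E D W_distr, of "w n" "\<lambda>A. \<not> Q n A"] elim by auto
  qed
qed

lemma whp_positive: "whp (\<lambda>n \<omega>. \<forall>e\<in>E n. 0 < W n e \<omega>)"
proof -
  have "err (\<lambda>n \<omega>. G n 0 \<omega> = {}) 0"
  proof (rule err_level)
    have "bexp 0 (E n) (\<lambda>A. of_bool (A \<noteq> {})) = 0" for n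
    proof -
      have "bexp 0 (E n) (\<lambda>A. of_bool (A \<noteq> {})) = bexp 0 (E n) (\<lambda>A. 1 + (- 1) * of_bool (A \<inter> E n = {}))"
        by (intro bexp_cong) auto
      also have "\<dots> = 0" using finite_E[of n] by (simp only: bexp_add bexp_cmult bexp_const bexp_disjoint) simp
      finally show ?thesis .
    qed
    then show "\<forall>\<^sub>F n in sequentially. bexp (F 0) (E n) (\<lambda>A. of_bool (\<not> A = {})) \<le> 0" by (simp add: F0)
  qed (simp add: F0)
  then have "whp (\<lambda>n \<omega>. G n 0 \<omega> = {})" unfolding whp_def using err_mono by fastforce
  then show ?thesis by (rule whp_mono) (auto simp: level_def not_le)
qed

lemma whp_isolated:
  assumes "0 \<le> c" "0 < \<delta>"
  shows "whp (\<lambda>n \<omega>. (exp (- c) - \<delta>) * real n \<le> real (card (isolated {..<n} (G n (lv n c) \<omega>))))"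
  unfolding whp_def
proof (intro allI impI)
  fix \<eta> :: real assume \<eta>: "0 < \<eta>"
  have "\<forall>\<^sub>F n in sequentially. bexp (F (lv n c)) (E n)
     (\<lambda>A. of_bool (real (card (isolated {..<n} A)) < (exp (- c) - \<delta>) * real n)) < \<eta>"
    using isolated_whp[OF r F_bounds F_lv_lim[OF assms(1)] assms(2)] \<eta> by (intro order_tendstoD(2)) auto
  then have "\<forall>\<^sub>F n in sequentially. bexp (F (lv n c)) (E n)
     (\<lambda>A. of_bool (\<not> (exp (- c) - \<delta>) * real n \<le> real (card (isolated {..<n} A)))) \<le> \<eta>"
    by eventually_elim (simp add: not_le)
  then show "err (\<lambda>n \<omega>. (exp (- c) - \<delta>) * real n \<le> real (card (isolated {..<n} (G n (lv n c) \<omega>)))) \<eta>"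
    by (rule err_level[OF F_lv_lt_1[OF assms(1)]])
qed

text \<open>Mean degrees \<open>(i * \<delta>) ^ r\<close> correspond to equally spaced weights, as
  \<open>mst_weight_lower\<close> requires. Inserting the limiting proportions of isolated vertices
  reproduces the sum of \<open>exp_sum_lower\<close>, and \<open>L_const_le\<close>
  concludes.\<close>

lemma whp_lower:
  assumes "0 < \<epsilon>"
  shows "whp (\<lambda>n \<omega>. a * L_const (Suc r) - \<epsilon> < mst_weight {..<n} (E n) (\<lambda>e. W n e \<omega>))"
proof -
  define K where "K = unit_integral (\<lambda>x. lg x powr (1 / real r))"
  define b where "b = a * \<rho>"
  have b: "0 < b" using a \<rho> by (simp add: b_def)
  define \<epsilon>1 where "\<epsilon>1 = \<epsilon> / (2 * b)"
  have \<epsilon>1: "0 < \<epsilon>1" using assms b by (simp add: \<epsilon>1_def)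
  obtain \<delta> m where \<delta>: "0 < \<delta>" and m: "K - \<epsilon>1 \<le> (\<Sum>i=1..m. \<delta> * exp (- ((real i * \<delta>) ^ r)))"
    using exp_sum_lower[OF r \<epsilon>1] unfolding K_def by blast
  define \<eta> where "\<eta> = \<epsilon>1 / (4 * (real m * \<delta> + 1))"
  have md: "0 \<le> real m * \<delta>" using \<delta> by simp
  have \<eta>: "0 < \<eta>" "\<eta> * (real m * \<delta>) \<le> \<epsilon>1 / 4"
    using md \<epsilon>1 by (auto simp: \<eta>_def field_simps)
  \<comment> \<open>The exponent \<open>1 / r\<close> in \<open>lv\<close> undoes the power
    \<open>r\<close>, so these levels are multiples of \<open>b * \<delta> / n\<close>.\<close>
  have lv_i: "lv n ((real i * \<delta>) ^ r) = real i * (b * \<delta> / real n)" for i n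
  proof -
    have "((real i * \<delta>) ^ r) powr (1 / real r) = real i * \<delta>"
    proof (cases "i = 0")
      case False
      then show ?thesis using \<delta> r by (simp add: powr_realpow[symmetric] powr_powr)
    qed (use r in simp)
    then show ?thesis by (simp add: lv_def b_def)
  qed
  have iso: "whp (\<lambda>n \<omega>. \<forall>i\<in>{1..m}. (exp (- ((real i * \<delta>) ^ r)) - \<eta>) * real n
      \<le> real (card (isolated {..<n} (G n (lv n ((real i * \<delta>) ^ r)) \<omega>))))"
    using \<delta> \<eta> by (intro whp_all whp_isolated) auto
  have ev: "\<forall>\<^sub>F n in sequentially. real m * \<delta> / real n < \<epsilon>1 / 4"
  proof -
    have "(\<lambda>n. real m * \<delta> / real n) \<longlonglongrightarrow> 0" by real_asymp
    then show ?thesis using \<epsilon>1 by (intro order_tendstoD(2)) auto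
  qed
  have L: "a * L_const (Suc r) \<le> b / real r * K"
    using mult_left_mono[OF L_const_le[of "Suc r"], of a] a r by (simp add: b_def \<rho>_def K_def mult_ac)
  show ?thesis
  proof (rule whp_mono[OF whp_conj[OF whp_positive iso]])
    show "\<forall>\<^sub>F n in sequentially. \<forall>\<omega>\<in>space (M n). (\<forall>e\<in>E n. 0 < W n e \<omega>) \<and>
        (\<forall>i\<in>{1..m}. (exp (- ((real i * \<delta>) ^ r)) - \<eta>) * real n
          \<le> real (card (isolated {..<n} (G n (lv n ((real i * \<delta>) ^ r)) \<omega>)))) \<longrightarrow>
        a * L_const (Suc r) - \<epsilon> < mst_weight {..<n} (E n) (\<lambda>e. W n e \<omega>)"
      using ev eventually_ge_at_top[of "Suc r"]
    proof eventually_elim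
      case (elim n)
      show ?case
      proof (intro ballI impI, elim conjE)
        fix \<omega> assume pos: "\<forall>e\<in>E n. 0 < W n e \<omega>" and
          iso: "\<forall>i\<in>{1..m}. (exp (- ((real i * \<delta>) ^ r)) - \<eta>) * real n
          \<le> real (card (isolated {..<n} (G n (lv n ((real i * \<delta>) ^ r)) \<omega>)))"
        let ?mst = "mst_weight {..<n} (E n) (\<lambda>e. W n e \<omega>)"
        have n: "0 < real n" using elim by simp
        define d where "d = b * \<delta> / real n"
        have d: "0 < d" using b \<delta> n by (simp add: d_def)
        have "b * ((\<Sum>i=1..m. \<delta> * exp (- ((real i * \<delta>) ^ r))) - \<eta> * (real m * \<delta>) - real m * \<delta> / real n)
            = (\<Sum>i=1..m. d * ((exp (- ((real i * \<delta>) ^ r)) - \<eta>) * real n - 1))"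
        proof -
          have "d * ((exp (- ((real i * \<delta>) ^ r)) - \<eta>) * real n - 1)
              = b * (\<delta> * exp (- ((real i * \<delta>) ^ r)) - (\<eta> * \<delta> + \<delta> / real n))" for i
            using n by (simp add: d_def field_simps)
          then have "(\<Sum>i=1..m. d * ((exp (- ((real i * \<delta>) ^ r)) - \<eta>) * real n - 1))
              = b * (\<Sum>i=1..m. \<delta> * exp (- ((real i * \<delta>) ^ r)) - (\<eta> * \<delta> + \<delta> / real n))"
            by (simp add: sum_distrib_left)
          then show ?thesis by (simp add: sum_subtractf algebra_simps)
        qed
        also have "\<dots> \<le> (\<Sum>i=1..m. d * (real (card (isolated {..<n} {e \<in> E n. W n e \<omega> \<le> real i * d})) - 1))"
        proof (intro sum_mono mult_left_mono)
          fix i assume i: "i \<in> {1..m}"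
          have "{e \<in> E n. W n e \<omega> \<le> real i * d} = G n (lv n ((real i * \<delta>) ^ r)) \<omega>"
            by (simp add: level_def lv_i d_def)
          then show "(exp (- ((real i * \<delta>) ^ r)) - \<eta>) * real n - 1
              \<le> real (card (isolated {..<n} {e \<in> E n. W n e \<omega> \<le> real i * d})) - 1"
            using bspec[OF iso i] by simp
        qed (use d in simp)
        also have "\<dots> \<le> real r * ?mst"
          using r elim pos d by (intro mst_weight_lower) (auto intro: less_imp_le)
        finally have low: "b * ((\<Sum>i=1..m. \<delta> * exp (- ((real i * \<delta>) ^ r))) - \<eta> * (real m * \<delta>) - real m * \<delta> / real n) \<le> real r * ?mst" .
        have "b * (K - 3 * \<epsilon>1 / 2) \<le> b * ((\<Sum>i=1..m. \<delta> * exp (- ((real i * \<delta>) ^ r))) - \<eta> * (real m * \<delta>) - real m * \<delta> / real n)"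
          using m \<eta> elim b by (intro mult_left_mono) auto
        then have "b * (K - 3 * \<epsilon>1 / 2) \<le> real r * ?mst" using low by linarith
        then have "b * (K - 3 * \<epsilon>1 / 2) / real r \<le> ?mst" using r by (simp add: divide_le_eq mult.commute)
        moreover have "b * (K - 3 * \<epsilon>1 / 2) / real r = b / real r * K - 3 * \<epsilon> / 4 / real r"
        proof -
          have "b * \<epsilon>1 = \<epsilon> / 2" using b by (simp add: \<epsilon>1_def)
          then have "b * (K - 3 * \<epsilon>1 / 2) = b * K - 3 * \<epsilon> / 4" by (simp add: algebra_simps)
          then show ?thesis by (simp add: diff_divide_distrib)
        qed
        moreover have "3 * \<epsilon> / 4 / real r < \<epsilon>"
        proof -
          have "3 * \<epsilon> / 4 / real r \<le> 3 * \<epsilon> / 4 / 1" using assms r by (intro divide_left_mono) auto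
          then show ?thesis using assms by linarith
        qed
        ultimately show "a * L_const (Suc r) - \<epsilon> < ?mst" using L by linarith
      qed
    qed
  qed
qed

end

section \<open>The giant component at a level and the edges of a window\<close>

text \<open>A component of maximal size as a function of the edge set alone, ties being broken by
  choice. Conditioning on a level set therefore fixes its component as well.\<close>

definition big_comp :: "nat \<Rightarrow> nat set set \<Rightarrow> nat set" where
  "big_comp n A = reach A `` {arg_max_on (\<lambda>v. card (reach A `` {v})) {..<n}}"

lemma big_comp_props:
  assumes "0 < n" "A \<subseteq> nsets {..<n} t"
  shows "big_comp n A \<subseteq> {..<n}" "big_comp n A \<times> big_comp n A \<subseteq> reach A" "big_comp n A \<noteq> {}"
    "v < n \<Longrightarrow> card (reach A `` {v}) \<le> card (big_comp n A)"
proof -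
  let ?f = "\<lambda>v. card (reach A `` {v})"
  define u where "u = arg_max_on ?f {..<n}"
  have ne: "{..<n} \<noteq> {}" using assms(1) by auto
  obtain v0 where v0: "v0 < n" "\<And>v. v < n \<Longrightarrow> ?f v \<le> ?f v0"
  proof -
    have "finite (?f ` {..<n})" "?f ` {..<n} \<noteq> {}" using ne by auto
    then have "Max (?f ` {..<n}) \<in> ?f ` {..<n}" by (rule Max_in)
    then obtain v0 where "v0 < n" "Max (?f ` {..<n}) = ?f v0" by auto
    then show thesis using that[of v0] Max_ge[of "?f ` {..<n}"] by (metis finite_imageI finite_lessThan imageI lessThan_iff)
  qed
  have "is_arg_max ?f (\<lambda>v. v \<in> {..<n}) v0"
    using v0 by (auto simp: is_arg_max_linorder)
  then have "is_arg_max ?f (\<lambda>v. v \<in> {..<n}) u"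
    unfolding u_def arg_max_on_def arg_max_def by (rule someI)
  then have u: "u < n" "\<And>v. v < n \<Longrightarrow> ?f v \<le> ?f u" by (auto simp: is_arg_max_linorder)
  have b: "big_comp n A = reach A `` {u}" by (simp add: big_comp_def u_def)
  show "big_comp n A \<subseteq> {..<n}"
    unfolding b using u(1) assms(2) by (intro reach_subset) (auto simp: nsets_def)
  show "big_comp n A \<times> big_comp n A \<subseteq> reach A"
    unfolding b using reach_sym rtrancl_trans by fast
  show "big_comp n A \<noteq> {}" unfolding b by auto
  show "card (reach A `` {v}) \<le> card (big_comp n A)" if "v < n"
    unfolding b using u(2)[OF that] .
qed

context random_weights
begin

text \<open>The two rounds of \<open>giant\<close> are realised by the level set at \<open>c\<close>
  and the edges that appear between \<open>c\<close> and \<open>c'\<close>. If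
  \<open>giant_frac\<close> is not above \<open>\<delta> / 2\<close>, the bound is not
  positive.\<close>

lemma whp_giant:
  assumes "0 \<le> c" "c < c'" "0 < \<delta>"
  shows "whp (\<lambda>n \<omega>. (giant_frac (Suc r) c - \<delta>) * real n \<le> real (card (big_comp n (G n (lv n c') \<omega>))))"
proof (cases "giant_frac (Suc r) c \<le> \<delta> / 2")
  case True
  show ?thesis
  proof (rule whp_True, intro always_eventually allI ballI)
    fix n \<omega>
    have "(giant_frac (Suc r) c - \<delta>) * real n \<le> 0 * real n"
      using True assms(3) by (intro mult_right_mono) auto
    then show "(giant_frac (Suc r) c - \<delta>) * real n \<le> real (card (big_comp n (G n (lv n c') \<omega>)))" by simp
  qed
next
  case False
  then obtain x where x: "0 < x" "x < 1" "cfun (Suc r) x < c" "giant_frac (Suc r) c - \<delta> / 2 < x"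
    using giant_frac_approx[of "\<delta> / 2" "Suc r" c] assms(3) by auto
  obtain c1 where c1: "cfun (Suc r) x < c1" "c1 < c" using x(3) dense by blast
  \<comment> \<open>The sprinkled mean degree tends to \<open>c' - c\<close>, so it eventually
    exceeds half of that.\<close>
  define \<eta> where "\<eta> = (c' - c) / 2"
  have \<eta>: "0 < \<eta>" using assms by (simp add: \<eta>_def)
  show ?thesis
    unfolding whp_def
  proof (intro allI impI)
    fix \<epsilon> :: real assume \<epsilon>: "0 < \<epsilon>"
    have "2 \<le> Suc r" "0 < \<delta> / 2" using r assms(3) by auto
    from giant[OF this(1) x(1,2) c1(1) \<eta> this(2) \<epsilon>]
    obtain n0 where n0: "\<And>(V::nat set) p q. finite V \<and> n0 \<le> card V \<and> 0 \<le> p \<and> p \<le> 1 \<and> 0 \<le> q \<and> q \<le> 1 \<and>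
      c1 \<le> p * real (card V choose (Suc r - 1)) \<and> \<eta> \<le> q * real (card V choose (Suc r - 1)) \<Longrightarrow>
      bexp p (nsets V (Suc r)) (\<lambda>A. bexp q (nsets V (Suc r)) (\<lambda>B.
      of_bool (\<forall>v\<in>V. real (card (reach (A \<union> B) `` {v})) < (x - \<delta> / 2) * real (card V)))) \<le> \<epsilon>"
      by blast
    have p: "(\<lambda>n. F (lv n c) * real ((n - 0) choose r)) \<longlonglongrightarrow> c"
      by (rule density_choose[OF F_lv_lim[OF assms(1)]])
    have q: "(\<lambda>n. cond_p (lv n c) (lv n c') * real ((n - 0) choose r)) \<longlonglongrightarrow> c' - c"
      using assms by (intro density_choose cond_p_lim) auto
    have ev: "\<forall>\<^sub>F n in sequentially. 0 < n \<and> n0 \<le> n \<and> lv n c < lv n c' \<and> F (lv n c) < 1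
        \<and> c1 \<le> F (lv n c) * real (n choose r) \<and> \<eta> \<le> cond_p (lv n c) (lv n c') * real (n choose r)"
    proof -
      have 1: "\<forall>\<^sub>F n in sequentially. c1 < F (lv n c) * real ((n - 0) choose r)"
        using p c1 by (intro order_tendstoD(1)) auto
      have 2: "\<forall>\<^sub>F n in sequentially. \<eta> < cond_p (lv n c) (lv n c') * real ((n - 0) choose r)"
        using q assms by (intro order_tendstoD(1)) (auto simp: \<eta>_def)
      show ?thesis
        using 1 2 F_lv_lt_1[OF assms(1)] eventually_gt_at_top[of 0] eventually_ge_at_top[of n0]
        by eventually_elim (use lv_less assms in \<open>auto simp: less_imp_le\<close>)
    qed
    have "err (\<lambda>n \<omega>. (giant_frac (Suc r) c - \<delta>) * real n \<le> real (card (big_comp n (G n (lv n c') \<omega>)))) \<epsilon>"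
    proof (rule err_levels[where w = "\<lambda>n. lv n c" and w' = "\<lambda>n. lv n c'" and
        Q = "\<lambda>n A B. (giant_frac (Suc r) c - \<delta>) * real n \<le> real (card (big_comp n B))"])
      show "\<forall>\<^sub>F n in sequentially. lv n c < lv n c' \<and> F (lv n c) < 1" using ev by eventually_elim simp
      show "\<forall>\<^sub>F n in sequentially. bexp (F (lv n c)) (E n) (\<lambda>A. bexp (cond_p (lv n c) (lv n c')) (E n)
           (\<lambda>B. of_bool (\<not> (giant_frac (Suc r) c - \<delta>) * real n \<le> real (card (big_comp n (A \<union> B)))))) \<le> \<epsilon>"
        using ev
      proof eventually_elim
        case (elim n)
        have q01: "0 \<le> cond_p (lv n c) (lv n c')" "cond_p (lv n c) (lv n c') \<le> 1"
          using elim by (auto intro!: cond_p_bounds)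
        have "bexp (F (lv n c)) (E n) (\<lambda>A. bexp (cond_p (lv n c) (lv n c')) (E n)
           (\<lambda>B. of_bool (\<not> (giant_frac (Suc r) c - \<delta>) * real n \<le> real (card (big_comp n (A \<union> B))))))
         \<le> bexp (F (lv n c)) (E n) (\<lambda>A. bexp (cond_p (lv n c) (lv n c')) (E n) (\<lambda>B.
            of_bool (\<forall>v\<in>{..<n}. real (card (reach (A \<union> B) `` {v})) < (x - \<delta> / 2) * real (card {..<n}))))"
        proof (intro bexp_mono F_bounds q01)
          fix A B assume AB: "A \<subseteq> E n" "B \<subseteq> E n"
          then have "A \<union> B \<subseteq> E n" by simp
          note bc = big_comp_props(4)[OF _ this]
          have *: "(giant_frac (Suc r) c - \<delta>) * real n \<le> (x - \<delta> / 2) * real n"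
            using x(4) by (intro mult_right_mono) auto
          have "real (card (reach (A \<union> B) `` {v})) < (x - \<delta> / 2) * real n"
            if "\<not> (giant_frac (Suc r) c - \<delta>) * real n \<le> real (card (big_comp n (A \<union> B)))" "v < n" for v
          proof -
            have "real (card (reach (A \<union> B) `` {v})) \<le> real (card (big_comp n (A \<union> B)))"
              using bc[of v] elim that(2) by simp
            moreover have "real (card (big_comp n (A \<union> B))) < (x - \<delta> / 2) * real n"
              using * that(1) by linarith
            ultimately show ?thesis by linarith
          qed
          then show "of_bool (\<not> (giant_frac (Suc r) c - \<delta>) * real n \<le> real (card (big_comp n (A \<union> B))))
            \<le> (of_bool (\<forall>v\<in>{..<n}. real (card (reach (A \<union> B) `` {v})) < (x - \<delta> / 2) * real (card {..<n})) :: real)"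
            by auto
        qed
        also have "\<dots> \<le> \<epsilon>"
          using elim q01 F_bounds by (intro n0) auto
        finally show ?case .
      qed
    qed
    then show "err (\<lambda>n \<omega>. (giant_frac (Suc r) c - \<delta>) * real n \<le> real (card (big_comp n (G n (lv n c') \<omega>)))) \<epsilon>" .
  qed
qed

lemma nsets_missing_card:
  assumes "S \<subseteq> {..<n}" "0 < n" "0 \<le> \<xi>" "\<xi> * real n \<le> real (card S)"
  shows "real (card {e \<in> E n. \<not> e \<subseteq> S}) \<le> real (n choose Suc r) * (1 - max 0 (\<xi> - real (Suc r) / real n) ^ Suc r)"
proof -
  have finS: "finite S" using assms(1) finite_subset by blast
  have eq: "{e \<in> E n. \<not> e \<subseteq> S} = E n - nsets S (Suc r)" by (auto simp: nsets_def)
  have sub: "nsets S (Suc r) \<subseteq> E n" using assms(1) by (rule nsets_mono)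
  have "card {e \<in> E n. \<not> e \<subseteq> S} = (n choose Suc r) - (card S choose Suc r)"
    unfolding eq using sub finS by (subst card_Diff_subset) (auto simp: card_nsets finite_imp_finite_nsets)
  moreover have "card (nsets S (Suc r)) \<le> card (E n)" using sub by (intro card_mono finite_E)
  then have "(card S choose Suc r) \<le> (n choose Suc r)" using finS by (simp add: card_nsets)
  ultimately have c: "real (card {e \<in> E n. \<not> e \<subseteq> S}) = real (n choose Suc r) - real (card S choose Suc r)"
    by (simp add: of_nat_diff)
  have "max 0 (\<xi> - real (Suc r) / real n) ^ Suc r * real (n choose Suc r) \<le> real (card S choose Suc r)"
  proof (cases "\<xi> \<le> real (Suc r) / real n")
    case True
    then show ?thesis by simp
  next
    case False
    then have x: "real (Suc r) < \<xi> * real n" using assms(2) by (simp add: field_simps)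
    then have S: "Suc r \<le> card S" using assms(4) by linarith
    have "\<xi> - real (Suc r) / real n = (\<xi> * real n - real (Suc r)) / real n"
      using assms(2) by (simp add: diff_divide_distrib)
    also have "\<dots> \<le> (real (card S) - real (Suc r)) / real n"
      using assms by (intro divide_right_mono) auto
    finally have "max 0 (\<xi> - real (Suc r) / real n) ^ Suc r \<le> ((real (card S) - real (Suc r)) / real n) ^ Suc r"
      using False S by (intro power_mono) auto
    then have "max 0 (\<xi> - real (Suc r) / real n) ^ Suc r * real (n choose Suc r)
      \<le> ((real (card S) - real (Suc r)) / real n) ^ Suc r * real (n choose Suc r)"
      by (intro mult_right_mono) auto
    also have "\<dots> \<le> real (card S choose Suc r)" by (rule choose_ratio_ge[OF S assms(2)])
    finally show ?thesis .
  qed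
  then show ?thesis unfolding c by (simp add: algebra_simps)
qed

text \<open>Given the lower level set, its largest component is fixed and the fresh edges are an
  independent random set. Those outside this component are among a binomial number with mean about
  \<open>(c' - c) * (1 - \<xi> ^ t) / t * n\<close>, controlled by Chebyshev's inequality.\<close>

lemma whp_window:
  assumes "0 \<le> c" "c < c'" "0 \<le> \<xi>" "\<xi> \<le> 1" "0 < \<delta>"
  shows "whp (\<lambda>n \<omega>. \<xi> * real n \<le> real (card (big_comp n (G n (lv n c) \<omega>))) \<longrightarrow>
     real (card {e \<in> G n (lv n c') \<omega> - G n (lv n c) \<omega>. \<not> e \<subseteq> big_comp n (G n (lv n c) \<omega>)})
       \<le> ((c' - c) * ((1 - \<xi> ^ Suc r) / real (Suc r)) + \<delta>) * real n)"
proof -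
  define q where "q n = cond_p (lv n c) (lv n c')" for n
  define \<mu> where "\<mu> = (c' - c) * ((1 - \<xi> ^ Suc r) / real (Suc r))"
  define \<zeta> where "\<zeta> n = max 0 (\<xi> - real (Suc r) / real n)" for n
  define \<kappa> where "\<kappa> n = q n * real ((n - 1) choose r)" for n
  have \<kappa>: "\<kappa> \<longlonglongrightarrow> c' - c"
    unfolding \<kappa>_def q_def using assms by (intro density_choose cond_p_lim) auto
  have \<zeta>: "\<zeta> \<longlonglongrightarrow> max 0 (\<xi> - 0)"
    unfolding \<zeta>_def by (intro tendsto_max tendsto_diff tendsto_const) real_asymp
  have "(\<lambda>n. \<kappa> n * ((1 - \<zeta> n ^ Suc r) / real (Suc r))) \<longlonglongrightarrow> (c' - c) * ((1 - (max 0 (\<xi> - 0)) ^ Suc r) / real (Suc r))"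
    by (intro tendsto_intros \<kappa> \<zeta>) simp
  then have "(\<lambda>n. \<kappa> n * ((1 - \<zeta> n ^ Suc r) / real (Suc r))) \<longlonglongrightarrow> \<mu>"
    using assms(3) by (simp add: \<mu>_def del: power_Suc)
  then have ev1: "\<forall>\<^sub>F n in sequentially. \<kappa> n * ((1 - \<zeta> n ^ Suc r) / real (Suc r)) < \<mu> + \<delta> / 2"
    using assms(5) by (intro order_tendstoD(2)) auto
  show ?thesis
    unfolding whp_def
  proof (intro allI impI)
    fix \<epsilon> :: real assume \<epsilon>: "0 < \<epsilon>"
    have "(\<lambda>n. (\<mu> + \<delta> / 2) / (\<delta> / 2)\<^sup>2 / real n) \<longlonglongrightarrow> 0" by real_asymp
    then have ev2: "\<forall>\<^sub>F n in sequentially. (\<mu> + \<delta> / 2) / (\<delta> / 2)\<^sup>2 / real n < \<epsilon>"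
      using \<epsilon> by (intro order_tendstoD(2)) auto
    have ev: "\<forall>\<^sub>F n in sequentially. 0 < n \<and> lv n c < lv n c' \<and> F (lv n c) < 1
        \<and> \<kappa> n * ((1 - \<zeta> n ^ Suc r) / real (Suc r)) < \<mu> + \<delta> / 2
        \<and> (\<mu> + \<delta> / 2) / (\<delta> / 2)\<^sup>2 / real n < \<epsilon>"
      using ev1 ev2 F_lv_lt_1[OF assms(1)] eventually_gt_at_top[of 0]
      by eventually_elim (use lv_less assms in auto)
    have "err (\<lambda>n \<omega>. \<xi> * real n \<le> real (card (big_comp n (G n (lv n c) \<omega>))) \<longrightarrow>
     real (card {e \<in> G n (lv n c') \<omega> - G n (lv n c) \<omega>. \<not> e \<subseteq> big_comp n (G n (lv n c) \<omega>)})
       \<le> (\<mu> + \<delta>) * real n) \<epsilon>"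
    proof (rule err_levels[where w = "\<lambda>n. lv n c" and w' = "\<lambda>n. lv n c'" and
        Q = "\<lambda>n A B. \<xi> * real n \<le> real (card (big_comp n A)) \<longrightarrow>
          real (card {e \<in> B - A. \<not> e \<subseteq> big_comp n A}) \<le> (\<mu> + \<delta>) * real n"])
      show "\<forall>\<^sub>F n in sequentially. lv n c < lv n c' \<and> F (lv n c) < 1" using ev by eventually_elim simp
      show "\<forall>\<^sub>F n in sequentially. bexp (F (lv n c)) (E n) (\<lambda>A. bexp (cond_p (lv n c) (lv n c')) (E n)
           (\<lambda>B. of_bool (\<not> (\<xi> * real n \<le> real (card (big_comp n A)) \<longrightarrow>
          real (card {e \<in> A \<union> B - A. \<not> e \<subseteq> big_comp n A}) \<le> (\<mu> + \<delta>) * real n)))) \<le> \<epsilon>"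
        using ev
      proof eventually_elim
        case (elim n)
        then have n: "0 < n" by simp
        have q01: "0 \<le> q n" "q n \<le> 1"
          using elim unfolding q_def by (auto intro!: cond_p_bounds)
        show ?case
          unfolding q_def[symmetric]
        proof (rule bexp_le_const[OF finite_E F_bounds])
          fix A assume A: "A \<subseteq> E n"
          define S where "S = big_comp n A"
          have SV: "S \<subseteq> {..<n}" unfolding S_def by (rule big_comp_props(1)[OF n A])
          define T where "T = {e \<in> E n. \<not> e \<subseteq> S}"
          show "bexp (q n) (E n) (\<lambda>B. of_bool (\<not> (\<xi> * real n \<le> real (card (big_comp n A)) \<longrightarrow>
            real (card {e \<in> A \<union> B - A. \<not> e \<subseteq> big_comp n A}) \<le> (\<mu> + \<delta>) * real n))) \<le> \<epsilon>"
          proof (cases "\<xi> * real n \<le> real (card S)")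
            case False
            then show ?thesis using finite_E \<epsilon> by (simp add: S_def)
          next
            case True
            have "q n * real (card T) \<le> q n * (real (n choose Suc r) * (1 - \<zeta> n ^ Suc r))"
              unfolding T_def \<zeta>_def using q01 assms(3) by (intro mult_left_mono nsets_missing_card SV n True)
            also have "\<dots> = \<kappa> n * ((1 - \<zeta> n ^ Suc r) / real (Suc r)) * real n"
            proof -
              \<comment> \<open>Double counting of pairs of an edge and a vertex in it; this is the
                origin of the factor \<open>1 / t\<close>.\<close>
              have "Suc r * (n choose Suc r) = n * ((n - 1) choose r)"
                using binomial_absorption[of r "n"] by simp
              then have "real (Suc r) * real (n choose Suc r) = real n * real ((n - 1) choose r)"
                by (metis of_nat_mult)
              then have "real (n choose Suc r) = real n * real ((n - 1) choose r) / real (Suc r)"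
                by (simp add: field_simps del: of_nat_Suc)
              then show ?thesis by (simp add: \<kappa>_def mult_ac del: of_nat_Suc power_Suc)
            qed
            also have "\<dots> \<le> (\<mu> + \<delta> / 2) * real n" using elim by (intro mult_right_mono) auto
            finally have qT: "q n * real (card T) \<le> (\<mu> + \<delta> / 2) * real n" .
            have pos: "0 < (\<delta> / 2 * real n)\<^sup>2" using assms(5) n by simp
            have "bexp (q n) (E n) (\<lambda>B. of_bool (\<not> (\<xi> * real n \<le> real (card (big_comp n A)) \<longrightarrow>
              real (card {e \<in> A \<union> B - A. \<not> e \<subseteq> big_comp n A}) \<le> (\<mu> + \<delta>) * real n)))
              \<le> bexp (q n) (E n) (\<lambda>B. (real (card (B \<inter> T)) - q n * real (card T))\<^sup>2) / (\<delta> / 2 * real n)\<^sup>2"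
            proof (rule bexp_markov[OF q01 pos])
              fix B assume B: "B \<subseteq> E n"
              assume "\<not> (\<xi> * real n \<le> real (card (big_comp n A)) \<longrightarrow>
                real (card {e \<in> A \<union> B - A. \<not> e \<subseteq> big_comp n A}) \<le> (\<mu> + \<delta>) * real n)"
              then have "(\<mu> + \<delta>) * real n < real (card {e \<in> A \<union> B - A. \<not> e \<subseteq> S})" by (simp add: S_def)
              also have "\<dots> \<le> real (card (B \<inter> T))"
                using B finite_subset[OF B finite_E] by (intro of_nat_mono card_mono) (auto simp: T_def)
              finally have "\<delta> / 2 * real n \<le> real (card (B \<inter> T)) - q n * real (card T)"
                using qT by (simp add: algebra_simps)
              then show "(\<delta> / 2 * real n)\<^sup>2 \<le> (real (card (B \<inter> T)) - q n * real (card T))\<^sup>2"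
                using assms(5) by (intro power_mono) auto
            qed auto
            also have "bexp (q n) (E n) (\<lambda>B. (real (card (B \<inter> T)) - q n * real (card T))\<^sup>2) = q n * (1 - q n) * real (card T)"
              by (rule bexp_card_sq[OF finite_E]) (auto simp: T_def)
            also have "q n * (1 - q n) * real (card T) \<le> (\<mu> + \<delta> / 2) * real n"
            proof -
              have "q n * (1 - q n) * real (card T) \<le> q n * 1 * real (card T)"
                using q01 by (intro mult_right_mono mult_left_mono) auto
              then show ?thesis using qT by simp
            qed
            finally have "bexp (q n) (E n) (\<lambda>B. of_bool (\<not> (\<xi> * real n \<le> real (card (big_comp n A)) \<longrightarrow>
              real (card {e \<in> A \<union> B - A. \<not> e \<subseteq> big_comp n A}) \<le> (\<mu> + \<delta>) * real n)))
              \<le> (\<mu> + \<delta> / 2) * real n / (\<delta> / 2 * real n)\<^sup>2" using pos by (simp add: divide_right_mono)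
            also have "\<dots> = (\<mu> + \<delta> / 2) / (\<delta> / 2)\<^sup>2 / real n"
              using n by (simp add: power_mult_distrib power2_eq_square)
            also have "\<dots> \<le> \<epsilon>" using elim by simp
            finally show ?thesis .
          qed
        qed
      qed
    qed
    then show "err (\<lambda>n \<omega>. \<xi> * real n \<le> real (card (big_comp n (G n (lv n c) \<omega>))) \<longrightarrow>
     real (card {e \<in> G n (lv n c') \<omega> - G n (lv n c) \<omega>. \<not> e \<subseteq> big_comp n (G n (lv n c) \<omega>)})
       \<le> ((c' - c) * ((1 - \<xi> ^ Suc r) / real (Suc r)) + \<delta>) * real n) \<epsilon>" by (simp only: \<mu>_def)
  qed
qed

end

section \<open>Attaching the vertices outside the giant component\<close>

text \<open>An attaching edge has all its other vertices in \<open>S\<close>, so the candidates for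
  different \<open>v\<close> are distinct and each \<open>v\<close> has
  \<open>card S choose r\<close> of them, independently of the other outside vertices.\<close>

definition unattached :: "nat \<Rightarrow> nat set \<Rightarrow> nat set set \<Rightarrow> nat set" where
  "unattached n S A = {v \<in> {..<n} - S. \<forall>e\<in>A. v \<in> e \<longrightarrow> \<not> e - {v} \<subseteq> S}"

lemma dyadic_level:
  fixes y z :: real
  assumes "0 < y" "y \<le> z"
  obtains J :: nat where "y * 2 ^ J \<le> z" "z < y * 2 ^ Suc J"
proof -
  obtain N :: nat where "z / y < 2 ^ N" using real_arch_pow[of 2 "z / y"] by auto
  then have "z < y * 2 ^ N" using assms by (simp add: divide_less_eq mult.commute)
  moreover have "\<not> z < y * 2 ^ 0" using assms by simp
  ultimately obtain k where "\<forall>i\<le>k. \<not> z < y * 2 ^ i" "z < y * 2 ^ Suc k"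
    using ex_least_nat_less[of "\<lambda>j. z < y * 2 ^ j" N] by blast
  then show thesis by (intro that[of k]) auto
qed

lemma exp_neg_pow2_le: "exp (- (2 ^ j)) \<le> 2 / (4::real) ^ j"
proof -
  have "((2::real) ^ j)\<^sup>2 / 2 \<le> exp (2 ^ j)" using exp_lower_Taylor_quadratic[of "2 ^ j :: real"]
      zero_le_power[of "2::real" j] by linarith
  moreover have "((2::real) ^ j)\<^sup>2 = 4 ^ j" by (simp add: power2_eq_square power_mult_distrib[symmetric])
  ultimately have "(4::real) ^ j / 2 \<le> exp (2 ^ j)" by simp
  then have "1 / exp (2 ^ j) \<le> 1 / ((4::real) ^ j / 2)" by (intro divide_left_mono) auto
  then show ?thesis by (simp add: exp_minus inverse_eq_divide)
qed

context random_weights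
begin

text \<open>As \<open>S\<close> has at least half of the vertices and \<open>4 * r \<le> n\<close>,
  each outside vertex has at least \<open>(n / 4) ^ r / fact r\<close> candidate edges. All of them
  are missing from \<open>B\<close> with probability at most \<open>exp (- K)\<close>.\<close>

lemma unattached_expectation:
  assumes "A \<subseteq> E n" "S \<subseteq> {..<n}" "real n \<le> 2 * real (card S)" "4 * r \<le> n" "0 < n" "0 \<le> q" "q \<le> 1"
    and "K \<le> q * (real n / 4) ^ r / fact r"
  shows "bexp q (E n) (\<lambda>B. real (card (unattached n S (A \<union> B)))) \<le> real (card ({..<n} - S)) * exp (- K)"
proof -
  have finS: "finite S" using assms(2) finite_subset by blast
  define T where "T v = insert v ` nsets S r" for v
  have TE: "T v \<subseteq> E n" and cT: "card (T v) = card S choose r" if v: "v \<in> {..<n} - S" for v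
  proof -
    show "T v \<subseteq> E n" unfolding T_def using v assms(2) by (auto simp: nsets_def card_insert_if)
    have "inj_on (insert v) (nsets S r)"
    proof (rule inj_onI)
      fix x y assume "x \<in> nsets S r" "y \<in> nsets S r" "insert v x = insert v y"
      moreover have "v \<notin> x" "v \<notin> y" using calculation v by (auto simp: nsets_def)
      ultimately show "x = y" by (metis insert_ident)
    qed
    then show "card (T v) = card S choose r" unfolding T_def using finS by (simp add: card_image card_nsets)
  qed
  have "bexp q (E n) (\<lambda>B. real (card (unattached n S (A \<union> B))))
      \<le> bexp q (E n) (\<lambda>B. \<Sum>v\<in>{..<n} - S. of_bool (B \<inter> T v = {}))"
  proof (rule bexp_mono)
    fix B
    have "real (card (unattached n S (A \<union> B))) = (\<Sum>v\<in>unattached n S (A \<union> B). 1)" by simp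
    also have "\<dots> \<le> (\<Sum>v\<in>unattached n S (A \<union> B). of_bool (B \<inter> T v = {}))"
    proof (rule sum_mono)
      fix v assume v: "v \<in> unattached n S (A \<union> B)"
      have "B \<inter> T v = {}"
      proof (rule ccontr)
        assume "B \<inter> T v \<noteq> {}"
        then obtain \<sigma> where \<sigma>: "insert v \<sigma> \<in> B" "\<sigma> \<in> nsets S r" by (auto simp: T_def)
        then have "insert v \<sigma> - {v} \<subseteq> S" by (auto simp: nsets_def)
        moreover have "\<not> insert v \<sigma> - {v} \<subseteq> S" using v \<sigma>(1) by (auto simp: unattached_def)
        ultimately show False by blast
      qed
      then show "(1::real) \<le> of_bool (B \<inter> T v = {})" by simp
    qed
    also have "\<dots> \<le> (\<Sum>v\<in>{..<n} - S. of_bool (B \<inter> T v = {}))"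
      by (intro sum_mono2) (auto simp: unattached_def)
    finally show "real (card (unattached n S (A \<union> B))) \<le> (\<Sum>v\<in>{..<n} - S. of_bool (B \<inter> T v = {}))" .
  qed (use assms in auto)
  also have "\<dots> = (\<Sum>v\<in>{..<n} - S. (1 - q) ^ (card S choose r))"
    unfolding bexp_sum using cT by (intro sum.cong refl) (simp add: bexp_disjoint[OF finite_E TE])
  also have "\<dots> = real (card ({..<n} - S)) * (1 - q) ^ (card S choose r)" by simp
  also have "\<dots> \<le> real (card ({..<n} - S)) * exp (- K)"
  proof (rule mult_left_mono)
    have "real n / 4 \<le> real (card S) - real r" using assms(3,4) by linarith
    moreover have "r \<le> card S" using assms(3,4) by linarith
    ultimately have "(real n / 4) ^ r \<le> fact r * real (card S choose r)"
      using choose_lower[of r "card S"] power_mono[of "real n / 4" "real (card S) - real r" r] by linarith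
    then have "(real n / 4) ^ r / fact r \<le> real (card S choose r)" by (simp add: divide_le_eq mult.commute)
    then have "q * ((real n / 4) ^ r / fact r) \<le> q * real (card S choose r)" using assms by (intro mult_left_mono)
    then have K: "K \<le> q * real (card S choose r)" using assms(8) by simp
    have "(1 - q) ^ (card S choose r) \<le> exp (- q) ^ (card S choose r)"
      using assms exp_ge_add_one_self[of "- q"] by (intro power_mono) auto
    also have "\<dots> = exp (- (q * real (card S choose r)))"
      by (simp add: exp_of_nat_mult[symmetric] mult_ac)
    also have "\<dots> \<le> exp (- K)" using K by simp
    finally show "(1 - q) ^ (card S choose r) \<le> exp (- K)" .
  qed simp
  finally show ?thesis .
qed

text \<open>The dyadic levels climb up to a constant weight, so \<open>F\<close> must be controlled
  for all small \<open>x\<close> at once and not only along \<open>lv n c\<close>. The constants 7/8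
  and 9/8 are close enough for the increment of \<open>F\<close> from the base level to every dyadic
  level to keep a fixed proportion.\<close>

lemma F_two_sided:
  obtains x0 where "0 < x0" "\<And>x. 0 < x \<Longrightarrow> x < x0 \<Longrightarrow> 7 / 8 * (x / a) ^ r \<le> F x \<and> F x \<le> 9 / 8 * (x / a) ^ r"
proof -
  have ar: "0 < a ^ r" using a by simp
  have "\<forall>\<^sub>F x in at_right 0. 7 / 8 / a ^ r < F x / x ^ r \<and> F x / x ^ r < 9 / 8 / a ^ r"
  proof (intro eventually_conj order_tendstoD[OF F_lim])
    show "7 / 8 / a ^ r < 1 / a ^ r" "1 / a ^ r < 9 / 8 / a ^ r"
      using ar by (intro divide_strict_right_mono; simp)+
  qed
  then obtain x0 where x0: "0 < x0" "\<And>x. 0 < x \<Longrightarrow> x < x0 \<Longrightarrow> 7 / 8 / a ^ r < F x / x ^ r \<and> F x / x ^ r < 9 / 8 / a ^ r"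
    unfolding eventually_at_right_field by blast
  show thesis
  proof (rule that[OF x0(1)])
    fix x assume x: "0 < x" "x < x0"
    then have xr: "0 < x ^ r" by simp
    have "7 / 8 / a ^ r * x ^ r \<le> F x" "F x \<le> 9 / 8 / a ^ r * x ^ r"
      using x0(2)[OF x] xr by (auto simp: pos_less_divide_eq pos_divide_less_eq)
    then show "7 / 8 * (x / a) ^ r \<le> F x \<and> F x \<le> 9 / 8 * (x / a) ^ r" by (simp add: power_divide)
  qed
qed

text \<open>Vertices outside the giant component are attached through the dyadic levels
  \<^term>\<open>2 * lv n c * 2 ^ j\<close>, up to a constant weight; the number of vertices still unattached decreases
  fast enough for the total weight to be of the order of the first level.\<close>

lemma err_tail:
  assumes c: "4 ^ Suc r \<le> c" and \<theta>: "0 \<le> \<theta>" "\<theta> \<le> 1 / 2" and \<tau>: "0 < \<tau>" and \<eta>: "0 < \<eta>"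
  defines "y \<equiv> \<lambda>n j. 2 * lv n c * 2 ^ j"
  shows "err (\<lambda>n \<omega>. (1 - \<theta>) * real n \<le> real (card (big_comp n (G n (lv n c) \<omega>))) \<longrightarrow>
      (\<exists>J. unattached n (big_comp n (G n (lv n c) \<omega>)) (G n (y n J) \<omega>) = {} \<and>
        (\<Sum>j<J. y n (Suc j) * real (card (unattached n (big_comp n (G n (lv n c) \<omega>)) (G n (y n j) \<omega>)))) \<le> \<tau>))
    (4 * (a * \<rho> * c powr (1 / real r)) * \<theta> / \<tau> + \<eta>)"
proof -
  define b where "b = a * \<rho> * c powr (1 / real r)"
  have c0: "0 < c" using c by (smt (verit) zero_less_power)
  have b: "0 < b" using a \<rho> c0 by (simp add: b_def)
  have lv: "lv n c = b / real n" for n by (simp add: lv_def b_def)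
  obtain x0 where x0: "0 < x0" "\<And>x. 0 < x \<Longrightarrow> x < x0 \<Longrightarrow> 7 / 8 * (x / a) ^ r \<le> F x \<and> F x \<le> 9 / 8 * (x / a) ^ r"
    using F_two_sided by blast
  have "(\<lambda>n. (8 * b / x0)\<^sup>2 / real n) \<longlonglongrightarrow> 0" by real_asymp
  then have evA: "\<forall>\<^sub>F n in sequentially. (8 * b / x0)\<^sup>2 / real n < \<eta>"
    using \<eta> by (intro order_tendstoD(2)) auto
  have "(\<lambda>n. 2 * (b / real n)) \<longlonglongrightarrow> 0" by real_asymp
  then have evB: "\<forall>\<^sub>F n in sequentially. 2 * (b / real n) < x0 / 2"
    using x0 by (intro order_tendstoD(2)) auto
  show ?thesis
    unfolding err_def b_def[symmetric]
    using evA evB F_lv_lt_1[OF less_imp_le[OF c0]] eventually_ge_at_top[of "4 * r"] eventually_gt_at_top[of 0]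
  proof eventually_elim
    case (elim n)
    interpret prob_space "M n" by (rule M)
    have n: "0 < real n" using elim by simp
    have lvp: "0 < lv n c" using b n by (simp add: lv)
    have lvx: "2 * lv n c \<le> x0 / 2" using elim by (simp add: lv)
    have lp: "0 < 2 * lv n c" using lvp by simp
    \<comment> \<open>The last dyadic level below \<open>x0 / 2\<close>. It is of constant order, so
      \<open>2 ^ J\<close> is of order \<open>n\<close>.\<close>
    obtain J where J: "y n J \<le> x0 / 2" "x0 / 2 < y n (Suc J)"
      using dyadic_level[OF lp lvx] unfolding y_def by blast
    define good where "good A \<longleftrightarrow> (1 - \<theta>) * real n \<le> real (card (big_comp n A))" for A
    define \<phi> where "\<phi> A B = of_bool (good A) * real (card (unattached n (big_comp n A) B))" for A B
    have ylt: "lv n c < y n j" for j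
    proof -
      have "lv n c < 2 * lv n c * 1" using lvp by simp
      also have "\<dots> \<le> 2 * lv n c * 2 ^ j" using lvp by (intro mult_left_mono) auto
      finally show ?thesis by (simp add: y_def)
    qed
    note ex = expectation_levels[OF indep finite_E D W_distr ylt \<open>F (lv n c) < 1\<close>]
    have int: "integrable (M n) (\<lambda>\<omega>. \<phi> (G n (lv n c) \<omega>) (G n (y n j) \<omega>))" for j
      by (rule ex(1))
    have Eb: "expectation (\<lambda>\<omega>. \<phi> (G n (lv n c) \<omega>) (G n (y n j) \<omega>)) \<le> \<theta> * real n * (2 / 4 ^ Suc j)"
      if j: "j \<le> J" for j
    proof -
      define q where "q = cond_p (lv n c) (y n j)"
      have q01: "0 \<le> q" "q \<le> 1" unfolding q_def using ylt[of j] elim by (auto intro!: cond_p_bounds)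
      have yj: "0 < y n j" "y n j < x0"
      proof -
        show "0 < y n j" using lvp by (simp add: y_def)
        have "y n j \<le> y n J" unfolding y_def using lvp j by (intro mult_left_mono power_increasing) auto
        then show "y n j < x0" using J(1) x0(1) by linarith
      qed
      have lvx0: "lv n c < x0" using ylt[of j] yj by linarith
      have P: "(lv n c / a) ^ r = fact r * c / real n ^ r" by (rule lv_power) (use c0 in simp)
      have P0: "0 \<le> (lv n c / a) ^ r" using lvp a by simp
      have "2 ^ Suc j * (lv n c / a) ^ r \<le> (2 ^ Suc j) ^ r * (lv n c / a) ^ r"
      proof (rule mult_right_mono[OF _ P0])
        have "(1::real) \<le> 2 ^ Suc j" by (rule one_le_power) simp
        then have "(2 ^ Suc j :: real) ^ 1 \<le> (2 ^ Suc j) ^ r" using r by (intro power_increasing) auto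
        then show "(2 ^ Suc j :: real) \<le> (2 ^ Suc j) ^ r" by simp
      qed
      also have "\<dots> = (y n j / a) ^ r" by (simp add: y_def power_mult_distrib power_divide mult_ac)
      finally have yr: "2 ^ Suc j * (lv n c / a) ^ r \<le> (y n j / a) ^ r" .
      have two: "(1::real) \<le> 2 ^ j" by simp
      have "2 ^ Suc j / 4 * (lv n c / a) ^ r \<le> (7 / 8 * 2 ^ Suc j - 9 / 8) * (lv n c / a) ^ r"
      proof (rule mult_right_mono[OF _ P0])
        have "(2::real) ^ Suc j = 2 * 2 ^ j" by simp
        then show "(2::real) ^ Suc j / 4 \<le> 7 / 8 * 2 ^ Suc j - 9 / 8" using two by linarith
      qed
      also have "\<dots> \<le> 7 / 8 * (y n j / a) ^ r - 9 / 8 * (lv n c / a) ^ r"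
        using yr by (simp add: left_diff_distrib)
      also have "\<dots> \<le> F (y n j) - F (lv n c)" using x0(2)[OF yj] x0(2)[OF lvp lvx0] by linarith
      also have "\<dots> \<le> q"
      proof -
        have "0 \<le> F (y n j) - F (lv n c)"
          using q01(1) elim unfolding q_def cond_p_def by (simp add: zero_le_divide_iff)
        moreover have "0 < 1 - F (lv n c)" "1 - F (lv n c) \<le> 1" using elim F_bounds by auto
        ultimately have "(F (y n j) - F (lv n c)) / 1 \<le> (F (y n j) - F (lv n c)) / (1 - F (lv n c))"
          by (intro divide_left_mono) auto
        then show ?thesis by (simp add: q_def cond_p_def)
      qed
      finally have ql: "2 ^ Suc j / 4 * (lv n c / a) ^ r \<le> q" .
      \<comment> \<open>The assumption on \<open>c\<close> pays for the factor \<open>4 ^ r\<close>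
        lost by having only \<open>n / 4\<close> in the count of candidates, and for the 4 lost in
        \<open>ql\<close>.\<close>
      have "2 ^ Suc j \<le> 2 ^ Suc j * (c / 4 ^ Suc r)"
        using c by (simp add: le_divide_eq)
      also have "\<dots> = 2 ^ Suc j / 4 * (lv n c / a) ^ r * ((real n / 4) ^ r / fact r)"
        unfolding P using n by (simp add: power_divide field_simps)
      also have "\<dots> \<le> q * ((real n / 4) ^ r / fact r)" using ql n by (intro mult_right_mono) auto
      finally have Kq: "2 ^ Suc j \<le> q * (real n / 4) ^ r / fact r" by simp
      have "expectation (\<lambda>\<omega>. \<phi> (G n (lv n c) \<omega>) (G n (y n j) \<omega>))
          = bexp (F (lv n c)) (E n) (\<lambda>A. bexp q (E n) (\<lambda>B. \<phi> A (A \<union> B)))"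
        unfolding q_def cond_p_def by (rule ex(2))
      also have "\<dots> \<le> \<theta> * real n * (2 / 4 ^ Suc j)"
      proof (rule bexp_le_const[OF finite_E F_bounds])
        fix A assume A: "A \<subseteq> E n"
        let ?S = "big_comp n A"
        have S: "?S \<subseteq> {..<n}" using big_comp_props(1)[OF _ A] elim by simp
        show "bexp q (E n) (\<lambda>B. \<phi> A (A \<union> B)) \<le> \<theta> * real n * (2 / 4 ^ Suc j)"
        proof (cases "good A")
          case False
          then show ?thesis using finite_E \<theta> by (simp add: \<phi>_def)
        next
          case True
          have "card ({..<n} - ?S) = n - card ?S" using S finite_subset[OF S] by (subst card_Diff_subset) auto
          moreover have "card ?S \<le> n" using card_mono[OF _ S] by simp
          ultimately have out: "real (card ({..<n} - ?S)) \<le> \<theta> * real n"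
            using True by (simp add: good_def of_nat_diff algebra_simps)
          have "real n / 2 \<le> (1 - \<theta>) * real n"
            using mult_right_mono[of "1 / 2" "1 - \<theta>" "real n"] \<theta> by simp
          then have half: "real n \<le> 2 * real (card ?S)" using True unfolding good_def by linarith
          have "bexp q (E n) (\<lambda>B. \<phi> A (A \<union> B)) = bexp q (E n) (\<lambda>B. real (card (unattached n ?S (A \<union> B))))"
            using True by (simp add: \<phi>_def)
          also have "\<dots> \<le> real (card ({..<n} - ?S)) * exp (- (2 ^ Suc j))"
            using elim by (intro unattached_expectation[OF A S half _ _ q01 Kq]) auto
          also have "\<dots> \<le> \<theta> * real n * (2 / 4 ^ Suc j)"
            using out \<theta> exp_neg_pow2_le[of "Suc j"] by (intro mult_mono) auto
          finally show ?thesis .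
        qed
      qed
      finally show ?thesis .
    qed
    \<comment> \<open>Markov's inequality is applied to this sum: if \<open>f \<omega> < 1\<close>
      and the component is large, the total weight is below \<open>\<tau>\<close> and, the last term
      being an integer, no vertex is unattached at \<open>J\<close>.\<close>
    define f where "f \<omega> = (\<Sum>j<J. y n (Suc j) / \<tau> * \<phi> (G n (lv n c) \<omega>) (G n (y n j) \<omega>)) + \<phi> (G n (lv n c) \<omega>) (G n (y n J) \<omega>)" for \<omega>
    have y0: "0 \<le> y n j" for j using lvp by (simp add: y_def)
    have fint: "integrable (M n) f"
      unfolding f_def using int by (intro Bochner_Integration.integrable_add Bochner_Integration.integrable_sum) auto
    have f0: "0 \<le> f \<omega>" for \<omega>
      unfolding f_def \<phi>_def using y0 \<tau> by (intro add_nonneg_nonneg sum_nonneg mult_nonneg_nonneg divide_nonneg_nonneg) auto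
    have "expectation f = (\<Sum>j<J. y n (Suc j) / \<tau> * expectation (\<lambda>\<omega>. \<phi> (G n (lv n c) \<omega>) (G n (y n j) \<omega>)))
        + expectation (\<lambda>\<omega>. \<phi> (G n (lv n c) \<omega>) (G n (y n J) \<omega>))"
      unfolding f_def using int by (subst Bochner_Integration.integral_add) (auto intro!: Bochner_Integration.integral_sum)
    also have "\<dots> \<le> (\<Sum>j<J. y n (Suc j) / \<tau> * (\<theta> * real n * (2 / 4 ^ Suc j))) + \<theta> * real n * (2 / 4 ^ Suc J)"
      using Eb y0 \<tau> by (intro add_mono sum_mono mult_left_mono) auto
    also have "(\<Sum>j<J. y n (Suc j) / \<tau> * (\<theta> * real n * (2 / 4 ^ Suc j))) = (2 * lv n c * real n * \<theta> / \<tau>) * (\<Sum>j<J. (1 / 2) ^ j)"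
    proof -
      have "y n (Suc j) / \<tau> * (\<theta> * real n * (2 / 4 ^ Suc j)) = 2 * lv n c * real n * \<theta> / \<tau> * (1 / 2) ^ j" for j
      proof -
        have "(4::real) ^ j = 2 ^ j * 2 ^ j" by (simp add: power_mult_distrib[symmetric])
        then show ?thesis using \<tau> by (simp add: y_def power_divide field_simps)
      qed
      then show ?thesis by (simp add: sum_distrib_left)
    qed
    also have "\<dots> \<le> (2 * lv n c * real n * \<theta> / \<tau>) * 2"
    proof (rule mult_left_mono)
      have "(\<Sum>j<J. (1 / 2 :: real) ^ j) = 2 * (1 - (1 / 2) ^ J)" by (induction J) auto
      then show "(\<Sum>j<J. (1 / 2 :: real) ^ j) \<le> 2" by simp
    qed (use lvp n \<theta> \<tau> in auto)
    also have "(2 * lv n c * real n * \<theta> / \<tau>) * 2 = 4 * b * \<theta> / \<tau>" using n by (simp add: lv)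
    \<comment> \<open>Since \<open>4 ^ J\<close> is of the order of the square of \<open>n\<close>,
      the expected number of vertices unattached at \<open>J\<close> is of order
      \<open>1 / n\<close>.\<close>
    also have "\<theta> * real n * (2 / 4 ^ Suc J) \<le> \<eta>"
    proof -
      have "x0 * real n / (8 * b) \<le> 2 ^ J"
        using J(2) b n by (simp add: y_def lv field_simps)
      then have "(x0 * real n / (8 * b))\<^sup>2 \<le> (2 ^ J)\<^sup>2" using x0 n b by (intro power_mono) auto
      moreover have "((2::real) ^ J)\<^sup>2 = 4 ^ J" by (simp add: power2_eq_square power_mult_distrib[symmetric])
      ultimately have "(x0 * real n / (8 * b))\<^sup>2 \<le> 4 ^ J" by simp
      then have "1 / 4 ^ J \<le> 1 / (x0 * real n / (8 * b))\<^sup>2"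
        using x0 n b by (intro divide_left_mono) auto
      also have "\<dots> = (8 * b / x0)\<^sup>2 / (real n)\<^sup>2" using x0 n b by (simp add: power_divide power_mult_distrib)
      finally have "real n * (1 / 4 ^ J) \<le> real n * ((8 * b / x0)\<^sup>2 / (real n)\<^sup>2)" by (intro mult_left_mono) auto
      also have "\<dots> = (8 * b / x0)\<^sup>2 / real n" using n by (simp add: power2_eq_square)
      finally have "real n * (1 / 4 ^ J) \<le> \<eta>" using elim by linarith
      moreover have "\<theta> * real n * (2 / 4 ^ Suc J) \<le> 1 * real n * (1 / 4 ^ J)"
        using \<theta> n by (intro mult_mono) (auto simp: divide_simps)
      ultimately show ?thesis by simp
    qed
    finally have Ef: "expectation f \<le> 4 * b * \<theta> / \<tau> + \<eta>" by simp
    have meas: "{\<omega> \<in> space (M n). 1 \<le> f \<omega>} \<in> sets (M n)"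
      using fint by measurable
    have "measure (M n) {\<omega> \<in> space (M n). 1 \<le> f \<omega>} \<le> expectation f / 1"
      using fint f0 by (intro integral_Markov_inequality_measure[where A = "space (M n)"]) auto
    then have prob: "measure (M n) {\<omega> \<in> space (M n). 1 \<le> f \<omega>} \<le> 4 * b * \<theta> / \<tau> + \<eta>" using Ef by simp
    have sub: "1 \<le> f \<omega>"
      if g: "good (G n (lv n c) \<omega>)" and
        nJ: "\<nexists>J. unattached n (big_comp n (G n (lv n c) \<omega>)) (G n (y n J) \<omega>) = {} \<and>
        (\<Sum>j<J. y n (Suc j) * real (card (unattached n (big_comp n (G n (lv n c) \<omega>)) (G n (y n j) \<omega>)))) \<le> \<tau>" for \<omega>
    proof -
      let ?u = "\<lambda>j. unattached n (big_comp n (G n (lv n c) \<omega>)) (G n (y n j) \<omega>)"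
      have fin: "finite (?u j)" for j by (simp add: unattached_def)
      have f_eq: "f \<omega> = (\<Sum>j<J. y n (Suc j) * real (card (?u j))) / \<tau> + real (card (?u J))"
        using g by (simp add: f_def \<phi>_def sum_divide_distrib)
      have s0: "0 \<le> (\<Sum>j<J. y n (Suc j) * real (card (?u j)))" using y0 by (intro sum_nonneg) auto
      show ?thesis
      proof (cases "?u J = {}")
        case False
        then have "1 \<le> real (card (?u J))" using fin[of J] by (simp add: Suc_le_eq card_gt_0_iff)
        then show ?thesis unfolding f_eq using s0 \<tau> by (simp add: add_increasing)
      next
        case True
        then have "\<tau> < (\<Sum>j<J. y n (Suc j) * real (card (?u j)))" using nJ by force
        then have "1 \<le> (\<Sum>j<J. y n (Suc j) * real (card (?u j))) / \<tau>" using \<tau> by (simp add: le_divide_eq)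
        then show ?thesis unfolding f_eq by simp
      qed
    qed
    show ?case
      by (intro bexI[OF _ meas] conjI prob subsetI) (use sub in \<open>auto simp: good_def\<close>)
  qed
qed

end

lemma power_diff_le:
  fixes u v :: real
  assumes "0 \<le> v" "v \<le> u" "u \<le> 1"
  shows "u ^ k - v ^ k \<le> real k * (u - v)"
proof (induction k)
  case (Suc k)
  have "u ^ Suc k - v ^ Suc k = u * (u ^ k - v ^ k) + (u - v) * v ^ k" by (simp add: algebra_simps)
  also have "\<dots> \<le> 1 * (u ^ k - v ^ k) + (u - v) * 1"
    using assms by (intro add_mono mult_right_mono mult_left_mono) (auto intro!: power_mono power_le_one)
  also have "\<dots> \<le> real k * (u - v) + (u - v)" using Suc by simp
  finally show ?case by (simp add: algebra_simps)
qed simp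

context random_weights
begin

text \<open>The parameters are chosen in the order \<open>C\<close>, \<open>k\<close>,
  \<open>\<delta>\<close>: a last mean degree that makes the tail cheap, a mesh width
  \<open>1 / k\<close> for the Riemann error, and a tolerance small against \<open>P\<close> and
  \<open>Q\<close>, the second of which depends on the mesh. The Riemann error and the tolerance
  cost \<open>\<epsilon> / 4\<close> each, the two tail terms \<open>\<epsilon> / 8\<close>
  each.\<close>

lemma err_upper:
  assumes \<epsilon>: "0 < \<epsilon>" and \<eta>: "0 < \<eta>"
  shows "err (\<lambda>n \<omega>. mst_weight {..<n} (E n) (\<lambda>e. W n e \<omega>) < a * U_const (Suc r) + \<epsilon>) \<eta>"
proof -
  define s where "s = 1 / real r"
  have s: "0 < s" using r by (simp add: s_def)
  define b where "b = a * \<rho>"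
  have b: "0 < b" using a \<rho> by (simp add: b_def)
  have lv: "lv n c * real n = b * c powr s" if "0 < n" for n c
    using that by (simp add: lv_def b_def s_def)
  define \<tau> where "\<tau> = \<epsilon> / 8"
  have \<tau>: "0 < \<tau>" using \<epsilon> by (simp add: \<tau>_def)
  \<comment> \<open>Bounds \<open>P * \<theta>\<close> for two purposes: the first entry limits the
    cost \<open>2 * P * \<theta>\<close> of the first attaching level to
    \<open>\<epsilon> / 8\<close>, the second the failure probability
    \<open>4 * P * \<theta> / \<tau>\<close> of the tail to \<open>\<eta> / 2\<close>.\<close>
  define \<epsilon>1 where "\<epsilon>1 = min (\<epsilon> / 16) (\<eta> * \<tau> / 8)"
  have \<epsilon>1: "0 < \<epsilon>1" using \<epsilon> \<eta> \<tau> by (simp add: \<epsilon>1_def)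
  have "\<forall>\<^sub>F C in sequentially. b * real C powr s * exp (- (real C - 1) / 2) < \<epsilon>1 / 2 \<and>
      exp (- (real C - 1) / 2) < 1 / 4 \<and> 4 ^ Suc r \<le> real C \<and> 3 \<le> real C"
  proof (intro eventually_conj)
    have "(\<lambda>C. b * real C powr s * exp (- (real C - 1) / 2)) \<longlonglongrightarrow> 0" using b s by real_asymp
    then show "\<forall>\<^sub>F C in sequentially. b * real C powr s * exp (- (real C - 1) / 2) < \<epsilon>1 / 2"
      using \<epsilon>1 by (intro order_tendstoD(2)) auto
    have "(\<lambda>C. exp (- (real C - 1) / 2)) \<longlonglongrightarrow> 0" by real_asymp
    then show "\<forall>\<^sub>F C in sequentially. exp (- (real C - 1) / 2) < 1 / 4"
      by (intro order_tendstoD(2)) auto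
    show "\<forall>\<^sub>F C in sequentially. 4 ^ Suc r \<le> real C" by real_asymp
    show "\<forall>\<^sub>F C in sequentially. 3 \<le> real C" by real_asymp
  qed
  then obtain C :: nat where C: "b * real C powr s * exp (- (real C - 1) / 2) < \<epsilon>1 / 2"
      "exp (- (real C - 1) / 2) < 1 / 4" "4 ^ Suc r \<le> real C" "3 \<le> real C"
    using eventually_happens'[OF sequentially_bot] by blast
  define U where "U = U_const (Suc r)"
  have "(\<lambda>k. a * ((1 + 3 * (1 / real k) * real r) powr (1 + s) * U)) \<longlonglongrightarrow> a * ((1 + 3 * 0 * real r) powr (1 + s) * U)"
    by (intro tendsto_intros lim_1_over_n) auto
  then have "(\<lambda>k. a * ((1 + 3 * (1 / real k) * real r) powr (1 + s) * U)) \<longlonglongrightarrow> a * U" by simp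
  then have "\<forall>\<^sub>F k in sequentially. a * ((1 + 3 * (1 / real k) * real r) powr (1 + s) * U) < a * U + \<epsilon> / 4"
    using \<epsilon> by (intro order_tendstoD(2)) auto
  then have "\<forall>\<^sub>F k in sequentially. a * ((1 + 3 * (1 / real k) * real r) powr (1 + s) * U) < a * U + \<epsilon> / 4 \<and> 1 \<le> k"
    using eventually_ge_at_top[of 1] by eventually_elim simp
  then obtain k :: nat where k: "a * ((1 + 3 * (1 / real k) * real r) powr (1 + s) * U) < a * U + \<epsilon> / 4" "1 \<le> k"
    using eventually_happens'[OF sequentially_bot] by blast
  define \<Delta> where "\<Delta> = 1 / real k"
  have \<Delta>: "0 < \<Delta>" "\<Delta> \<le> 1" using k by (auto simp: \<Delta>_def)
  define m where "m = k * C"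
  have m\<Delta>: "real m * \<Delta> = real C" using k by (simp add: m_def \<Delta>_def)
  define Q where "Q = (\<Sum>i<m. b * (real (Suc i) * \<Delta>) powr s * (\<Delta> + 1))"
  have Q: "0 \<le> Q" unfolding Q_def using b \<Delta> by (intro sum_nonneg) auto
  define P where "P = b * real C powr s"
  have P: "0 \<le> P" using b by (simp add: P_def)
  have pos: "0 < \<epsilon> / (4 * (Q + 1))" "0 < \<epsilon>1 / (2 * (P + 1))" using \<epsilon> \<epsilon>1 Q P by auto
  define \<delta> where "\<delta> = min (1 / 4) (min (\<epsilon> / (4 * (Q + 1))) (\<epsilon>1 / (2 * (P + 1))))"
  have \<delta>: "0 < \<delta>" "\<delta> \<le> 1 / 4" "\<delta> \<le> \<epsilon> / (4 * (Q + 1))" "\<delta> \<le> \<epsilon>1 / (2 * (P + 1))"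
    using pos unfolding \<delta>_def by linarith+
  have "\<delta> * (Q + 1) \<le> \<epsilon> / 4" using \<delta>(3) Q by (simp add: le_divide_eq mult_ac)
  then have Q\<delta>: "Q * \<delta> \<le> \<epsilon> / 4" using \<delta>(1) by (simp add: algebra_simps)
  have "\<delta> * (P + 1) \<le> \<epsilon>1 / 2" using \<delta>(4) P by (simp add: le_divide_eq mult_ac)
  then have P\<delta>: "P * \<delta> \<le> \<epsilon>1 / 2" using \<delta>(1) by (simp add: algebra_simps)
  \<comment> \<open>The proportion left outside at the last level: the exponential from
    \<open>giant_frac_lower\<close>, with \<open>\<Delta> \<le> 1\<close> for the sprinkling, plus
    the tolerance.\<close>
  define \<theta> where "\<theta> = exp (- (real C - 1) / 2) + \<delta>"
  have \<theta>: "0 \<le> \<theta>" "\<theta> \<le> 1 / 2" using C(2) \<delta> by (auto simp: \<theta>_def add_nonneg_nonneg)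
  have P\<theta>: "P * \<theta> \<le> \<epsilon>1" using C(1) P\<delta> by (simp add: \<theta>_def P_def algebra_simps)
  define X where "X i = giant_frac (Suc r) ((real i - 1) * \<Delta>)" for i :: nat
  define \<xi> where "\<xi> i = max 0 (X i - \<delta>)" for i
  have X: "0 \<le> X i" "X i \<le> 1" for i using giant_frac_bounds by (auto simp: X_def)
  have \<xi>: "0 \<le> \<xi> i" "\<xi> i \<le> 1" "\<xi> i \<le> X i" "X i - \<xi> i \<le> \<delta>" for i
    using X[of i] \<delta>(1) by (auto simp: \<xi>_def)
  define c where "c i = real i * \<Delta>" for i :: nat
  have c: "0 \<le> c i" "c i < c (Suc i)" "c (Suc i) - c i = \<Delta>" for i
    using \<Delta> by (auto simp: c_def algebra_simps)
  have cm: "c m = real C" by (simp add: c_def m\<Delta>)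
  have \<xi>m: "1 - \<theta> \<le> \<xi> m"
  proof -
    have e: "(real m - 1) * \<Delta> = real C - \<Delta>" using m\<Delta> by (simp add: algebra_simps)
    have "1 - exp (- (real C - \<Delta>) / 2) \<le> X m"
      unfolding X_def e using r C(4) \<Delta> by (intro giant_frac_lower) auto
    moreover have "exp (- (real C - \<Delta>) / 2) \<le> exp (- (real C - 1) / 2)" using \<Delta> by simp
    ultimately have "1 - \<theta> \<le> X m - \<delta>" unfolding \<theta>_def by linarith
    then show ?thesis by (simp add: \<xi>_def)
  qed
  define S where "S n i \<omega> = big_comp n (G n (lv n (c i)) \<omega>)" for n i \<omega>
  let ?giants = "\<lambda>n \<omega>. \<forall>i\<in>{..m}. \<xi> i * real n \<le> real (card (S n i \<omega>))"
  have giants: "whp (\<lambda>n \<omega>. ?giants n \<omega>)"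
  proof (rule whp_all)
    fix i
    show "whp (\<lambda>n \<omega>. \<xi> i * real n \<le> real (card (S n i \<omega>)))"
    proof (cases "\<xi> i = 0")
      case True
      then show ?thesis by (intro whp_True) simp
    next
      case False
      \<comment> \<open>Index 0 would use mean degree \<open>- \<Delta>\<close>, below all values of
        \<open>cfun\<close>; there \<open>giant_frac\<close> and hence \<open>\<xi> 0\<close> are
        0.\<close>
      have "i \<noteq> 0"
      proof
        assume "i = 0"
        have empty: "{x. 0 < x \<and> x < 1 \<and> cfun (Suc r) x < - \<Delta>} = {}"
          using cfun_pos[of "Suc r"] r \<Delta> by force
        have "giant_frac (Suc r) (- \<Delta>) = 0" unfolding giant_frac_def empty by simp
        then have "X i = 0" by (simp add: X_def \<open>i = 0\<close>)
        then show False using False \<delta>(1) by (simp add: \<xi>_def)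
      qed
      then have i1: "0 \<le> (real i - 1) * \<Delta>" "(real i - 1) * \<Delta> < c i"
        using \<Delta> by (auto simp: c_def algebra_simps)
      from whp_giant[OF i1 \<delta>(1)] show ?thesis
        using False by (simp add: S_def \<xi>_def X_def max_def split: if_splits)
    qed
  qed simp
  let ?windows = "\<lambda>n \<omega>. \<forall>i\<in>{..<m}. \<xi> i * real n \<le> real (card (S n i \<omega>)) \<longrightarrow>
      real (card {e \<in> G n (lv n (c (Suc i))) \<omega> - G n (lv n (c i)) \<omega>. \<not> e \<subseteq> S n i \<omega>})
        \<le> (\<Delta> * ((1 - \<xi> i ^ Suc r) / real (Suc r)) + \<delta>) * real n"
  have windows: "whp (\<lambda>n \<omega>. ?windows n \<omega>)"
  proof (rule whp_all)
    fix i
    show "whp (\<lambda>n \<omega>. \<xi> i * real n \<le> real (card (S n i \<omega>)) \<longrightarrow>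
     real (card {e \<in> G n (lv n (c (Suc i))) \<omega> - G n (lv n (c i)) \<omega>. \<not> e \<subseteq> S n i \<omega>})
       \<le> (\<Delta> * ((1 - \<xi> i ^ Suc r) / real (Suc r)) + \<delta>) * real n)"
      using whp_window[OF c(1)[of i] c(2)[of i] \<xi>(1)[of i] \<xi>(2)[of i] \<delta>(1)]
      unfolding S_def c(3) .
  qed simp
  define y where "y n j = 2 * lv n (c m) * 2 ^ j" for n :: nat and j :: nat
  let ?tail = "\<lambda>n \<omega>. (1 - \<theta>) * real n \<le> real (card (S n m \<omega>)) \<longrightarrow>
      (\<exists>J. unattached n (S n m \<omega>) (G n (y n J) \<omega>) = {} \<and>
        (\<Sum>j<J. y n (Suc j) * real (card (unattached n (S n m \<omega>) (G n (y n j) \<omega>)))) \<le> \<tau>)"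
  have tail: "err (\<lambda>n \<omega>. ?tail n \<omega>)
    (4 * (a * \<rho> * c m powr (1 / real r)) * \<theta> / \<tau> + \<eta> / 4)"
    using err_tail[OF _ \<theta> \<tau>, of "c m" "\<eta> / 4"] C(3) \<eta> unfolding S_def y_def cm by simp
  have tail_prob: "4 * (a * \<rho> * c m powr (1 / real r)) * \<theta> / \<tau> + \<eta> / 4 \<le> 3 * \<eta> / 4"
  proof -
    have "4 * (P * \<theta>) \<le> 4 * (\<eta> * \<tau> / 8)" using P\<theta> by (simp add: \<epsilon>1_def)
    then have P4: "4 * (P * \<theta>) / \<tau> \<le> \<eta> / 2" using \<tau> by (simp add: divide_le_eq)
    have eq: "4 * (a * \<rho> * c m powr (1 / real r)) * \<theta> = 4 * (P * \<theta>)"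
      by (simp add: P_def b_def s_def cm)
    show ?thesis unfolding eq using P4 by linarith
  qed
  have "err (\<lambda>n \<omega>. (((\<forall>e\<in>E n. 0 < W n e \<omega>) \<and> (?giants n \<omega>)) \<and>
      (?windows n \<omega>)) \<and>
      (?tail n \<omega>))
      (\<eta> / 4 + (4 * (a * \<rho> * c m powr (1 / real r)) * \<theta> / \<tau> + \<eta> / 4))"
    using whp_conj[OF whp_conj[OF whp_positive giants] windows] \<eta> unfolding whp_def
    by (intro err_conj[OF _ tail]) auto
  then show ?thesis
  proof (rule err_mono)
    show "\<eta> / 4 + (4 * (a * \<rho> * c m powr (1 / real r)) * \<theta> / \<tau> + \<eta> / 4) \<le> \<eta>" using tail_prob by simp
    show "\<forall>\<^sub>F n in sequentially. \<forall>\<omega>\<in>space (M n). (((\<forall>e\<in>E n. 0 < W n e \<omega>) \<and>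
        (?giants n \<omega>)) \<and>
      (?windows n \<omega>)) \<and>
      (?tail n \<omega>) \<longrightarrow>
      mst_weight {..<n} (E n) (\<lambda>e. W n e \<omega>) < a * U_const (Suc r) + \<epsilon>"
      using eventually_gt_at_top[of 0]
    proof eventually_elim
      case (elim n)
      show ?case
      proof (intro ballI impI, elim conjE)
        fix \<omega>
        assume pos: "\<forall>e\<in>E n. 0 < W n e \<omega>" and
          gi: "?giants n \<omega>" and
          wi: "?windows n \<omega>" and
          ta: "?tail n \<omega>"
        have Sp: "S n i \<omega> \<subseteq> {..<n}" "S n i \<omega> \<times> S n i \<omega> \<subseteq> reach (G n (lv n (c i)) \<omega>)" "S n i \<omega> \<noteq> {}" for i
          unfolding S_def by (rule big_comp_props(1-3)[OF elim level_subset])+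
        have Sm: "(1 - \<theta>) * real n \<le> real (card (S n m \<omega>))"
          using mult_right_mono[OF \<xi>m, of "real n"] bspec[OF gi, of m] by simp
        with ta obtain J where J: "unattached n (S n m \<omega>) (G n (y n J) \<omega>) = {}"
          "(\<Sum>j<J. y n (Suc j) * real (card (unattached n (S n m \<omega>) (G n (y n j) \<omega>)))) \<le> \<tau>" by blast
        have lev: "{e \<in> E n. W n e \<omega> \<le> z} = G n z \<omega>" for z by (simp add: level_def)
        have un: "{v \<in> {..<n} - S n m \<omega>. \<forall>e\<in>G n z \<omega>. v \<in> e \<longrightarrow> \<not> e - {v} \<subseteq> S n m \<omega>}
            = unattached n (S n m \<omega>) (G n z \<omega>)" for z by (simp add: unattached_def)
        have "mst_weight {..<n} (E n) (\<lambda>e. W n e \<omega>)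
          \<le> (\<Sum>i<m. lv n (c (Suc i)) * real (card {e \<in> G n (lv n (c (Suc i))) \<omega> - G n (lv n (c i)) \<omega>. \<not> e \<subseteq> S n i \<omega>}))
            + (y n 0 * real (card ({..<n} - S n m \<omega>))
              + (\<Sum>j<J. y n (Suc j) * real (card (unattached n (S n m \<omega>) (G n (y n j) \<omega>)))))"
        proof (rule mst_weight_upper[where V = "{..<n}" and r = r and w = "\<lambda>e. W n e \<omega>" and x = "\<lambda>i. lv n (c i)"
            and y = "y n" and m = m and S = "\<lambda>i. S n i \<omega>" and J = J, unfolded lev un])
          show "finite {..<n}" by simp
          show "0 < r" by (rule r)
          show "0 \<le> W n e \<omega>" if "e \<in> E n" for e using pos that by (simp add: less_imp_le)
          show "G n (lv n (c 0)) \<omega> = {}" using pos by (auto simp: level_def c_def lv_0 not_le)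
          show "lv n (c i) \<le> lv n (c (Suc i))" for i using c(1,2)[of i] by (intro lv_mono) auto
          show "0 \<le> lv n (c i)" for i by (rule lv_nonneg)
          show "0 \<le> y n i" for i using lv_nonneg by (simp add: y_def)
          show "S n i \<omega> \<subseteq> {..<n} \<and> S n i \<omega> \<times> S n i \<omega> \<subseteq> reach (G n (lv n (c i)) \<omega>)" for i using Sp(1,2) by blast
          show "S n m \<omega> \<noteq> {}" by (rule Sp(3))
          show "unattached n (S n m \<omega>) (G n (y n J) \<omega>) = {}" by (rule J(1))
        qed
        also have "(\<Sum>i<m. lv n (c (Suc i)) * real (card {e \<in> G n (lv n (c (Suc i))) \<omega> - G n (lv n (c i)) \<omega>. \<not> e \<subseteq> S n i \<omega>}))
            \<le> (\<Sum>i<m. b * c (Suc i) powr s * \<Delta> * ((1 - X i ^ Suc r) / real (Suc r)) + b * c (Suc i) powr s * (\<Delta> + 1) * \<delta>)"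
        proof (rule sum_mono)
          fix i assume i: "i \<in> {..<m}"
          have "real (card {e \<in> G n (lv n (c (Suc i))) \<omega> - G n (lv n (c i)) \<omega>. \<not> e \<subseteq> S n i \<omega>})
              \<le> (\<Delta> * ((1 - \<xi> i ^ Suc r) / real (Suc r)) + \<delta>) * real n"
            using bspec[OF wi i] bspec[OF gi, of i] i by simp
          then have "lv n (c (Suc i)) * real (card {e \<in> G n (lv n (c (Suc i))) \<omega> - G n (lv n (c i)) \<omega>. \<not> e \<subseteq> S n i \<omega>})
              \<le> lv n (c (Suc i)) * ((\<Delta> * ((1 - \<xi> i ^ Suc r) / real (Suc r)) + \<delta>) * real n)"
            by (intro mult_left_mono lv_nonneg)
          also have "\<dots> = (lv n (c (Suc i)) * real n) * (\<Delta> * ((1 - \<xi> i ^ Suc r) / real (Suc r)) + \<delta>)"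
            by (simp only: mult_ac)
          also have "\<dots> = b * c (Suc i) powr s * (\<Delta> * ((1 - \<xi> i ^ Suc r) / real (Suc r)) + \<delta>)"
            by (simp only: lv[OF elim])
          also have "\<dots> \<le> b * c (Suc i) powr s * (\<Delta> * ((1 - X i ^ Suc r) / real (Suc r) + \<delta>) + \<delta>)"
          proof -
            have "X i ^ Suc r - \<xi> i ^ Suc r \<le> real (Suc r) * (X i - \<xi> i)"
              using X \<xi> by (intro power_diff_le) auto
            also have "\<dots> \<le> real (Suc r) * \<delta>" using \<xi>(4) by (intro mult_left_mono) auto
            finally have "(1 - \<xi> i ^ Suc r) \<le> (1 - X i ^ Suc r) + \<delta> * real (Suc r)" by (simp add: mult.commute)
            then have "(1 - \<xi> i ^ Suc r) / real (Suc r) \<le> ((1 - X i ^ Suc r) + \<delta> * real (Suc r)) / real (Suc r)"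
              by (intro divide_right_mono) auto
            also have "\<dots> = (1 - X i ^ Suc r) / real (Suc r) + \<delta>"
              by (simp add: add_divide_distrib del: of_nat_Suc power_Suc)
            finally show ?thesis using b \<Delta> by (intro mult_left_mono add_mono) auto
          qed
          finally show "lv n (c (Suc i)) * real (card {e \<in> G n (lv n (c (Suc i))) \<omega> - G n (lv n (c i)) \<omega>. \<not> e \<subseteq> S n i \<omega>})
              \<le> b * c (Suc i) powr s * \<Delta> * ((1 - X i ^ Suc r) / real (Suc r)) + b * c (Suc i) powr s * (\<Delta> + 1) * \<delta>"
            by (simp add: distrib_left distrib_right mult_ac del: of_nat_Suc power_Suc)
        qed
        also have "\<dots> = a * (\<rho> * (\<Sum>i<m. c (Suc i) powr s * \<Delta> * ((1 - X i ^ Suc r) / real (Suc r)))) + Q * \<delta>"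
          unfolding sum.distrib Q_def sum_distrib_right sum_distrib_left c_def b_def
          by (intro arg_cong2[where f = "(+)"] sum.cong refl) (simp_all only: mult_ac)
        also have "\<dots> \<le> a * ((1 + 3 * \<Delta> * real r) powr (1 + s) * U) + \<epsilon> / 4"
        proof (intro add_mono mult_left_mono Q\<delta>)
          have "2 \<le> Suc r" using r by simp
          from U_const_sum[OF this \<Delta>(1), of m]
          show "\<rho> * (\<Sum>i<m. c (Suc i) powr s * \<Delta> * ((1 - X i ^ Suc r) / real (Suc r)))
              \<le> (1 + 3 * \<Delta> * real r) powr (1 + s) * U"
            by (simp only: diff_Suc_1 \<rho>_def c_def X_def s_def U_def)
        qed (use a in simp)
        also have "\<dots> \<le> a * U + \<epsilon> / 2" using k(1) by (simp add: \<Delta>_def)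
        also have "y n 0 * real (card ({..<n} - S n m \<omega>)) \<le> \<epsilon> / 8"
        proof -
          have "card ({..<n} - S n m \<omega>) = n - card (S n m \<omega>)"
            using Sp(1)[of m] finite_subset[OF Sp(1)[of m]] by (subst card_Diff_subset) auto
          moreover have "card (S n m \<omega>) \<le> n" using card_mono[OF _ Sp(1)[of m]] by simp
          ultimately have "real (card ({..<n} - S n m \<omega>)) \<le> \<theta> * real n"
            using Sm by (simp add: of_nat_diff algebra_simps)
          then have "y n 0 * real (card ({..<n} - S n m \<omega>)) \<le> 2 * lv n (c m) * (\<theta> * real n)"
            unfolding y_def using lv_nonneg by (simp add: mult_left_mono)
          also have "\<dots> = 2 * ((lv n (c m) * real n) * \<theta>)" by simp
          also have "\<dots> = 2 * (P * \<theta>)" by (simp only: lv[OF elim] P_def cm)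
          also have "\<dots> \<le> 2 * (\<epsilon> / 16)" using P\<theta> by (simp add: \<epsilon>1_def)
          finally show ?thesis by simp
        qed
        also note J(2)
        finally have "mst_weight {..<n} (E n) (\<lambda>e. W n e \<omega>) \<le> a * U + \<epsilon> / 2 + (\<epsilon> / 8 + \<tau>)" by simp
        then show "mst_weight {..<n} (E n) (\<lambda>e. W n e \<omega>) < a * U_const (Suc r) + \<epsilon>"
          using \<epsilon> by (simp add: \<tau>_def U_def)
      qed
    qed
  qed
qed

text \<open>Passes from outer probabilities to the probability in the conclusion: \<open>err\<close>
  supplies an exceptional set \<open>B\<close>, and comparing its complement with the event itself
  requires that event to be measurable.\<close>

lemma mst_measurable: "(\<lambda>\<omega>. mst_weight {..<n} (E n) (\<lambda>e. W n e \<omega>)) \<in> borel_measurable (M n)"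
proof -
  interpret prob_space "M n" by (rule M)
  let ?\<H> = "{H. H \<subseteq> E n \<and> hg_connected {..<n} H}"
  have "finite ?\<H>" using finite_E by simp
  moreover have "(\<lambda>\<omega>. \<Sum>e\<in>H. W n e \<omega>) \<in> borel_measurable (M n)" if "H \<in> ?\<H>" for H
  proof (rule borel_measurable_sum)
    fix e assume "e \<in> H"
    then have "e \<in> E n" using that by blast
    then show "W n e \<in> borel_measurable (M n)" using indep[of n] unfolding indep_vars_def by blast
  qed
  ultimately have "(\<lambda>\<omega>. Min ((\<lambda>H. \<Sum>e\<in>H. W n e \<omega>) ` ?\<H>)) \<in> borel_measurable (M n)"
    by (rule borel_measurable_Min)
  moreover have "{\<Sum>e\<in>H. W n e \<omega> | H. H \<subseteq> E n \<and> hg_connected {..<n} H} = (\<lambda>H. \<Sum>e\<in>H. W n e \<omega>) ` ?\<H>" for \<omega>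
    by auto
  ultimately show ?thesis by (simp add: mst_weight_def)
qed

lemma mst_concentration:
  assumes "0 < \<epsilon>"
  shows "(\<lambda>n. measure (M n) {\<omega> \<in> space (M n). mst_weight {..<n} (E n) (\<lambda>e. W n e \<omega>)
     \<in> {a * L_const (Suc r) - \<epsilon><..<a * U_const (Suc r) + \<epsilon>}}) \<longlonglongrightarrow> 1"
proof (rule LIMSEQ_I)
  fix \<eta> :: real assume \<eta>: "0 < \<eta>"
  let ?P = "\<lambda>n \<omega>. mst_weight {..<n} (E n) (\<lambda>e. W n e \<omega>) \<in> {a * L_const (Suc r) - \<epsilon><..<a * U_const (Suc r) + \<epsilon>}"
  have "err (\<lambda>n \<omega>. a * L_const (Suc r) - \<epsilon> < mst_weight {..<n} (E n) (\<lambda>e. W n e \<omega>) \<and>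
      mst_weight {..<n} (E n) (\<lambda>e. W n e \<omega>) < a * U_const (Suc r) + \<epsilon>) (\<eta> / 4 + \<eta> / 4)"
    using whp_lower[OF assms] err_upper[OF assms, of "\<eta> / 4"] \<eta> unfolding whp_def by (intro err_conj) auto
  then have "err ?P (\<eta> / 2)" by (rule err_mono) auto
  then have "\<forall>\<^sub>F n in sequentially. norm (measure (M n) {\<omega> \<in> space (M n). ?P n \<omega>} - 1) < \<eta>"
    unfolding err_def
  proof eventually_elim
    case (elim n)
    interpret prob_space "M n" by (rule M)
    obtain B where B: "B \<in> events" "{\<omega> \<in> space (M n). \<not> ?P n \<omega>} \<subseteq> B" "prob B \<le> \<eta> / 2" using elim by blast
    have ev: "{\<omega> \<in> space (M n). ?P n \<omega>} \<in> events"
      using mst_measurable[of n] by measurable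
    have "1 - prob B = prob (space (M n) - B)" using prob_compl[OF B(1)] by simp
    also have "\<dots> \<le> prob {\<omega> \<in> space (M n). ?P n \<omega>}"
      using B(2) by (intro finite_measure_mono ev) blast
    finally have "1 - \<eta> / 2 \<le> prob {\<omega> \<in> space (M n). ?P n \<omega>}" using B(3) by linarith
    then show ?case using prob_le_1[of "{\<omega> \<in> space (M n). ?P n \<omega>}"] \<eta> by simp
  qed
  then show "\<exists>no. \<forall>n\<ge>no. norm (measure (M n) {\<omega> \<in> space (M n). ?P n \<omega>} - 1) < \<eta>"
    by (simp add: eventually_sequentially)
qed

end

theorem theorem1p2:
  fixes t :: nat and a :: real
    and N :: "'a measure" and X :: "'a \<Rightarrow> real"
    and M :: "nat \<Rightarrow> 'b measure" and W :: "nat \<Rightarrow> nat set \<Rightarrow> 'b \<Rightarrow> real"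
  shows
    "(2 \<le> t \<and>
      prob_space N \<and> X \<in> borel_measurable N \<and> (AE \<omega> in N. 0 < X \<omega>) \<and>
      0 < a \<and>
      ((\<lambda>x. x / root (t - 1) (cdf (distr N borel X) x)) \<longlongrightarrow> a) (at_right 0) \<and>
      (\<forall>n. prob_space (M n) \<and>
           prob_space.indep_vars (M n) (\<lambda>_. borel) (W n) (nsets {..<n} t) \<and>
           (\<forall>e\<in>nsets {..<n} t. distr (M n) borel (W n e) = distr N borel X))
      \<longrightarrow> (\<forall>\<epsilon>>0.
            (\<lambda>n. measure (M n) {\<omega> \<in> space (M n).
                mst_weight {..<n} (nsets {..<n} t) (\<lambda>e. W n e \<omega>)
                  \<in> {a * L_const t - \<epsilon><..<a * U_const t + \<epsilon>}}) \<longlonglongrightarrow> 1))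
     \<and> (\<lambda>s. U_const s / L_const s) \<in> O(\<lambda>s. ln (real s))"
proof (intro conjI impI allI)
  show "(\<lambda>s. U_const s / L_const s) \<in> O(\<lambda>s. ln (real s))" by (rule U_L_ratio)
next
  fix \<epsilon> :: real assume \<epsilon>: "0 < \<epsilon>"
  assume h: "2 \<le> t \<and>
      prob_space N \<and> X \<in> borel_measurable N \<and> (AE \<omega> in N. 0 < X \<omega>) \<and>
      0 < a \<and>
      ((\<lambda>x. x / root (t - 1) (cdf (distr N borel X) x)) \<longlongrightarrow> a) (at_right 0) \<and>
      (\<forall>n. prob_space (M n) \<and>
           prob_space.indep_vars (M n) (\<lambda>_. borel) (W n) (nsets {..<n} t) \<and>
           (\<forall>e\<in>nsets {..<n} t. distr (M n) borel (W n e) = distr N borel X))"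
  define r where "r = t - 1"
  have t: "t = Suc r" "0 < r" using h by (auto simp: r_def)
  let ?D = "distr N borel X"
  interpret N: prob_space N using h by blast
  have X: "X \<in> borel_measurable N" using h by blast
  have D: "real_distribution ?D" by (rule N.real_distribution_distr[OF X])
  have "cdf ?D 0 = measure N {\<omega> \<in> space N. X \<omega> \<le> 0}"
    unfolding cdf_def using X by (subst measure_distr) (auto intro!: arg_cong[where f = "measure N"])
  also have "\<dots> = 0"
  proof -
    have "AE \<omega> in N. \<not> X \<omega> \<le> 0" using h by (auto simp: not_le)
    moreover have "{\<omega> \<in> space N. X \<omega> \<le> 0} \<in> sets N" using X by measurable
    ultimately have "emeasure N {\<omega> \<in> space N. X \<omega> \<le> 0} = 0"
      using AE_iff_measurable[of "{\<omega> \<in> space N. X \<omega> \<le> 0}" N "\<lambda>\<omega>. \<not> X \<omega> \<le> 0"] by simp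
    then show ?thesis by (simp add: measure_def)
  qed
  finally have F0: "cdf ?D 0 = 0" .
  have "((\<lambda>x. x / root r (cdf ?D x)) \<longlongrightarrow> a) (at_right 0)" using h by (simp add: r_def)
  then have F_lim: "((\<lambda>x. cdf ?D x / x ^ r) \<longlongrightarrow> 1 / a ^ r) (at_right 0)"
    using h t(2) by (intro cdf_asymptotics) (auto simp: cdf_def)
  interpret random_weights r a ?D M W
  proof (rule random_weights.intro)
    show "0 < r" "real_distribution ?D" "cdf ?D 0 = 0" by (rule t(2), rule D, rule F0)
    show "((\<lambda>x. cdf ?D x / x ^ r) \<longlongrightarrow> 1 / a ^ r) (at_right 0)" by (rule F_lim)
    show "0 < a" using h by blast
    show "prob_space (M n)" for n using h by blast
    show "prob_space.indep_vars (M n) (\<lambda>_. borel) (W n) (nsets {..<n} (Suc r))" for n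
      using h unfolding t(1)[symmetric] by blast
    show "distr (M n) borel (W n e) = ?D" if "e \<in> nsets {..<n} (Suc r)" for n e
      using h that unfolding t(1)[symmetric] by blast
  qed
  show "(\<lambda>n. measure (M n) {\<omega> \<in> space (M n).
      mst_weight {..<n} (nsets {..<n} t) (\<lambda>e. W n e \<omega>)
        \<in> {a * L_const t - \<epsilon><..<a * U_const t + \<epsilon>}}) \<longlonglongrightarrow> 1"
    unfolding t by (rule mst_concentration[OF \<epsilon>])
qed

end
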